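(* Let the Pick matrix $P$ of an interpolation data set be invertible, let $\varphi\in\widetilde{\mathbf{N}}_0$, let $w=\mathbf{T}_\Theta[\varphi]$, and let $x_i$ be an interpolation node with $i\in\{1,\dots,\ell\}$. Suppose that $\tilde e_i\neq0$. Then: 1. The nontangential boundary limits $w'(x_i)$ and $w(x_i)$ exist and satisfy $w'(x_i)=\gamma_i$ and $w(x_i)=w_i$ if and only if $\varphi$ meets either condition $\mathbf C_1$ or $\mathbf C_2$ at $x_i$. 2. The nontangential boundary limits $w'(x_i)$ and $w(x_i)$ exist and satisfy $-\infty<w'(x_i)<\gamma_i$ and $w(x_i)=w_i$ if and only if $\varphi$ meets condition $\mathbf C_3$ at $x_i$. 3. The nontangential boundary limits $w'(x_i)$ and $w(x_i)$ exist and satisfy $\gamma_i<w'(x_i)<\infty$ and $w(x_i)=w_i$ if and only if $\varphi$ meets condition $\mathbf C_4$ at $x_i$. 4. If $\varphi$ meets condition $\mathbf C_5$ at $x_i$, then one of the following holds: (a) the nontangential boundary limit $w(x_i)$ fails to exist; (b) the limit $w(x_i)$ exists and $w(x_i)\ne w_i$; (c) $w(x_i)=w_i$ and $|K_w(x_i,x_i)|=\infty$. 5. If $\varphi$ meets condition $\mathbf C_6$ at $x_i$, then the nontangential boundary limit $w(x_i)$ exists and $w(x_i)\ne w_i$.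
   Context: Classes. $\mathbb{C}^+$ is the open upper half plane. For $f$ meromorphic on $\mathbb{C}^+$, $K_f(z,\zeta)=\frac{f(z)-\overline{f(\zeta)}}{z-\bar\zeta}$. $\mathbf{N}_0$ is the Nevanlinna class (functions analytic on $\mathbb{C}^+$ with nonnegative imaginary part) and $\widetilde{\mathbf{N}}_0=\mathbf{N}_0\cup\{\infty\}$, where $\infty$ is the function identically $\infty$. Boundary limits. For $x\in\mathbb{R}$, $f(x)$, $f'(x)$ and $K_f(x,x)$ denote the nontangential limits as $z\to x$ of $f(z)$, $f'(z)$ and $K_f(z,z)$, when they exist (the limit $f(x)$ may be $\infty$). Data. $x_1,\dots,x_n$ are distinct real numbers (nodes), $0\le\ell\le n$, $w_j,\gamma_j\in\mathbb{R}$ $(1\le j\le\ell)$, $\xi_k\in\mathbb{R}\setminus\{0\}$ $(\ell<k\le n)$. The Pick matrix $P=[p_{ij}]_{i,j=1}^n$ is the real symmetric matrix with: $p_{ij}=\frac{w_j-w_i}{x_j-x_i}$ for $i\ne j$ and $p_{ii}=\gamma_i$, for $i,j\le\ell$; $p_{ij}=p_{ji}=\frac{\xi_j}{x_j-x_i}$ for $i\le\ell<j$; $p_{ii}=-\xi_i$ and $p_{ij}=0$ $(i\neq j)$ for $i,j>\ell$. Also $X=\mathrm{diag}(x_1,\dots,x_n)$, $C=[w_1\ \cdots\ w_\ell\ \xi_{\ell+1}\ \cdots\ \xi_n]$, $E=[1\ \cdots\ 1\ 0\ \cdots\ 0]$ ($\ell$ ones), $J=\begin{bmatrix}0&-i\\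 i&0\end{bmatrix}$. For $P$ invertible, $\Theta(z)=[\Theta_{ij}(z)]_{i,j=1}^2=I_2-i\begin{bmatrix}C\\ E\end{bmatrix}(zI-X)^{-1}P^{-1}\begin{bmatrix}C^*&E^*\end{bmatrix}J$ and $\mathbf{T}_\Theta[\varphi]=\frac{\Theta_{11}\varphi+\Theta_{12}}{\Theta_{21}\varphi+\Theta_{22}}$, with $\mathbf{T}_\Theta[\infty]=\Theta_{11}/\Theta_{21}$ ($\mathbf{T}_\Theta[\varphi]\equiv\infty$ if the denominator vanishes identically). Let $\tilde c_i$, $\tilde e_i$ be the $i$-th entries of the row vectors $CP^{-1}$, $EP^{-1}$ (real), $\eta_i=\tilde c_i/\tilde e_i$, and $\tilde p_{ii}$ the $i$-th diagonal entry of $P^{-1}$. Conditions on $\varphi\in\widetilde{\mathbf{N}}_0$ at $x_i$ when $\tilde e_i\ne0$ (exactly one holds): $\mathbf C_1$: the limit $\varphi(x_i)$ does not exist, or exists and is not equal to $\eta_i$. $\mathbf C_2$: $\varphi(x_i)=\eta_i$ and $K_\varphi(x_i,x_i)=\infty$. $\mathbf C_3$: $\varphi(x_i)=\eta_i$ and $-\tilde p_{ii}/\tilde e_i^2<\varphi'(x_i)<\infty$. $\mathbf C_4$: $\varphi(x_i)=\eta_i$ and $0\le\varphi'(x_i)<-\tilde p_{ii}/\tilde e_i^2$. $\mathbf C_5$: $\varphi(x_i)=\eta_i$ and $\varphi'(x_i)=-\tilde p_{ii}/\tilde e_i^2>0$. $\mathbf C_6$: $\varphi(x_i)=\eta_i$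 and $\varphi'(x_i)=\tilde p_{ii}=0$. *)

theory Defs
  imports
    "HOL-Analysis.Analysis"
    "Jordan_Normal_Form.Gauss_Jordan_Elimination"
    "Jordan_Normal_Form.Schur_Decomposition"
begin

section \<open>Sphere-valued functions on the upper half plane\<close>

text \<open>
  The Riemann sphere is the one-point compactification of the complex plane, \<open>None\<close> being the
  point at infinity. A meromorphic function on the upper half plane is represented by the map into
  the sphere which takes the value \<open>None\<close> at the poles; the function identically \<open>\<infinity>\<close> is the map
  which is \<open>None\<close> everywhere. Only the values on the upper half plane are ever used.
\<close>

type_synonym sphere = "complex option"

definition sphere_top :: "sphere topology" where
  "sphere_top = Alexandroff_compactification (euclidean :: complex topology)"

definition upper_half_plane :: "complex set" where
  "upper_half_plane = {z. Im z > 0}"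

definition nevanlinna :: "(complex \<Rightarrow> complex) set" where
  "nevanlinna = {f. f holomorphic_on upper_half_plane \<and> (\<forall>z\<in>upper_half_plane. Im (f z) \<ge> 0)}"

definition ext_nevanlinna :: "(complex \<Rightarrow> sphere) set" where
  "ext_nevanlinna =
     {f. (\<exists>g\<in>nevanlinna. \<forall>z\<in>upper_half_plane. f z = Some (g z)) \<or>
         (\<forall>z\<in>upper_half_plane. f z = None)}"

text \<open>
  A pole of a meromorphic function is a pole of its derivative. At a pole of \<open>f\<close> the kernel is not
  defined by the formula; it is given the value \<open>\<infinity>\<close> there.
\<close>

definition sphere_deriv :: "(complex \<Rightarrow> sphere) \<Rightarrow> complex \<Rightarrow> sphere" where
  "sphere_deriv f z = (case f z of None \<Rightarrow> None | Some _ \<Rightarrow> Some (deriv (\<lambda>u. the (f u)) z))"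

definition nev_kernel :: "(complex \<Rightarrow> sphere) \<Rightarrow> complex \<Rightarrow> complex \<Rightarrow> sphere" where
  "nev_kernel f z \<zeta> =
     (case (f z, f \<zeta>) of
        (Some a, Some b) \<Rightarrow> Some ((a - cnj b) / (z - cnj \<zeta>))
      | _ \<Rightarrow> None)"

definition stolz_sector :: "real \<Rightarrow> real \<Rightarrow> complex set" where
  "stolz_sector x a = {z \<in> upper_half_plane. \<bar>Re z - x\<bar> \<le> a * Im z}"

definition nt_limit :: "(complex \<Rightarrow> sphere) \<Rightarrow> real \<Rightarrow> sphere \<Rightarrow> bool" where
  "nt_limit f x L \<longleftrightarrow>
     (\<forall>a>0. limitin sphere_top f L (at (complex_of_real x) within stolz_sector x a))"


section \<open>Interpolation data and the associated matrices\<close>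

text \<open>
  Indices start at \<open>0\<close>: the regular nodes are those with index \<open>i < nreg D\<close>, the singular ones
  those with \<open>nreg D \<le> i < nnodes D\<close>. The fields \<open>wval\<close> and \<open>gam\<close> matter only at regular indices,
  the field \<open>xi\<close> only at singular ones.
\<close>

record interp_data =
  nnodes :: nat
  nreg :: nat
  node :: "nat \<Rightarrow> real"
  wval :: "nat \<Rightarrow> real"
  gam :: "nat \<Rightarrow> real"
  xi :: "nat \<Rightarrow> real"

definition valid_data :: "interp_data \<Rightarrow> bool" where
  "valid_data D \<longleftrightarrow>
     nreg D \<le> nnodes D \<and>
     inj_on (node D) {..<nnodes D} \<and>
     (\<forall>k. nreg D \<le> k \<and> k < nnodes D \<longrightarrow> xi D k \<noteq> 0)"

definition pick_entry :: "interp_data \<Rightarrow> nat \<Rightarrow> nat \<Rightarrow> real" where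
  "pick_entry D i j =
     (if i < nreg D \<and> j < nreg D then
        (if i = j then gam D i else (wval D j - wval D i) / (node D j - node D i))
      else if i < nreg D then xi D j / (node D j - node D i)
      else if j < nreg D then xi D i / (node D i - node D j)
      else (if i = j then - xi D i else 0))"

definition pick_matrix :: "interp_data \<Rightarrow> real mat" where
  "pick_matrix D = Matrix.mat (nnodes D) (nnodes D) (\<lambda>(i, j). pick_entry D i j)"

definition C_row :: "interp_data \<Rightarrow> real mat" where
  "C_row D = Matrix.mat 1 (nnodes D) (\<lambda>(_, j). if j < nreg D then wval D j else xi D j)"

definition E_row :: "interp_data \<Rightarrow> real mat" where
  "E_row D = Matrix.mat 1 (nnodes D) (\<lambda>(_, j). if j < nreg D then 1 else 0)"

definition X_mat :: "interp_data \<Rightarrow> real mat" where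
  "X_mat D = mat_diag (nnodes D) (node D)"

definition J_mat :: "complex mat" where
  "J_mat = mat_of_rows_list 2 [[0, - \<i>], [\<i>, 0]]"

text \<open>Meaningful for invertible matrices only.\<close>

definition mat_inv :: "'a :: field mat \<Rightarrow> 'a mat" where
  "mat_inv A = the (mat_inverse A)"

abbreviation cmat :: "real mat \<Rightarrow> complex mat" where
  "cmat A \<equiv> map_mat complex_of_real A"

definition Theta :: "interp_data \<Rightarrow> complex \<Rightarrow> complex mat" where
  "Theta D z =
     (let CE = cmat (C_row D) @\<^sub>r cmat (E_row D)
      in 1\<^sub>m 2 - \<i> \<cdot>\<^sub>m (CE * mat_inv (z \<cdot>\<^sub>m 1\<^sub>m (nnodes D) - cmat (X_mat D))
                        * cmat (mat_inv (pick_matrix D)) * mat_adjoint CE * J_mat))"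

text \<open>
  The linear fractional transformation is evaluated pointwise. For invertible \<open>M\<close> the numerator does
  not vanish where the denominator does, so that the value there is \<open>\<infinity>\<close>.
\<close>

definition lin_frac :: "complex mat \<Rightarrow> sphere \<Rightarrow> sphere" where
  "lin_frac M s =
     (case s of
        Some v \<Rightarrow>
          (if M $$ (1,0) * v + M $$ (1,1) = 0 then None
           else Some ((M $$ (0,0) * v + M $$ (0,1)) / (M $$ (1,0) * v + M $$ (1,1))))
      | None \<Rightarrow>
          (if M $$ (1,0) = 0 then None else Some (M $$ (0,0) / M $$ (1,0))))"

definition T_Theta :: "interp_data \<Rightarrow> (complex \<Rightarrow> sphere) \<Rightarrow> complex \<Rightarrow> sphere" where
  "T_Theta D \<phi> = (\<lambda>z. lin_frac (Theta D z) (\<phi> z))"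

definition c_tilde :: "interp_data \<Rightarrow> nat \<Rightarrow> real" where
  "c_tilde D i = (C_row D * mat_inv (pick_matrix D)) $$ (0, i)"

definition e_tilde :: "interp_data \<Rightarrow> nat \<Rightarrow> real" where
  "e_tilde D i = (E_row D * mat_inv (pick_matrix D)) $$ (0, i)"

definition p_tilde :: "interp_data \<Rightarrow> nat \<Rightarrow> real" where
  "p_tilde D i = mat_inv (pick_matrix D) $$ (i, i)"

definition eta :: "interp_data \<Rightarrow> nat \<Rightarrow> real" where
  "eta D i = c_tilde D i / e_tilde D i"


section \<open>Boundary values and the conditions on the parameter\<close>

definition bd_value :: "(complex \<Rightarrow> sphere) \<Rightarrow> real \<Rightarrow> real \<Rightarrow> bool" where
  "bd_value f x a \<longleftrightarrow> nt_limit f x (Some (complex_of_real a))"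

definition bd_deriv :: "(complex \<Rightarrow> sphere) \<Rightarrow> real \<Rightarrow> real \<Rightarrow> bool" where
  "bd_deriv f x d \<longleftrightarrow> nt_limit (sphere_deriv f) x (Some (complex_of_real d))"

text \<open>
  The limit \<open>\<infinity>\<close> in the sphere means that the absolute value of the kernel tends to \<open>\<infinity>\<close>; on the
  diagonal the kernel of a Nevanlinna function is nonnegative, so that it then tends to \<open>+\<infinity>\<close>.
\<close>

definition bd_kernel_infinite :: "(complex \<Rightarrow> sphere) \<Rightarrow> real \<Rightarrow> bool" where
  "bd_kernel_infinite f x \<longleftrightarrow> nt_limit (\<lambda>z. nev_kernel f z z) x None"

definition cond_C1 :: "interp_data \<Rightarrow> (complex \<Rightarrow> sphere) \<Rightarrow> nat \<Rightarrow> bool" where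
  "cond_C1 D \<phi> i \<longleftrightarrow>
     \<not> (\<exists>L. nt_limit \<phi> (node D i) L) \<or>
     (\<exists>L. nt_limit \<phi> (node D i) L \<and> L \<noteq> Some (complex_of_real (eta D i)))"

definition cond_C2 :: "interp_data \<Rightarrow> (complex \<Rightarrow> sphere) \<Rightarrow> nat \<Rightarrow> bool" where
  "cond_C2 D \<phi> i \<longleftrightarrow>
     bd_value \<phi> (node D i) (eta D i) \<and> bd_kernel_infinite \<phi> (node D i)"

definition cond_C3 :: "interp_data \<Rightarrow> (complex \<Rightarrow> sphere) \<Rightarrow> nat \<Rightarrow> bool" where
  "cond_C3 D \<phi> i \<longleftrightarrow>
     bd_value \<phi> (node D i) (eta D i) \<and>
     (\<exists>d. bd_deriv \<phi> (node D i) d \<and> - p_tilde D i / (e_tilde D i)\<^sup>2 < d)"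

definition cond_C4 :: "interp_data \<Rightarrow> (complex \<Rightarrow> sphere) \<Rightarrow> nat \<Rightarrow> bool" where
  "cond_C4 D \<phi> i \<longleftrightarrow>
     bd_value \<phi> (node D i) (eta D i) \<and>
     (\<exists>d. bd_deriv \<phi> (node D i) d \<and> 0 \<le> d \<and> d < - p_tilde D i / (e_tilde D i)\<^sup>2)"

definition cond_C5 :: "interp_data \<Rightarrow> (complex \<Rightarrow> sphere) \<Rightarrow> nat \<Rightarrow> bool" where
  "cond_C5 D \<phi> i \<longleftrightarrow>
     bd_value \<phi> (node D i) (eta D i) \<and>
     (\<exists>d. bd_deriv \<phi> (node D i) d \<and> d = - p_tilde D i / (e_tilde D i)\<^sup>2 \<and> d > 0)"

definition cond_C6 :: "interp_data \<Rightarrow> (complex \<Rightarrow> sphere) \<Rightarrow> nat \<Rightarrow> bool" where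
  "cond_C6 D \<phi> i \<longleftrightarrow>
     bd_value \<phi> (node D i) (eta D i) \<and> bd_deriv \<phi> (node D i) 0 \<and> p_tilde D i = 0"

end

theory Submission
  imports Defs "HOL-Complex_Analysis.Complex_Analysis"
begin

text \<open>
  Write \<open>x\<close> for the node and \<open>t = z - x\<close>. For a Nevanlinna function \<open>\<phi>\<close> the quotient
  \<open>(\<phi> z - \<eta>) / t\<close> always has a nontangential limit \<open>d \<in> [0, \<infinity>]\<close> at \<open>x\<close>: either \<open>\<phi>\<close> is the
  constant \<open>\<eta>\<close>, or \<open>g = - 1 / (\<phi> - \<eta>)\<close> is again a Nevanlinna function and \<open>t * g z\<close> has a
  finite limit, by the Schwarz--Pick lemma. Clearing the pole of \<open>\<Theta>\<close> at \<open>x\<close>, the Lyapunov identities for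
  the Pick matrix and its inverse give \<open>(w z - w_i) / t \<longrightarrow> \<gamma>_i - 1 / (e\<^sup>2 d + p)\<close>, where \<open>e\<close> and
  \<open>p\<close> are the \<open>i\<close>-th entry of \<open>E P^-1\<close> and the \<open>i\<close>-th diagonal entry of \<open>P^-1\<close>, so the
  conditions \<open>C1\<close>--\<open>C6\<close> are distinguished by \<open>d\<close>. Cauchy estimates on discs inside a larger sector turn limits
  of difference quotients into limits of derivatives. When \<open>e\<^sup>2 d + p = 0\<close> and \<open>d > 0\<close>, split the mass at \<open>x\<close>
  off \<open>g\<close>: the transform becomes a fractional linear image, with real coefficients regular at \<open>x\<close>, of
  a Nevanlinna function \<open>h\<close> without mass at \<open>x\<close>; if \<open>w\<close> tends to \<open>w_i\<close> then \<open>h\<close> tends to infinity, and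
  Julia's inequality for \<open>- 1 / h\<close> makes the kernel infinite.
\<close>

section \<open>Nontangential limits in the sphere\<close>

text \<open>The Pick matrix need not be definite, so \<open>w\<close> may have poles and values
  below the axis, and no boundary theorem for Nevanlinna functions applies to it directly. All
  information is taken from \<open>\<phi>\<close> and carried through the explicit transform;
  sphere-valued limits absorb the poles.

  The reverse implications cost nothing extra: \<open>d\<close> is computed for every
  \<open>\<phi>\<close>, so both sides of each equivalence become statements on the sign of
  \<open>e\<^sup>2 d + p\<close>. It remains to see that \<open>w\<close>, if it tends to
  \<open>w_i\<close>, has no finite derivative when this number is 0; there the denominator of the
  correction to \<open>\<gamma>_i\<close> tends to 0 while its numerator tends to
  \<open>- 1 / e\<close>.

  The mass of \<open>g\<close> at \<open>x\<close> is an infimum, the largest multiple of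
  \<open>- 1 / t\<close> that can be subtracted, so no integral representation enters. A finite
  \<open>d\<close> with \<open>\<phi>\<close> not identically \<open>\<eta>\<close> is 1 over this
  mass, hence positive. So \<open>d = 0\<close> means that \<open>\<phi>\<close> is the constant
  \<open>\<eta>\<close>, which separates C6 from C5: in C6 the transform is computed outright, in C5
  the leading terms cancel and the remainder \<open>h\<close>, of which only
  \<open>t * h \<longrightarrow> 0\<close> is known, governs \<open>w\<close>.\<close>

abbreviation ntf :: "real \<Rightarrow> real \<Rightarrow> complex filter" where
  "ntf x a \<equiv> at (complex_of_real x) within stolz_sector x a"

text \<open>\<open>the None\<close> is an arbitrary complex number, so eventual finiteness has to be
  recorded beside the convergence of \<open>the (f z)\<close>. Images of open sets under
  \<open>Some\<close> are open in the compactification, which yields both parts.\<close>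

lemma limitin_sphere_Some:
  "limitin sphere_top f (Some c) F \<longleftrightarrow>
     (\<forall>\<^sub>F z in F. f z \<noteq> None) \<and> ((\<lambda>z. the (f z)) \<longlongrightarrow> c) F"
proof
  assume L: "limitin sphere_top f (Some c) F"
  have ev: "\<forall>\<^sub>F z in F. f z \<in> Some ` U" if "open U" "c \<in> U" for U
    using L that unfolding limitin_def sphere_top_def by auto
  have "\<forall>\<^sub>F z in F. f z \<noteq> None"
    using ev[of UNIV] by (auto elim!: eventually_mono)
  moreover have "((\<lambda>z. the (f z)) \<longlongrightarrow> c) F"
  proof (rule topological_tendstoI)
    fix U assume "open U" "c \<in> U"
    from ev[OF this] show "\<forall>\<^sub>F z in F. the (f z) \<in> U"
      by (auto elim!: eventually_mono)
  qed
  ultimately show "(\<forall>\<^sub>F z in F. f z \<noteq> None) \<and> ((\<lambda>z. the (f z)) \<longlongrightarrow> c) F" ..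
next
  assume R: "(\<forall>\<^sub>F z in F. f z \<noteq> None) \<and> ((\<lambda>z. the (f z)) \<longlongrightarrow> c) F"
  show "limitin sphere_top f (Some c) F"
    unfolding limitin_def
  proof (intro conjI allI impI)
    show "Some c \<in> topspace sphere_top" by (simp add: sphere_top_def)
    fix V assume "openin sphere_top V \<and> Some c \<in> V"
    then have "openin sphere_top V" "Some c \<in> V" by auto
    have "openin euclidean {u \<in> topspace euclidean. Some u \<in> V}"
      using openin_continuous_map_preimage[OF continuous_map_Some \<open>openin sphere_top V\<close>[unfolded sphere_top_def]] .
    then have V: "open (Some -` V)" "c \<in> Some -` V"
      using \<open>Some c \<in> V\<close> by (simp_all add: vimage_def)
    have "\<forall>\<^sub>F z in F. the (f z) \<in> Some -` V"
      using R V topological_tendstoD by blast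
    moreover have "\<forall>\<^sub>F z in F. f z \<noteq> None" using R ..
    ultimately show "\<forall>\<^sub>F z in F. f z \<in> V"
      by eventually_elim auto
  qed
qed

text \<open>Neighbourhoods of \<open>None\<close> are complements of compact sets, and compact sets
  lie in balls. Poles satisfy the condition vacuously.\<close>

lemma limitin_sphere_None:
  "limitin sphere_top f None F \<longleftrightarrow>
     (\<forall>M. \<forall>\<^sub>F z in F. \<forall>v. f z = Some v \<longrightarrow> M < norm v)"
proof
  assume L: "limitin sphere_top f None F"
  show "\<forall>M. \<forall>\<^sub>F z in F. \<forall>v. f z = Some v \<longrightarrow> M < norm v"
  proof
    fix M :: real
    let ?V = "topspace sphere_top - Some ` (cball 0 M)"
    have "openin sphere_top ?V"
      unfolding sphere_top_def openin_Alexandroff_compactification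
      by (intro disjI2 exI[of _ "cball 0 M"]) (auto simp: compactin_euclidean_iff)
    moreover have "None \<in> ?V" by (auto simp: sphere_top_def)
    ultimately have "\<forall>\<^sub>F z in F. f z \<in> ?V" using L unfolding limitin_def by blast
    then show "\<forall>\<^sub>F z in F. \<forall>v. f z = Some v \<longrightarrow> M < norm v"
      by eventually_elim (force simp: not_le[symmetric])
  qed
next
  assume R: "\<forall>M. \<forall>\<^sub>F z in F. \<forall>v. f z = Some v \<longrightarrow> M < norm v"
  show "limitin sphere_top f None F"
    unfolding limitin_def
  proof (intro conjI allI impI)
    show "None \<in> topspace sphere_top" by (simp add: sphere_top_def)
    fix V assume "openin sphere_top V \<and> None \<in> V"
    then have "openin sphere_top V" "None \<in> V" by auto
    then obtain K :: "complex set" where K: "compactin euclidean K" "V = insert None (Some ` (UNIV - K))"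
      unfolding sphere_top_def openin_Alexandroff_compactification topspace_euclidean by blast
    have "compact K" using K(1) by (simp only: compactin_euclidean_iff)
    then obtain M where M: "\<And>v. v \<in> K \<Longrightarrow> norm v \<le> M"
      using compact_imp_bounded[OF \<open>compact K\<close>] unfolding bounded_iff by auto
    have "\<forall>\<^sub>F z in F. \<forall>v. f z = Some v \<longrightarrow> M < norm v" using R by blast
    then show "\<forall>\<^sub>F z in F. f z \<in> V"
    proof eventually_elim
      case (elim z)
      then show ?case using K M by (cases "f z") (force simp: not_le[symmetric])+
    qed
  qed
qed

lemma nt_limit_Some:
  "nt_limit f x (Some c) \<longleftrightarrow>
    (\<forall>a>0. (\<forall>\<^sub>F z in ntf x a. f z \<noteq> None) \<and> ((\<lambda>z. the (f z)) \<longlongrightarrow> c) (ntf x a))"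
  by (simp add: nt_limit_def limitin_sphere_Some)

lemma nt_limit_None:
  "nt_limit f x None \<longleftrightarrow>
    (\<forall>a>0. \<forall>M. \<forall>\<^sub>F z in ntf x a. \<forall>v. f z = Some v \<longrightarrow> M < norm v)"
  by (simp add: nt_limit_def limitin_sphere_None)

section \<open>The filter of nontangential approach\<close>

lemma eventually_ntf:
  "eventually P (ntf x a) \<longleftrightarrow>
     (\<exists>d>0. \<forall>z\<in>stolz_sector x a. norm (z - of_real x) < d \<longrightarrow> P z)"
proof -
  have "of_real x \<notin> stolz_sector x a" by (simp add: stolz_sector_def upper_half_plane_def)
  then show ?thesis unfolding eventually_at dist_norm by metis
qed

lemma eventually_ntf_sector: "\<forall>\<^sub>F z in ntf x a. z \<in> stolz_sector x a"
  by (auto simp: eventually_ntf intro: exI[of _ 1])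

lemma eventually_ntf_upper: "\<forall>\<^sub>F z in ntf x a. Im z > 0"
  using eventually_ntf_sector by eventually_elim (auto simp: stolz_sector_def upper_half_plane_def)

lemma stolz_sector_norm_le:
  assumes "z \<in> stolz_sector x a" "a > 0"
  shows "norm (z - of_real x) \<le> (1 + a) * Im z"
proof -
  have "norm (z - of_real x) \<le> \<bar>Re (z - of_real x)\<bar> + \<bar>Im (z - of_real x)\<bar>" by (rule cmod_le)
  then show ?thesis
    using assms by (auto simp: stolz_sector_def upper_half_plane_def algebra_simps)
qed

text \<open>The ray above \<open>x\<close> lies in every sector. It shows the filters to be proper
  and is the path along which incompatible limits are compared.\<close>

definition vert :: "real \<Rightarrow> real \<Rightarrow> complex" where
  "vert x y = Complex x y"

lemma vert_simps [simp]: "Re (vert x y) = x" "Im (vert x y) = y"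
  "vert x y - of_real x = \<i> * of_real y"
  by (auto simp: vert_def complex_eq_iff)

lemma vert_in_sector: "a > 0 \<Longrightarrow> y > 0 \<Longrightarrow> vert x y \<in> stolz_sector x a"
  by (auto simp: stolz_sector_def upper_half_plane_def)

lemma filterlim_vert:
  assumes "a > 0"
  shows "filterlim (vert x) (ntf x a) (at_right 0)"
  unfolding filterlim_def le_filter_def eventually_filtermap
proof (intro allI impI)
  fix P assume "eventually P (ntf x a)"
  then obtain d where d: "d > 0" "\<And>z. z \<in> stolz_sector x a \<Longrightarrow> norm (z - of_real x) < d \<Longrightarrow> P z"
    unfolding eventually_ntf by auto
  then have "P (vert x y)" if "0 < y" "y < d" for y
    using that vert_in_sector[OF assms] by (auto simp: norm_mult)
  then show "\<forall>\<^sub>F y in at_right 0. P (vert x y)"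
    using d(1) eventually_at_right_field by blast
qed

lemma ntf_nontrivial: "a > 0 \<Longrightarrow> ntf x a \<noteq> bot"
  using filterlim_vert[of a x] unfolding filterlim_def
  by (metis filtermap_bot_iff le_bot trivial_limit_at_right_real)

lemma ntf_le_at: "ntf x a \<le> at (of_real x)"
  by (simp add: at_le)

lemma tendsto_ident_ntf: "((\<lambda>z. z) \<longlongrightarrow> of_real x) (ntf x a)"
  by (rule tendsto_ident_at)

lemma tendsto_diff_ntf: "((\<lambda>z. z - of_real x) \<longlongrightarrow> 0) (ntf x a)"
  using tendsto_ident_ntf[of x a] by (simp only: Lim_null[symmetric])

lemma nt_limit_unique:
  assumes "nt_limit f x L" "nt_limit f x L'"
  shows "L = L'"
proof -
  have False if S: "nt_limit f x (Some c)" and N: "nt_limit f x None" for c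
  proof -
    have "\<forall>\<^sub>F z in ntf x 1. f z \<noteq> None" "((\<lambda>z. the (f z)) \<longlongrightarrow> c) (ntf x 1)"
      using S unfolding nt_limit_Some by auto
    then have "\<forall>\<^sub>F z in ntf x 1. norm (the (f z)) < norm c + 1"
      using order_tendstoD(2)[OF tendsto_norm, of _ c "ntf x 1" "norm c + 1"] by simp
    moreover have "\<forall>\<^sub>F z in ntf x 1. \<forall>v. f z = Some v \<longrightarrow> norm c + 1 < norm v"
      using N unfolding nt_limit_None by auto
    moreover note \<open>\<forall>\<^sub>F z in ntf x 1. f z \<noteq> None\<close>
    ultimately have "\<forall>\<^sub>F z in ntf x 1. False"
      by eventually_elim force
    then show False using ntf_nontrivial[of 1 x] by simp
  qed
  moreover have "c = c'" if "nt_limit f x (Some c)" "nt_limit f x (Some c')" for c c'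
    using that tendsto_unique[OF ntf_nontrivial[of 1 x], of "\<lambda>z. the (f z)" c c']
    unfolding nt_limit_Some by auto
  ultimately show ?thesis using assms by (cases L; cases L') auto
qed

section \<open>Difference quotients and derivatives\<close>

text \<open>Poles are exempt, so the notion covers transforms that take the value
  \<open>None\<close> inside the half plane.\<close>

definition sphere_regular :: "(complex \<Rightarrow> sphere) \<Rightarrow> bool" where
  "sphere_regular f \<longleftrightarrow>
     (\<forall>z\<in>upper_half_plane. f z \<noteq> None \<longrightarrow> (\<lambda>u. the (f u)) field_differentiable at z)"

text \<open>In a sector \<open>norm (z - x)\<close> is comparable to \<open>Im z\<close>, so discs
  of radius proportional to \<open>Im z\<close> suit a Cauchy estimate. On the disc
  \<open>Im u \<ge> Im z / 2\<close>, and
  \<open>a * Im z + Im z / 2 = (2 * a + 1) * (Im z / 2)\<close> gives the aperture.\<close>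

lemma sector_cball:
  assumes z: "z \<in> stolz_sector x a" and a: "a > 0"
    and u: "u \<in> cball z (Im z / 2)"
  shows "u \<in> stolz_sector x (2 * a + 1)" "norm (u - of_real x) \<le> (2 + a) * Im z"
proof -
  have zI: "Im z > 0" "\<bar>Re z - x\<bar> \<le> a * Im z"
    using z by (auto simp: stolz_sector_def upper_half_plane_def)
  have n: "norm (u - z) \<le> Im z / 2" using u by (simp add: dist_norm norm_minus_commute)
  have i: "\<bar>Im u - Im z\<bar> \<le> Im z / 2" "\<bar>Re u - Re z\<bar> \<le> Im z / 2"
    using n abs_Im_le_cmod[of "u - z"] abs_Re_le_cmod[of "u - z"] by auto
  have uI: "Im u \<ge> Im z / 2" using i by linarith
  have "\<bar>Re u - x\<bar> \<le> a * Im z + Im z / 2" using i zI by linarith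
  also have "\<dots> = (2 * a + 1) * (Im z / 2)" by (simp add: algebra_simps)
  also have "\<dots> \<le> (2 * a + 1) * Im u" using uI a by (intro mult_left_mono) auto
  finally show "u \<in> stolz_sector x (2 * a + 1)"
    using uI zI by (auto simp: stolz_sector_def upper_half_plane_def)
  have "norm (u - of_real x) \<le> norm (u - z) + norm (z - of_real x)"
    using norm_triangle_ineq[of "u - z" "z - of_real x"] by simp
  then show "norm (u - of_real x) \<le> (2 + a) * Im z"
    using n stolz_sector_norm_le[OF z a] zI by (simp add: algebra_simps)
qed

text \<open>The remainder \<open>U\<close> of the linear approximation is small against the distance
  to \<open>x\<close> in the wider sector. Cauchy's estimate divides it by \<open>Im z / 2\<close>,
  which is comparable to that distance, so \<open>deriv U z = deriv F z - L\<close> tends to 0. The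
  discs leave the sector of \<open>z\<close>, hence the hypotheses for every aperture.\<close>

lemma deriv_limit_of_quotient_limit:
  fixes F :: "complex \<Rightarrow> complex"
  assumes dq: "\<And>a. a > 0 \<Longrightarrow> ((\<lambda>z. (F z - c) / (z - of_real x)) \<longlongrightarrow> L) (ntf x a)"
    and diff: "\<And>a. a > 0 \<Longrightarrow> \<forall>\<^sub>F z in ntf x a. F field_differentiable at z"
    and a: "a > 0"
  shows "(deriv F \<longlongrightarrow> L) (ntf x a)"
proof (rule tendstoI)
  fix \<epsilon> :: real assume \<epsilon>: "\<epsilon> > 0"
  define b where "b = 2 * a + 1"
  have b: "b > 0" using a by (simp add: b_def)
  \<comment> \<open>Cauchy's bound will be \<open>2 * \<delta> * (2 + a)\<close>, which this choice
    makes \<open>\<epsilon> / 2\<close>.\<close>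
  define \<delta> where "\<delta> = \<epsilon> / (4 * (2 + a))"
  have \<delta>: "\<delta> > 0" using \<epsilon> a by (simp add: \<delta>_def)
  have "\<forall>\<^sub>F z in ntf x b. dist ((F z - c) / (z - of_real x)) L < \<delta>"
    using dq[OF b] \<delta> by (rule tendstoD)
  with diff[OF b] have "\<forall>\<^sub>F z in ntf x b. F field_differentiable at z \<and>
      dist ((F z - c) / (z - of_real x)) L < \<delta>"
    by eventually_elim auto
  then obtain d where d: "d > 0" "\<And>z. z \<in> stolz_sector x b \<Longrightarrow> norm (z - of_real x) < d \<Longrightarrow>
      F field_differentiable at z \<and> dist ((F z - c) / (z - of_real x)) L < \<delta>"
    unfolding eventually_ntf by auto
  have "dist (deriv F z) L < \<epsilon>" if z: "z \<in> stolz_sector x a" and zd: "norm (z - of_real x) < d / (2 + a)" for z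
  proof -
    have Iz: "Im z > 0" using z by (auto simp: stolz_sector_def upper_half_plane_def)
    have "Im z \<le> norm (z - of_real x)" using abs_Im_le_cmod[of "z - of_real x"] by simp
    then have "Im z < d / (2 + a)" using zd by linarith
    then have "(2 + a) * Im z < d" using a by (simp add: pos_less_divide_eq mult.commute)
    then have *: "u \<in> stolz_sector x b \<and> norm (u - of_real x) < d \<and> norm (u - of_real x) \<le> (2 + a) * Im z"
      if "u \<in> cball z (Im z / 2)" for u
      using sector_cball[OF z a that] unfolding b_def by auto
    define U where "U = (\<lambda>u. F u - (c + L * (u - of_real x)))"
    have Fd: "F field_differentiable at u" if "u \<in> cball z (Im z / 2)" for u
      using * d(2) that by blast
    have Ud: "U field_differentiable at u" if "u \<in> cball z (Im z / 2)" for u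
      unfolding U_def by (intro derivative_intros Fd that)
    have bound: "norm (U u) \<le> \<delta> * ((2 + a) * Im z)" if "u \<in> cball z (Im z / 2)" for u
    proof -
      have un: "u - of_real x \<noteq> 0"
        using *[OF that] by (auto simp: stolz_sector_def upper_half_plane_def)
      have "U u = ((F u - c) / (u - of_real x) - L) * (u - of_real x)"
        unfolding left_diff_distrib using un by (simp add: U_def)
      then have "norm (U u) = norm ((F u - c) / (u - of_real x) - L) * norm (u - of_real x)"
        by (simp only: norm_mult)
      also have "\<dots> \<le> \<delta> * ((2 + a) * Im z)"
        using *[OF that] d(2)[of u] \<delta> by (intro mult_mono) (auto simp: dist_norm)
      finally show ?thesis .
    qed
    have "norm ((deriv ^^ 1) U z) \<le> fact 1 * (\<delta> * ((2 + a) * Im z)) / (Im z / 2) ^ 1"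
    proof (rule Cauchy_inequality)
      have hol: "U holomorphic_on cball z (Im z / 2)"
        unfolding holomorphic_on_def using Ud field_differentiable_at_within by blast
      show "U holomorphic_on ball z (Im z / 2)"
        by (rule holomorphic_on_subset[OF hol ball_subset_cball])
      show "continuous_on (cball z (Im z / 2)) U"
        by (rule holomorphic_on_imp_continuous_on[OF hol])
      show "norm (U u) \<le> \<delta> * ((2 + a) * Im z)" if "norm (z - u) = Im z / 2" for u
        using that by (intro bound) (simp add: dist_norm)
    qed (use Iz in simp)
    moreover have "deriv U z = deriv F z - L"
    proof (rule DERIV_imp_deriv)
      have "(F has_field_derivative deriv F z) (at z)"
        using Fd[of z] Iz by (simp add: field_differentiable_derivI)
      then show "(U has_field_derivative deriv F z - L) (at z)"
        unfolding U_def by (auto intro!: derivative_eq_intros)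
    qed
    moreover have "fact 1 * (\<delta> * ((2 + a) * Im z)) / (Im z / 2) ^ 1 = 2 * \<delta> * (2 + a)"
      using Iz by simp
    ultimately have "norm (deriv F z - L) \<le> 2 * \<delta> * (2 + a)"
      by simp
    also have "\<dots> = \<epsilon> / 2" using a unfolding \<delta>_def by (simp add: field_simps)
    also have "\<dots> < \<epsilon>" using \<epsilon> by simp
    finally show ?thesis by (simp add: dist_norm)
  qed
  then show "\<forall>\<^sub>F z in ntf x a. dist (deriv F z) L < \<epsilon>"
    unfolding eventually_ntf using d(1) a by (intro exI[of _ "d / (2 + a)"]) auto
qed

text \<open>The mean value inequality for \<open>U\<close> between heights \<open>s < y\<close>
  gives a bound \<open>\<epsilon> / 2 * (y - s)\<close>, and \<open>s\<close> may tend to 0. One ray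
  is enough to let a finite derivative contradict the behaviour of a quotient.\<close>

lemma quotient_limit_of_deriv_limit:
  fixes F :: "complex \<Rightarrow> complex"
  assumes a: "a > 0" and F: "(F \<longlongrightarrow> c) (ntf x a)" and dF: "(deriv F \<longlongrightarrow> d) (ntf x a)"
    and diff: "\<forall>\<^sub>F z in ntf x a. F field_differentiable at z"
  shows "((\<lambda>y. (F (vert x y) - c) / (vert x y - of_real x)) \<longlongrightarrow> d) (at_right 0)"
proof (rule tendstoI)
  fix \<epsilon> :: real assume \<epsilon>: "\<epsilon> > 0"
  have "\<forall>\<^sub>F z in ntf x a. dist (deriv F z) d < \<epsilon> / 2"
    using dF \<epsilon> by (intro tendstoD) auto
  with diff have "\<forall>\<^sub>F z in ntf x a. F field_differentiable at z \<and> dist (deriv F z) d < \<epsilon> / 2"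
    by eventually_elim auto
  then obtain \<delta> where \<delta>: "\<delta> > 0" "\<And>z. z \<in> stolz_sector x a \<Longrightarrow> norm (z - of_real x) < \<delta> \<Longrightarrow>
      F field_differentiable at z \<and> dist (deriv F z) d < \<epsilon> / 2"
    unfolding eventually_ntf by auto
  define U where "U = (\<lambda>z. F z - d * (z - of_real x))"
  \<comment> \<open>An open vertical segment: convex, and inside the sector where
    \<open>deriv F\<close> is within \<open>\<epsilon> / 2\<close> of \<open>d\<close>.\<close>
  define S where "S = {z. Re z = x} \<inter> ({z. 0 < Im z} \<inter> {z. Im z < \<delta>})"
  have "convex {z. Re z = x}"
    unfolding convex_alt by (auto simp: algebra_simps)
  then have "convex S"
    unfolding S_def by (intro convex_Int convex_halfspace_Im_gt convex_halfspace_Im_lt)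
  have inS: "F field_differentiable at z \<and> dist (deriv F z) d < \<epsilon> / 2" if "z \<in> S" for z
  proof -
    have eq: "vert x (Im z) = z" using that by (simp add: S_def complex_eq_iff)
    have "norm (z - of_real x) = Im z"
      using that vert_simps(3)[of x "Im z"] unfolding eq by (simp add: S_def norm_mult)
    then show ?thesis
      using that \<delta>(2)[of z] vert_in_sector[OF a, of "Im z" x] by (simp add: S_def eq)
  qed
  have diffU: "norm (U u - U v) \<le> \<epsilon> / 2 * norm (u - v)" if "u \<in> S" "v \<in> S" for u v
  proof (rule field_differentiable_bound[OF \<open>convex S\<close>, where f' = "\<lambda>z. deriv F z - d"])
    fix z assume "z \<in> S"
    then have "(F has_field_derivative deriv F z) (at z)"
      using inS by (simp add: field_differentiable_derivI)
    then have "(U has_field_derivative deriv F z - d) (at z)"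
      unfolding U_def by (auto intro!: derivative_eq_intros)
    then show "(U has_field_derivative deriv F z - d) (at z within S)"
      by (rule has_field_derivative_at_within)
    show "norm (deriv F z - d) \<le> \<epsilon> / 2" using inS \<open>z \<in> S\<close> by (force simp: dist_norm)
  qed (use that in auto)
  have Ulim: "((\<lambda>y. U (vert x y)) \<longlongrightarrow> c) (at_right 0)"
  proof -
    have "(U \<longlongrightarrow> c - d * 0) (ntf x a)"
      unfolding U_def by (intro tendsto_intros F tendsto_diff_ntf)
    then show ?thesis
      using filterlim_compose[OF _ filterlim_vert[OF a]] by simp
  qed
  have "dist ((F (vert x y) - c) / (vert x y - of_real x)) d < \<epsilon>" if y: "0 < y" "y < \<delta>" for y
  proof -
    have "((\<lambda>s. norm (U (vert x y) - U (vert x s))) \<longlongrightarrow> norm (U (vert x y) - c)) (at_right 0)"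
      by (intro tendsto_intros Ulim)
    moreover have "\<forall>\<^sub>F s in at_right 0. norm (U (vert x y) - U (vert x s)) \<le> \<epsilon> / 2 * y"
    proof -
      have "norm (U (vert x y) - U (vert x s)) \<le> \<epsilon> / 2 * y" if s: "0 < s" "s < y" for s
      proof -
        have "norm (U (vert x y) - U (vert x s)) \<le> \<epsilon> / 2 * norm (vert x y - vert x s)"
          using s y by (intro diffU) (auto simp: S_def)
        also have "norm (vert x y - vert x s) = y - s"
          using s by (simp add: cmod_def)
        also have "\<epsilon> / 2 * (y - s) \<le> \<epsilon> / 2 * y" using s \<epsilon> by (intro mult_left_mono) auto
        finally show ?thesis .
      qed
      then show ?thesis using y(1) eventually_at_right_field by blast
    qed
    ultimately have "norm (U (vert x y) - c) \<le> \<epsilon> / 2 * y"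
      by (intro tendsto_upperbound) auto
    moreover have "(F (vert x y) - c) / (vert x y - of_real x) - d = (U (vert x y) - c) / (vert x y - of_real x)"
      using y by (simp add: U_def diff_divide_distrib)
    ultimately have "norm ((F (vert x y) - c) / (vert x y - of_real x) - d) \<le> \<epsilon> / 2"
      using y by (simp add: norm_divide norm_mult field_simps)
    then show ?thesis using \<epsilon> by (simp add: dist_norm)
  qed
  then show "\<forall>\<^sub>F y in at_right 0. dist ((F (vert x y) - c) / (vert x y - of_real x)) d < \<epsilon>"
    using \<delta>(1) eventually_at_right_field by blast
qed

lemma sphere_regular_eventually:
  assumes "sphere_regular f" "\<forall>\<^sub>F z in ntf x a. f z \<noteq> None"
  shows "\<forall>\<^sub>F z in ntf x a. (\<lambda>u. the (f u)) field_differentiable at z"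
  using assms(2) eventually_ntf_upper
  by eventually_elim (use assms(1) in \<open>auto simp: sphere_regular_def upper_half_plane_def\<close>)

lemma sphere_deriv_eq:
  "f z \<noteq> None \<Longrightarrow> sphere_deriv f z = Some (deriv (\<lambda>u. the (f u)) z)"
  by (auto simp: sphere_deriv_def)

lemma nt_limit_of_quotient_limit:
  assumes reg: "sphere_regular f"
    and fin: "\<And>a. a > 0 \<Longrightarrow> \<forall>\<^sub>F z in ntf x a. f z \<noteq> None"
    and dq: "\<And>a. a > 0 \<Longrightarrow> ((\<lambda>z. (the (f z) - c) / (z - of_real x)) \<longlongrightarrow> L) (ntf x a)"
  shows "nt_limit f x (Some c)" "nt_limit (sphere_deriv f) x (Some L)"
proof -
  show "nt_limit f x (Some c)"
    unfolding nt_limit_Some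
  proof (intro allI impI conjI fin)
    fix a :: real assume a: "a > 0"
    have "((\<lambda>z. c + (the (f z) - c) / (z - of_real x) * (z - of_real x)) \<longlongrightarrow> c + L * 0) (ntf x a)"
      by (intro tendsto_intros dq a tendsto_diff_ntf)
    then show "((\<lambda>z. the (f z)) \<longlongrightarrow> c) (ntf x a)"
      by (rule Lim_transform_eventually[THEN tendsto_eq_rhs])
         (use eventually_ntf_upper[of x a] in eventually_elim, auto)
  qed
  show "nt_limit (sphere_deriv f) x (Some L)"
    unfolding nt_limit_Some
  proof (intro allI impI conjI)
    fix a :: real assume a: "a > 0"
    show "\<forall>\<^sub>F z in ntf x a. sphere_deriv f z \<noteq> None"
      using fin[OF a] by eventually_elim (simp add: sphere_deriv_eq)
    have "(deriv (\<lambda>u. the (f u)) \<longlongrightarrow> L) (ntf x a)"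
      using dq sphere_regular_eventually[OF reg] fin a by (intro deriv_limit_of_quotient_limit) auto
    then show "((\<lambda>z. the (sphere_deriv f z)) \<longlongrightarrow> L) (ntf x a)"
      by (rule Lim_transform_eventually)
         (use fin[OF a] in eventually_elim, simp add: sphere_deriv_eq)
  qed
qed

lemma nt_deriv_imp_vertical_quotient:
  assumes "sphere_regular f" "nt_limit f x (Some c)" "nt_limit (sphere_deriv f) x (Some L)"
  shows "((\<lambda>y. (the (f (vert x y)) - c) / (vert x y - of_real x)) \<longlongrightarrow> L) (at_right 0)"
proof (rule quotient_limit_of_deriv_limit[where a = 1])
  have fin: "\<forall>\<^sub>F z in ntf x 1. f z \<noteq> None" using assms(2) by (simp add: nt_limit_Some)
  show "((\<lambda>z. the (f z)) \<longlongrightarrow> c) (ntf x 1)" using assms(2) by (simp add: nt_limit_Some)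
  have "((\<lambda>z. the (sphere_deriv f z)) \<longlongrightarrow> L) (ntf x 1)" using assms(3) by (simp add: nt_limit_Some)
  then show "(deriv (\<lambda>u. the (f u)) \<longlongrightarrow> L) (ntf x 1)"
    by (rule Lim_transform_eventually)
       (use fin in eventually_elim, simp add: sphere_deriv_eq)
  show "\<forall>\<^sub>F z in ntf x 1. (\<lambda>z. the (f z)) field_differentiable at z"
    by (rule sphere_regular_eventually[OF assms(1) fin])
qed simp

section \<open>Schwarz--Pick and Julia for Nevanlinna functions\<close>

text \<open>\<open>norm (a - b) / norm (a - cnj b)\<close> is the pseudohyperbolic distance of the
  half plane; the identity turns its comparison into one of imaginary parts.\<close>

lemma cmod_diff_cnj_power2:
  "(norm (a - cnj b))\<^sup>2 = (norm (a - b))\<^sup>2 + 4 * Im a * Im b"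
  unfolding cmod_power2 by (simp add: power2_eq_square algebra_simps)

lemma cmod_diff_less_cnj_iff:
  "Im b > 0 \<Longrightarrow> norm (a - b) < norm (a - cnj b) \<longleftrightarrow> Im a > 0"
proof -
  assume b: "Im b > 0"
  have "norm (a - b) < norm (a - cnj b) \<longleftrightarrow> (norm (a - b))\<^sup>2 < (norm (a - cnj b))\<^sup>2"
    by (metis norm_ge_zero power2_less_imp_less power_strict_mono zero_less_numeral)
  also have "\<dots> \<longleftrightarrow> Im a > 0"
    unfolding cmod_diff_cnj_power2 using b by (auto simp: zero_less_mult_iff)
  finally show ?thesis .
qed

text \<open>Schwarz's lemma for \<open>f\<close>, which is \<open>F\<close> between the Cayley
  transforms sending \<open>c\<close> and \<open>F c\<close> to 0. Squaring and expanding the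
  distances to the conjugate points cancels a common term and leaves a form without denominators,
  fit for limits at the boundary.\<close>

lemma Schwarz_Pick_upper_strict:
  assumes hol: "F holomorphic_on upper_half_plane"
    and pos: "\<And>z. Im z > 0 \<Longrightarrow> Im (F z) > 0"
    and z: "Im z > 0" and c: "Im c > 0"
  shows "(norm (F z - F c))\<^sup>2 * (Im z * Im c) \<le> (norm (z - c))\<^sup>2 * (Im (F z) * Im (F c))"
proof -
  \<comment> \<open>Inverse of the Cayley transform
    \<open>u = (z - c) / (z - cnj c)\<close>.\<close>
  define \<psi> where "\<psi> = (\<lambda>u. (c - cnj c * u) / (1 - u))"
  define f where "f = (\<lambda>u. (F (\<psi> u) - F c) / (F (\<psi> u) - cnj (F c)))"
  have cc: "c - cnj c \<noteq> 0" using c by (auto simp: complex_eq_iff)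
  have u1: "1 - u \<noteq> 0" if "norm u < 1" for u :: complex using that by auto
  have \<psi>: "Im (\<psi> u) > 0" if u: "norm u < 1" for u
  proof -
    have eq: "\<psi> u - c = u * (\<psi> u - cnj c)" and "\<psi> u - cnj c = (c - cnj c) / (1 - u)"
      using u1[OF u] by (auto simp: \<psi>_def divide_simps algebra_simps)
    then have "norm (\<psi> u - cnj c) > 0"
      using u1[OF u] cc by simp
    moreover have "norm (\<psi> u - c) = norm u * norm (\<psi> u - cnj c)"
      unfolding eq by (rule norm_mult)
    ultimately have "norm (\<psi> u - c) < norm (\<psi> u - cnj c)"
      using u by simp
    then show ?thesis using cmod_diff_less_cnj_iff[OF c] by simp
  qed
  have ne: "F w - cnj (F c) \<noteq> 0" if "Im w > 0" for w
    using pos[OF that] pos[OF c] by (auto simp: complex_eq_iff)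
  have quot: "norm ((w - b) / (w - cnj b)) < 1" if "Im w > 0" "Im b > 0" for w b
  proof -
    have "norm (w - b) < norm (w - cnj b)" using cmod_diff_less_cnj_iff that by simp
    then show ?thesis unfolding norm_divide
      by (smt (verit, best) divide_less_eq_1 norm_ge_zero)
  qed
  have holf: "f holomorphic_on ball 0 1"
  proof -
    have h1: "\<psi> holomorphic_on ball 0 1"
      unfolding \<psi>_def using u1 by (intro holomorphic_intros) auto
    have h2: "(F \<circ> \<psi>) holomorphic_on ball 0 1"
      by (rule holomorphic_on_compose_gen[OF h1 hol]) (use \<psi> in \<open>auto simp: upper_half_plane_def\<close>)
    have "(\<lambda>u. ((F \<circ> \<psi>) u - F c) / ((F \<circ> \<psi>) u - cnj (F c))) holomorphic_on ball 0 1"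
      using \<psi> ne by (intro holomorphic_intros h2) auto
    then show ?thesis by (simp add: f_def o_def)
  qed
  define u where "u = (z - c) / (z - cnj c)"
  have zc: "z - cnj c \<noteq> 0" using z c by (auto simp: complex_eq_iff)
  have un: "norm u < 1" unfolding u_def by (rule quot[OF z c])
  have "1 - u = (c - cnj c) / (z - cnj c)" "c - cnj c * u = z * (c - cnj c) / (z - cnj c)"
    using zc by (auto simp: u_def divide_simps algebra_simps)
  then have \<psi>u: "\<psi> u = z"
    using zc cc by (simp add: \<psi>_def)
  have "norm (f u) \<le> norm u"
  proof (rule Schwarz_Lemma(1)[OF holf _ _ un])
    show "f 0 = 0" by (simp add: f_def \<psi>_def)
    show "norm (f v) < 1" if "norm v < 1" for v
      unfolding f_def by (rule quot[OF pos[OF \<psi>[OF that]] pos[OF c]])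
  qed
  then have "norm (F z - F c) / norm (F z - cnj (F c)) \<le> norm (z - c) / norm (z - cnj c)"
    unfolding f_def \<psi>u norm_divide by (simp add: u_def norm_divide)
  then have "norm (F z - F c) * norm (z - cnj c) \<le> norm (z - c) * norm (F z - cnj (F c))"
    using zc ne[OF z] by (simp add: divide_simps mult.commute)
  then have "(norm (F z - F c) * norm (z - cnj c))\<^sup>2 \<le> (norm (z - c) * norm (F z - cnj (F c)))\<^sup>2"
    by (intro power_mono) auto
  then show ?thesis
    unfolding power_mult_distrib cmod_diff_cnj_power2 by (simp add: algebra_simps)
qed

text \<open>Values of \<open>F\<close> may be real, where the Cayley transform of the target
  degenerates. Adding \<open>\<i> * e\<close> moves them into the open half plane, and
  \<open>e\<close> tends to 0.\<close>

lemma Schwarz_Pick_nevanlinna: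
  assumes F: "F \<in> nevanlinna" and z: "Im z > 0" and c: "Im c > 0"
  shows "(norm (F z - F c))\<^sup>2 * (Im z * Im c) \<le> (norm (z - c))\<^sup>2 * (Im (F z) * Im (F c))"
proof (rule tendsto_lowerbound)
  show "((\<lambda>e. (norm (z - c))\<^sup>2 * ((Im (F z) + e) * (Im (F c) + e))) \<longlongrightarrow>
          (norm (z - c))\<^sup>2 * (Im (F z) * Im (F c))) (at_right 0)"
    by (rule tendsto_eq_intros | simp)+
  have "(norm (F z - F c))\<^sup>2 * (Im z * Im c) \<le> (norm (z - c))\<^sup>2 * ((Im (F z) + e) * (Im (F c) + e))"
    if "e > 0" for e
  proof -
    have F': "F holomorphic_on upper_half_plane" "\<And>z. Im z > 0 \<Longrightarrow> Im (F z) \<ge> 0"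
      using F by (auto simp: nevanlinna_def upper_half_plane_def)
    have "(norm ((F z + \<i> * of_real e) - (F c + \<i> * of_real e)))\<^sup>2 * (Im z * Im c)
       \<le> (norm (z - c))\<^sup>2 * (Im (F z + \<i> * of_real e) * Im (F c + \<i> * of_real e))"
      by (rule Schwarz_Pick_upper_strict[OF _ _ z c])
         (use F' that in \<open>auto intro!: holomorphic_intros add_nonneg_pos\<close>)
    then show ?thesis by simp
  qed
  then show "\<forall>\<^sub>F e in at_right 0. (norm (F z - F c))\<^sup>2 * (Im z * Im c)
      \<le> (norm (z - c))\<^sup>2 * ((Im (F z) + e) * (Im (F c) + e))"
    using eventually_at_right_less[of 0] by (auto elim: eventually_mono)
qed simp

text \<open>With \<open>Im (F c) = 0\<close> the right side of Schwarz-Pick vanishes; this replaces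
  the open mapping theorem.\<close>

lemma nevanlinna_real_value_const:
  assumes F: "F \<in> nevanlinna" and c: "Im c > 0" "Im (F c) = 0" and z: "Im z > 0"
  shows "F z = F c"
proof -
  have "(norm (F z - F c))\<^sup>2 * (Im z * Im c) \<le> 0"
    using Schwarz_Pick_nevanlinna[OF F z c(1)] c(2) by simp
  then have "(norm (F z - F c))\<^sup>2 \<le> 0"
    using z c(1) by (simp add: mult_le_0_iff)
  then show ?thesis by simp
qed

lemma nevanlinna_neg_inverse:
  assumes F: "F \<in> nevanlinna" and nz: "\<And>z. Im z > 0 \<Longrightarrow> F z \<noteq> 0"
  shows "(\<lambda>z. - 1 / F z) \<in> nevanlinna"
proof -
  have "F holomorphic_on upper_half_plane" "\<And>z. Im z > 0 \<Longrightarrow> Im (F z) \<ge> 0"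
    using F by (auto simp: nevanlinna_def upper_half_plane_def)
  then show ?thesis
    using nz unfolding nevanlinna_def
    by (auto simp: upper_half_plane_def Im_divide intro!: holomorphic_intros)
qed

text \<open>\<open>m\<close> is the point mass at \<open>x\<close> of the Herglotz measure of
  \<open>g\<close>. As \<open>- 1 / (z - x)\<close> has imaginary part
  \<open>Im z / (norm (z - x))\<^sup>2\<close>, the infimum of \<open>\<rho>\<close> is the largest
  multiple of it that can be subtracted with a nonnegative imaginary part left. For the rest
  \<open>h\<close> the infimum is 0, and Schwarz-Pick against a nearly minimal point
  \<open>c\<close> forces \<open>(z - x) * h z\<close> to 0.\<close>

lemma nevanlinna_boundary_mass:
  assumes g: "g \<in> nevanlinna"
  obtains m :: real where "m \<ge> 0" "(\<lambda>z. g z + of_real m / (z - of_real x)) \<in> nevanlinna"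
    "\<And>a. a > 0 \<Longrightarrow> ((\<lambda>z. (z - of_real x) * g z) \<longlongrightarrow> - of_real m) (ntf x a)"
proof -
  have g': "g holomorphic_on upper_half_plane" "\<And>z. Im z > 0 \<Longrightarrow> Im (g z) \<ge> 0"
    using g by (auto simp: nevanlinna_def upper_half_plane_def)
  define \<rho> where "\<rho> = (\<lambda>z. Im (g z) * (norm (z - of_real x))\<^sup>2 / Im z)"
  define m where "m = Inf (\<rho> ` upper_half_plane)"
  have bdd: "bdd_below (\<rho> ` upper_half_plane)"
    by (rule bdd_belowI[of _ 0]) (auto simp: \<rho>_def upper_half_plane_def g')
  have ne: "\<i> \<in> upper_half_plane" by (simp add: upper_half_plane_def)
  have m0: "m \<ge> 0" unfolding m_def
  proof (rule cInf_greatest)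
    show "\<rho> ` upper_half_plane \<noteq> {}" using ne by blast
  qed (auto simp: \<rho>_def upper_half_plane_def g')
  have mle: "m \<le> \<rho> z" if "Im z > 0" for z
    unfolding m_def by (rule cInf_lower[OF _ bdd]) (use that in \<open>auto simp: upper_half_plane_def\<close>)
  define h where "h = (\<lambda>z. g z + of_real m / (z - of_real x))"
  have tne: "z - of_real x \<noteq> 0" if "Im z > 0" for z using that by auto
  have Imh: "Im (h z) * (norm (z - of_real x))\<^sup>2 = (\<rho> z - m) * Im z" if "Im z > 0" for z
  proof -
    have "Im (of_real m / (z - of_real x)) = - m * Im z / (norm (z - of_real x))\<^sup>2"
      by (simp add: Im_divide cmod_power2)
    then have "Im (h z) = Im (g z) - m * Im z / (norm (z - of_real x))\<^sup>2"
      unfolding h_def by simp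
    moreover have "norm (z - of_real x) > 0" using tne[OF that] by simp
    ultimately show ?thesis
      using that by (simp add: \<rho>_def left_diff_distrib)
  qed
  have hN: "h \<in> nevanlinna"
  proof -
    have "Im (h z) \<ge> 0" if "Im z > 0" for z
    proof -
      have "Im (h z) * (norm (z - of_real x))\<^sup>2 \<ge> 0" using Imh[OF that] mle[OF that] that by simp
      then show ?thesis using tne[OF that] by (simp add: zero_le_mult_iff)
    qed
    moreover have "h holomorphic_on upper_half_plane"
      unfolding h_def by (intro holomorphic_intros g') (auto simp: upper_half_plane_def)
    ultimately show ?thesis by (auto simp: nevanlinna_def upper_half_plane_def)
  qed
  have lim: "((\<lambda>z. (z - of_real x) * h z) \<longlongrightarrow> 0) (ntf x a)" if a: "a > 0" for a
  proof (rule tendstoI)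
    fix \<epsilon> :: real assume \<epsilon>: "\<epsilon> > 0"
    \<comment> \<open>The 2 comes from \<open>(norm (z - c))\<^sup>2 \<le> 2 * s\<^sup>2\<close>
      near \<open>x\<close>, the \<open>1 + a\<close> from
      \<open>norm (z - x) \<le> (1 + a) * Im z\<close>.\<close>
    define C where "C = 2 * (1 + a)"
    define e where "e = \<epsilon> / (2 * (C + 2))"
    have C: "C > 0" using a by (simp add: C_def)
    have e: "e > 0" "(C + 2) * e = \<epsilon> / 2" using \<epsilon> C by (auto simp: e_def field_simps)
    have "Inf (\<rho> ` upper_half_plane) < m + e" using e by (simp add: m_def)
    then obtain c where c: "Im c > 0" "\<rho> c < m + e"
      using cInf_lessD[of "\<rho> ` upper_half_plane" "m + e"] ne
      by (metis empty_iff image_iff mem_Collect_eq upper_half_plane_def)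
    let ?q = "\<lambda>z. (norm (z - c))\<^sup>2 / (norm (c - of_real x))\<^sup>2"
    have "(?q \<longlongrightarrow> (norm (of_real x - c))\<^sup>2 / (norm (c - of_real x))\<^sup>2) (ntf x a)"
      by (intro tendsto_intros tendsto_ident_ntf) (use tne[OF c(1)] in auto)
    then have "(?q \<longlongrightarrow> 1) (ntf x a)"
      using tne[OF c(1)] by (simp add: norm_minus_commute)
    then have ev1: "\<forall>\<^sub>F z in ntf x a. ?q z < 2" by (rule order_tendstoD) simp
    have "((\<lambda>z. norm ((z - of_real x) * h c)) \<longlongrightarrow> norm (0 * h c)) (ntf x a)"
      by (intro tendsto_intros tendsto_diff_ntf)
    then have ev2: "\<forall>\<^sub>F z in ntf x a. norm ((z - of_real x) * h c) < e"
      by (rule order_tendstoD) (use e in simp)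
    show "\<forall>\<^sub>F z in ntf x a. dist ((z - of_real x) * h z) 0 < \<epsilon>"
      using ev1 ev2 eventually_ntf_sector
    proof eventually_elim
      case (elim z)
      have Iz: "Im z > 0" using elim(3) by (simp add: stolz_sector_def upper_half_plane_def)
      define t where "t = norm (z - of_real x)"
      have t: "t > 0" "t \<le> (1 + a) * Im z"
        using tne[OF Iz] stolz_sector_norm_le[OF elim(3) a] by (auto simp: t_def)
      define r where "r = norm ((z - of_real x) * h z)"
      define s where "s = norm (c - of_real x)"
      have s: "s > 0" using tne[OF c(1)] by (simp add: s_def)
      have Ihz: "Im (h z) \<ge> 0" using hN Iz by (auto simp: nevanlinna_def upper_half_plane_def)
      have Ihc: "Im (h c) * s\<^sup>2 \<le> e * Im c"
        using Imh[OF c(1)] c by (simp add: s_def)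
      have "(norm (h z - h c))\<^sup>2 * (Im z * Im c) * s\<^sup>2 \<le> (norm (z - c))\<^sup>2 * (Im (h z) * Im (h c)) * s\<^sup>2"
        by (intro mult_right_mono Schwarz_Pick_nevanlinna hN Iz c) auto
      also have "\<dots> = (norm (z - c))\<^sup>2 * Im (h z) * (Im (h c) * s\<^sup>2)" by simp
      also have "\<dots> \<le> (norm (z - c))\<^sup>2 * Im (h z) * (e * Im c)"
        by (intro mult_left_mono Ihc mult_nonneg_nonneg Ihz) auto
      finally have "((norm (h z - h c))\<^sup>2 * Im z * s\<^sup>2) * Im c \<le> ((norm (z - c))\<^sup>2 * Im (h z) * e) * Im c"
        by (simp add: mult_ac)
      then have "(norm (h z - h c))\<^sup>2 * Im z * s\<^sup>2 \<le> (norm (z - c))\<^sup>2 * Im (h z) * e"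
        using c(1) by simp
      also have "\<dots> \<le> (2 * s\<^sup>2) * norm (h z) * e"
      proof (intro mult_mono)
        show "(norm (z - c))\<^sup>2 \<le> 2 * s\<^sup>2" using elim(1) s by (simp add: s_def divide_less_eq)
        show "Im (h z) \<le> norm (h z)" by (metis abs_Im_le_cmod abs_le_D1)
      qed (use e Ihz in auto)
      finally have "((norm (h z - h c))\<^sup>2 * Im z) * s\<^sup>2 \<le> (2 * norm (h z) * e) * s\<^sup>2"
        by (simp add: mult_ac)
      then have "(norm (h z - h c))\<^sup>2 * Im z \<le> 2 * norm (h z) * e"
        using s by simp
      then have "(norm (h z - h c))\<^sup>2 * Im z * (1 + a) \<le> 2 * norm (h z) * e * (1 + a)"
        using a by (intro mult_right_mono) auto
      then have "(norm (h z - h c))\<^sup>2 * ((1 + a) * Im z) \<le> C * norm (h z) * e"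
        by (simp add: C_def algebra_simps)
      moreover have "(norm (h z - h c))\<^sup>2 * t \<le> (norm (h z - h c))\<^sup>2 * ((1 + a) * Im z)"
        using t by (intro mult_left_mono) auto
      ultimately have "(norm (h z - h c))\<^sup>2 * t * t \<le> C * norm (h z) * e * t"
        using t by (intro mult_right_mono) auto
      \<comment> \<open>One factor \<open>t\<close> has replaced \<open>Im z\<close>, the other was
        multiplied on both sides; together they carry \<open>z - x\<close> into the norms, so the
        left side is quadratic and the right side linear in the size of
        \<open>(z - x) * h z\<close>.\<close>
      then have *: "(norm ((z - of_real x) * h z - (z - of_real x) * h c))\<^sup>2 \<le> C * e * r"
        unfolding right_diff_distrib[symmetric] norm_mult r_def t_def[symmetric]
        by (simp add: power2_eq_square mult_ac)
      \<comment> \<open>\<open>(r - e)\<^sup>2 \<le> C * e * r\<close> implies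
        \<open>r * r \<le> (C + 2) * e * r\<close>. The case \<open>r \<le> e\<close> is apart
        because squaring needs \<open>r - e \<ge> 0\<close>.\<close>
      have "r \<le> (C + 2) * e"
      proof (cases "r \<le> e")
        case True
        have "e \<le> (C + 2) * e" using C e by simp
        with True show ?thesis by linarith
      next
        case False
        have "r - e \<le> norm ((z - of_real x) * h z - (z - of_real x) * h c)"
          using norm_triangle_ineq2[of "(z - of_real x) * h z" "(z - of_real x) * h c"] elim(2)
          by (simp add: r_def)
        then have "(r - e)\<^sup>2 \<le> C * e * r"
          using False * by (smt (verit) power_mono)
        then have "r * r \<le> (C + 2) * e * r"
          using e False by (simp add: power2_eq_square algebra_simps) (smt (verit) mult_nonneg_nonneg)
        then show ?thesis using False e by (simp add: mult_le_cancel_right)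
      qed
      then show ?case using e \<epsilon> by (simp add: r_def)
    qed
  qed
  have lim': "((\<lambda>z. (z - of_real x) * g z) \<longlongrightarrow> - of_real m) (ntf x a)" if "a > 0" for a
  proof -
    have "((\<lambda>z. (z - of_real x) * h z - of_real m) \<longlongrightarrow> 0 - of_real m) (ntf x a)"
      by (intro tendsto_intros lim that)
    then show ?thesis
      by (rule Lim_transform_eventually[THEN tendsto_eq_rhs])
         (use eventually_ntf_upper[of x a] in eventually_elim, use tne in \<open>auto simp: h_def field_simps\<close>)
  qed
  show ?thesis using that[OF m0 hN[unfolded h_def] lim'] .
qed

text \<open>Schwarz-Pick against points \<open>u\<close> with
  \<open>Im (k u) \<le> M * Im u\<close>: cancel \<open>Im u\<close> and let \<open>u\<close> tend
  to \<open>x\<close>, where \<open>k u\<close> tends to 0. Frequent points suffice, and they are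
  what a kernel that does not tend to infinity provides.\<close>

lemma nevanlinna_Julia_bound:
  assumes k: "k \<in> nevanlinna" and k0: "(k \<longlongrightarrow> 0) (ntf x a)"
    and fr: "\<exists>\<^sub>F z in ntf x a. Im (k z) \<le> M * Im z"
    and z: "Im z > 0"
  shows "norm (k z) * Im z \<le> M * (norm (z - of_real x))\<^sup>2"
proof -
  have nn: "Im (k u) \<ge> 0" if "Im u > 0" for u
    using k that by (auto simp: nevanlinna_def upper_half_plane_def)
  have M: "M \<ge> 0"
  proof -
    have "\<exists>\<^sub>F u in ntf x a. Im (k u) \<le> M * Im u \<and> Im u > 0"
      by (rule frequently_rev_mp[OF fr]) (use eventually_ntf_upper[of x a] in eventually_elim, auto)
    then obtain u where "Im (k u) \<le> M * Im u" "Im u > 0" by (auto dest: frequently_ex)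
    then show ?thesis using nn[of u] by (smt (verit) mult_neg_pos)
  qed
  have main: "(norm (k z))\<^sup>2 * Im z \<le> (norm (z - of_real x))\<^sup>2 * (Im (k z) * M)"
  \<comment> \<open>The good points \<open>u\<close> are only frequent, so the limit is not taken
    along them: a strict failure at \<open>x\<close> would persist eventually and exclude
    them.\<close>
  proof (rule ccontr)
    assume "\<not> ?thesis"
    then have less: "(norm (z - of_real x))\<^sup>2 * (Im (k z) * M) < (norm (k z))\<^sup>2 * Im z" by simp
    have "((\<lambda>u. (norm (k z - k u))\<^sup>2 * Im z - (norm (z - u))\<^sup>2 * (Im (k z) * M)) \<longlongrightarrow>
           (norm (k z - 0))\<^sup>2 * Im z - (norm (z - of_real x))\<^sup>2 * (Im (k z) * M)) (ntf x a)"
      by (intro tendsto_intros k0 tendsto_ident_ntf)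
    then have "\<forall>\<^sub>F u in ntf x a. 0 < (norm (k z - k u))\<^sup>2 * Im z - (norm (z - u))\<^sup>2 * (Im (k z) * M)"
      by (rule order_tendstoD) (use less in simp)
    then have "\<forall>\<^sub>F u in ntf x a. \<not> Im (k u) \<le> M * Im u"
      using eventually_ntf_upper
    proof eventually_elim
      case (elim u)
      show ?case
      proof
        assume A: "Im (k u) \<le> M * Im u"
        have "(norm (k z - k u))\<^sup>2 * (Im z * Im u) \<le> (norm (z - u))\<^sup>2 * (Im (k z) * Im (k u))"
          by (rule Schwarz_Pick_nevanlinna[OF k z elim(2)])
        also have "\<dots> \<le> (norm (z - u))\<^sup>2 * (Im (k z) * (M * Im u))"
          using A nn[OF z] by (intro mult_left_mono) auto
        finally have "((norm (k z - k u))\<^sup>2 * Im z) * Im u \<le> ((norm (z - u))\<^sup>2 * (Im (k z) * M)) * Im u"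
          by (simp add: mult_ac)
        then have "(norm (k z - k u))\<^sup>2 * Im z \<le> (norm (z - u))\<^sup>2 * (Im (k z) * M)"
          using elim(2) by simp
        with elim(1) show False by simp
      qed
    qed
    then show False using fr by (simp add: frequently_def)
  qed
  also have "\<dots> \<le> (norm (z - of_real x))\<^sup>2 * (norm (k z) * M)"
    using M by (intro mult_left_mono mult_right_mono) (auto intro: order_trans[OF _ abs_Im_le_cmod])
  finally have "(norm (k z) * Im z) * norm (k z) \<le> (M * (norm (z - of_real x))\<^sup>2) * norm (k z)"
    by (simp add: power2_eq_square mult_ac)
  then show ?thesis using M by (cases "k z = 0") (auto simp: mult_le_cancel_right)
qed

text \<open>If the kernel did not tend to infinity, Julia's bound on the vertical ray would give
  \<open>norm (k z) \<le> M * Im z\<close>; but \<open>q\<close> makes \<open>z - x\<close>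
  negligible against \<open>k z\<close>.\<close>

lemma nevanlinna_kernel_at_top:
  assumes k: "k \<in> nevanlinna" and nz: "\<And>z. Im z > 0 \<Longrightarrow> k z \<noteq> 0"
    and q: "((\<lambda>z. (z - of_real x) / k z) \<longlongrightarrow> 0) (ntf x 1)"
    and k0: "(k \<longlongrightarrow> 0) (ntf x a)"
  shows "filterlim (\<lambda>z. Im (k z) / Im z) at_top (ntf x a)"
proof (rule ccontr)
  assume "\<not> ?thesis"
  then obtain M0 where "\<not> (\<forall>\<^sub>F z in ntf x a. M0 \<le> Im (k z) / Im z)"
    unfolding filterlim_at_top by auto
  then have "\<exists>\<^sub>F z in ntf x a. \<not> M0 \<le> Im (k z) / Im z"
    by (simp add: not_eventually)
  \<comment> \<open>The maximum with 1 keeps the bound positive for the division by it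
    below.\<close>
  then have "\<exists>\<^sub>F z in ntf x a. Im (k z) \<le> max M0 1 * Im z"
  proof (rule frequently_rev_mp)
    show "\<forall>\<^sub>F z in ntf x a. \<not> M0 \<le> Im (k z) / Im z \<longrightarrow> Im (k z) \<le> max M0 1 * Im z"
      using eventually_ntf_upper
    proof (eventually_elim, intro impI)
      fix z assume "Im z > 0" "\<not> M0 \<le> Im (k z) / Im z"
      then have "Im (k z) < M0 * Im z" by (simp add: field_simps)
      also have "\<dots> \<le> max M0 1 * Im z" using \<open>Im z > 0\<close> by (intro mult_right_mono) auto
      finally show "Im (k z) \<le> max M0 1 * Im z" by simp
    qed
  qed
  then have b: "norm (k z) * Im z \<le> max M0 1 * (norm (z - of_real x))\<^sup>2" if "Im z > 0" for z
    using nevanlinna_Julia_bound[OF k k0 _ that] by blast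
  let ?M = "max M0 1"
  have M: "?M > 0" by simp
  have "((\<lambda>y. (vert x y - of_real x) / k (vert x y)) \<longlongrightarrow> 0) (at_right 0)"
    by (rule filterlim_compose[OF q filterlim_vert]) simp
  then have "\<forall>\<^sub>F y in at_right 0. dist ((vert x y - of_real x) / k (vert x y)) 0 < 1 / ?M"
    by (rule tendstoD) (use M in simp)
  moreover have "\<forall>\<^sub>F y in at_right (0::real). y > 0" by (rule eventually_at_right_less)
  ultimately have "\<forall>\<^sub>F y in at_right (0::real). False"
  proof eventually_elim
    case (elim y)
    have "norm (k (vert x y)) * y \<le> ?M * y\<^sup>2" using b[of "vert x y"] elim by (simp add: norm_mult)
    then have le: "norm (k (vert x y)) \<le> ?M * y" using elim(2) by (simp add: power2_eq_square)
    have pos: "norm (k (vert x y)) > 0" using nz[of "vert x y"] elim(2) by simp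
    have "y / norm (k (vert x y)) < 1 / ?M" using elim by (simp add: norm_divide norm_mult)
    then have "?M * y < norm (k (vert x y))" using M pos by (simp add: field_simps)
    with le show ?case by simp
  qed
  then show False by simp
qed

section \<open>Functions with real boundary behaviour near a real point\<close>

text \<open>Stands for "analytic at \<open>x\<close> and real on the axis", keeping two
  consequences: a real limit, and an imaginary part of order \<open>Im z\<close>. Unlike analyticity
  these survive conjugation, so products such as \<open>a0 z * cnj (b1 z)\<close> stay in the
  class.\<close>

definition real_at :: "real \<Rightarrow> (complex \<Rightarrow> complex) \<Rightarrow> real \<Rightarrow> bool" where
  "real_at x f L \<longleftrightarrow> (f \<longlongrightarrow> of_real L) (at (of_real x)) \<and>
     (\<exists>M. \<forall>\<^sub>F z in at (of_real x). \<bar>Im (f z)\<bar> \<le> M * \<bar>Im z\<bar>)"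

lemma real_at_tendsto: "real_at x f L \<Longrightarrow> (f \<longlongrightarrow> of_real L) (ntf x a)"
  unfolding real_at_def using tendsto_mono[OF ntf_le_at] by blast

lemma real_at_Im_bound:
  assumes "real_at x f L"
  obtains M where "\<forall>\<^sub>F z in ntf x a. \<bar>Im (f z)\<bar> \<le> M * Im z"
proof -
  obtain M where "\<forall>\<^sub>F z in at (of_real x). \<bar>Im (f z)\<bar> \<le> M * \<bar>Im z\<bar>"
    using assms unfolding real_at_def by auto
  then have "\<forall>\<^sub>F z in ntf x a. \<bar>Im (f z)\<bar> \<le> M * \<bar>Im z\<bar>"
    using filter_leD[OF ntf_le_at] by blast
  then have "\<forall>\<^sub>F z in ntf x a. \<bar>Im (f z)\<bar> \<le> M * Im z"
    using eventually_ntf_upper by eventually_elim simp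
  then show ?thesis using that by blast
qed

lemma real_at_const: "real_at x (\<lambda>z. of_real c) c"
  by (auto simp: real_at_def intro!: exI[of _ 0])

lemma real_at_ident: "real_at x (\<lambda>z. z - of_real x) 0"
  unfolding real_at_def
proof
  show "((\<lambda>z. z - complex_of_real x) \<longlongrightarrow> complex_of_real 0) (at (complex_of_real x))"
    by (rule tendsto_eq_intros | simp)+
qed (auto intro!: exI[of _ 1])

lemma real_at_add:
  assumes "real_at x f K" "real_at x g L"
  shows "real_at x (\<lambda>z. f z + g z) (K + L)"
proof -
  obtain M N where "\<forall>\<^sub>F z in at (of_real x). \<bar>Im (f z)\<bar> \<le> M * \<bar>Im z\<bar>"
     "\<forall>\<^sub>F z in at (of_real x). \<bar>Im (g z)\<bar> \<le> N * \<bar>Im z\<bar>"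
    using assms unfolding real_at_def by auto
  then have "\<forall>\<^sub>F z in at (of_real x). \<bar>Im (f z + g z)\<bar> \<le> (M + N) * \<bar>Im z\<bar>"
    by eventually_elim (simp add: algebra_simps)
  moreover have "((\<lambda>z. f z + g z) \<longlongrightarrow> of_real K + of_real L) (at (of_real x))"
    using assms unfolding real_at_def by (intro tendsto_add) auto
  ultimately show ?thesis unfolding real_at_def by auto
qed

lemma real_at_mult:
  assumes "real_at x f K" "real_at x g L"
  shows "real_at x (\<lambda>z. f z * g z) (K * L)"
proof -
  obtain M N where MN: "\<forall>\<^sub>F z in at (of_real x). \<bar>Im (f z)\<bar> \<le> M * \<bar>Im z\<bar>"
     "\<forall>\<^sub>F z in at (of_real x). \<bar>Im (g z)\<bar> \<le> N * \<bar>Im z\<bar>"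
    using assms unfolding real_at_def by auto
  have bd: "\<forall>\<^sub>F z in at (of_real x). \<bar>Re (f z)\<bar> < \<bar>L\<bar> + 1" if "(f \<longlongrightarrow> of_real L) (at (of_real x))" for f L
    using order_tendstoD(2)[OF tendsto_rabs[OF tendsto_Re[OF that]], of "\<bar>L\<bar> + 1"] by simp
  have "\<forall>\<^sub>F z in at (of_real x). \<bar>Re (f z)\<bar> < \<bar>K\<bar> + 1" "\<forall>\<^sub>F z in at (of_real x). \<bar>Re (g z)\<bar> < \<bar>L\<bar> + 1"
    using assms bd unfolding real_at_def by auto
  with MN have "\<forall>\<^sub>F z in at (of_real x). \<bar>Im (f z * g z)\<bar> \<le> ((\<bar>K\<bar> + 1) * N + (\<bar>L\<bar> + 1) * M) * \<bar>Im z\<bar>"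
  proof eventually_elim
    case (elim z)
    have "\<bar>Im (f z * g z)\<bar> \<le> \<bar>Re (f z)\<bar> * \<bar>Im (g z)\<bar> + \<bar>Re (g z)\<bar> * \<bar>Im (f z)\<bar>"
      using abs_triangle_ineq[of "Re (f z) * Im (g z)" "Im (f z) * Re (g z)"] by (simp add: abs_mult mult.commute)
    also have "\<dots> \<le> (\<bar>K\<bar> + 1) * (N * \<bar>Im z\<bar>) + (\<bar>L\<bar> + 1) * (M * \<bar>Im z\<bar>)"
      using elim by (intro add_mono mult_mono) auto
    finally show ?case by (simp add: algebra_simps)
  qed
  moreover have "((\<lambda>z. f z * g z) \<longlongrightarrow> of_real K * of_real L) (at (of_real x))"
    using assms unfolding real_at_def by (intro tendsto_mult) auto
  ultimately show ?thesis unfolding real_at_def by auto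
qed

lemma real_at_cmult: "real_at x f K \<Longrightarrow> real_at x (\<lambda>z. of_real c * f z) (c * K)"
  by (rule real_at_mult[OF real_at_const])

lemma real_at_uminus: "real_at x f K \<Longrightarrow> real_at x (\<lambda>z. - f z) (- K)"
  using real_at_cmult[of x f K "-1"] by simp

lemma real_at_diff: "real_at x f K \<Longrightarrow> real_at x g L \<Longrightarrow> real_at x (\<lambda>z. f z - g z) (K - L)"
  using real_at_add[OF _ real_at_uminus, of x f K g L] by simp

lemma real_at_cnj: "real_at x f K \<Longrightarrow> real_at x (\<lambda>z. cnj (f z)) K"
  unfolding real_at_def using tendsto_cnj[of f "of_real K"] by auto

lemma real_at_sum:
  "finite A \<Longrightarrow> (\<And>k. k \<in> A \<Longrightarrow> real_at x (f k) (L k)) \<Longrightarrow> real_at x (\<lambda>z. \<Sum>k\<in>A. f k z) (\<Sum>k\<in>A. L k)"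
proof (induction A rule: finite_induct)
  case empty
  then show ?case using real_at_const[of x 0] by simp
next
  case (insert k A)
  then show ?case using real_at_add[of x "f k" "L k" "\<lambda>z. \<Sum>k\<in>A. f k z" "\<Sum>k\<in>A. L k"] by simp
qed

lemma real_at_pole:
  assumes "y \<noteq> x"
  shows "real_at x (\<lambda>z. of_real b / (z - of_real y)) (b / (x - y))"
  unfolding real_at_def
proof
  show lim: "((\<lambda>z. of_real b / (z - complex_of_real y)) \<longlongrightarrow> of_real (b / (x - y))) (at (of_real x))"
    using assms by (auto intro!: tendsto_eq_intros)
  have "((\<lambda>z. norm (z - complex_of_real y)) \<longlongrightarrow> norm (of_real x - complex_of_real y)) (at (of_real x))"
    by (intro tendsto_intros)
  then have "\<forall>\<^sub>F z in at (of_real x). norm (z - complex_of_real y) > \<bar>x - y\<bar> / 2"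
    by (rule order_tendstoD) (use assms in \<open>simp flip: of_real_diff\<close>)
  then have "\<forall>\<^sub>F z in at (of_real x). \<bar>Im (of_real b / (z - complex_of_real y))\<bar> \<le> (\<bar>b\<bar> / (\<bar>x - y\<bar> / 2)\<^sup>2) * \<bar>Im z\<bar>"
  proof eventually_elim
    case (elim z)
    have "\<bar>Im (of_real b / (z - complex_of_real y))\<bar> = \<bar>b\<bar> * \<bar>Im z\<bar> / (norm (z - complex_of_real y))\<^sup>2"
      by (simp add: Im_divide cmod_power2 abs_mult)
    also have "\<dots> \<le> \<bar>b\<bar> * \<bar>Im z\<bar> / (\<bar>x - y\<bar> / 2)\<^sup>2"
      using elim assms by (intro divide_left_mono power_mono mult_nonneg_nonneg mult_pos_pos) auto
    finally show ?case by simp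
  qed
  then show "\<exists>M. \<forall>\<^sub>F z in at (of_real x). \<bar>Im (of_real b / (z - complex_of_real y))\<bar> \<le> M * \<bar>Im z\<bar>" ..
qed

text \<open>Multiply by the conjugate of the denominator: the coefficient of \<open>Im (k z)\<close>
  tends to the positive determinant, and all other terms are of order \<open>Im z\<close>, since
  products of the coefficients are \<open>real_at\<close> and \<open>k\<close> is bounded. Hence the
  kernel exceeds a positive multiple of that of \<open>k\<close>, up to a constant.\<close>

lemma lft_kernel_at_top:
  fixes a0 a1 b0 b1 k :: "complex \<Rightarrow> complex"
  assumes R: "real_at x a0 A0" "real_at x a1 A1" "real_at x b0 B0" "real_at x b1 B1"
    and det: "A0 * B1 - A1 * B0 > 0" and B0: "B0 \<noteq> 0"
    and k0: "(k \<longlongrightarrow> 0) (ntf x a)"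
    and K: "filterlim (\<lambda>z. Im (k z) / Im z) at_top (ntf x a)"
  shows "filterlim (\<lambda>z. Im ((a0 z - a1 z * k z) / (b0 z - b1 z * k z)) / Im z) at_top (ntf x a)"
proof -
  define \<delta> where "\<delta> = A0 * B1 - A1 * B0"
  have \<delta>: "\<delta> > 0" using det by (simp add: \<delta>_def)
  have P00: "real_at x (\<lambda>z. a0 z * cnj (b0 z)) (A0 * B0)" and P01: "real_at x (\<lambda>z. a0 z * cnj (b1 z)) (A0 * B1)"
    and P10: "real_at x (\<lambda>z. a1 z * cnj (b0 z)) (A1 * B0)" and P11: "real_at x (\<lambda>z. a1 z * cnj (b1 z)) (A1 * B1)"
    by (intro real_at_mult real_at_cnj R)+
  obtain M00 where M00: "\<forall>\<^sub>F z in ntf x a. \<bar>Im (a0 z * cnj (b0 z))\<bar> \<le> M00 * Im z"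
    using real_at_Im_bound[OF P00] .
  obtain M01 where M01: "\<forall>\<^sub>F z in ntf x a. \<bar>Im (a0 z * cnj (b1 z))\<bar> \<le> M01 * Im z"
    using real_at_Im_bound[OF P01] .
  obtain M10 where M10: "\<forall>\<^sub>F z in ntf x a. \<bar>Im (a1 z * cnj (b0 z))\<bar> \<le> M10 * Im z"
    using real_at_Im_bound[OF P10] .
  obtain M11 where M11: "\<forall>\<^sub>F z in ntf x a. \<bar>Im (a1 z * cnj (b1 z))\<bar> \<le> M11 * Im z"
    using real_at_Im_bound[OF P11] .
  define M where "M = M00 + M01 + M10 + M11"
  have "((\<lambda>z. Re (a0 z * cnj (b1 z)) - Re (a1 z * cnj (b0 z))) \<longlongrightarrow> Re (of_real (A0 * B1)) - Re (of_real (A1 * B0))) (ntf x a)"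
    by (intro tendsto_diff tendsto_Re real_at_tendsto P01 P10)
  then have c: "\<forall>\<^sub>F z in ntf x a. Re (a0 z * cnj (b1 z)) - Re (a1 z * cnj (b0 z)) > \<delta> / 2"
    by (rule order_tendstoD) (use \<delta> in \<open>simp add: \<delta>_def\<close>)
  have kn: "\<forall>\<^sub>F z in ntf x a. norm (k z) < 1"
    using order_tendstoD(2)[OF tendsto_norm[OF k0], of 1] by simp
  have "((\<lambda>z. b0 z - b1 z * k z) \<longlongrightarrow> of_real B0 - of_real B1 * 0) (ntf x a)"
    by (intro tendsto_intros real_at_tendsto R k0)
  then have blim: "((\<lambda>z. norm (b0 z - b1 z * k z)) \<longlongrightarrow> \<bar>B0\<bar>) (ntf x a)"
    using tendsto_norm by fastforce
  define B where "B = \<bar>B0\<bar> + 1"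
  have b1: "\<forall>\<^sub>F z in ntf x a. norm (b0 z - b1 z * k z) < B"
    by (rule order_tendstoD(2)[OF blim]) (simp add: B_def)
  have b2: "\<forall>\<^sub>F z in ntf x a. norm (b0 z - b1 z * k z) > 0"
    by (rule order_tendstoD(1)[OF blim]) (use B0 in simp)
  \<comment> \<open>This threshold makes \<open>\<delta> / 2 * q - M\<close> nonnegative, so that
    replacing the squared denominator by its upper bound \<open>B\<^sup>2\<close> decreases the
    fraction.\<close>
  have Kl: "\<forall>\<^sub>F z in ntf x a. max 0 (2 * M / \<delta>) \<le> Im (k z) / Im z"
    using K unfolding filterlim_at_top by blast
  have lower: "\<forall>\<^sub>F z in ntf x a. (\<delta> / 2 * (Im (k z) / Im z) - M) / B\<^sup>2
       \<le> Im ((a0 z - a1 z * k z) / (b0 z - b1 z * k z)) / Im z"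
    using M00 M01 M10 M11 c kn b1 b2 Kl eventually_ntf_upper
  proof eventually_elim
    case (elim z)
    define q where "q = Im (k z) / Im z"
    have q: "q \<ge> 0" "\<delta> / 2 * q \<ge> M" "Im (k z) = q * Im z"
      using elim(9,10) \<delta> by (auto simp: q_def field_simps)
    have Ik: "Im (k z) \<ge> 0" using q elim(10) by simp
    define num where "num = Im ((a0 z - a1 z * k z) * cnj (b0 z - b1 z * k z))"
    have "num = Im (a0 z * cnj (b0 z)) + Im (a1 z * cnj (b1 z)) * (norm (k z))\<^sup>2
        + (Re (a0 z * cnj (b1 z)) - Re (a1 z * cnj (b0 z))) * Im (k z)
        - (Im (a1 z * cnj (b0 z)) + Im (a0 z * cnj (b1 z))) * Re (k z)"
      unfolding num_def cmod_power2 by (simp add: power2_eq_square algebra_simps)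
    moreover have "\<bar>Im (a1 z * cnj (b1 z)) * (norm (k z))\<^sup>2\<bar> \<le> M11 * Im z * 1"
      unfolding abs_mult using elim(4,6) by (intro mult_mono) (auto simp: power_le_one)
    moreover have "\<bar>(Im (a1 z * cnj (b0 z)) + Im (a0 z * cnj (b1 z))) * Re (k z)\<bar> \<le> (M10 * Im z + M01 * Im z) * 1"
      unfolding abs_mult using elim(2,3,6) abs_Re_le_cmod[of "k z"] by (intro mult_mono) linarith+
    moreover have "(Re (a0 z * cnj (b1 z)) - Re (a1 z * cnj (b0 z))) * Im (k z) \<ge> \<delta> / 2 * Im (k z)"
      using elim(5) Ik by (intro mult_right_mono) auto
    ultimately have num: "num \<ge> \<delta> / 2 * Im (k z) - M * Im z"
      using elim(1) unfolding M_def distrib_right by (smt (verit))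
    have "Im ((a0 z - a1 z * k z) / (b0 z - b1 z * k z)) = num / (norm (b0 z - b1 z * k z))\<^sup>2"
      unfolding num_def by (subst complex_div_cnj) (simp only: Im_divide_of_real)
    moreover have "(\<delta> / 2 * q - M) / B\<^sup>2 * Im z \<le> num / (norm (b0 z - b1 z * k z))\<^sup>2"
    proof -
      have n1: "(\<delta> / 2 * q - M) * Im z \<le> num" using num q(3) by (simp add: algebra_simps)
      have n0: "0 \<le> (\<delta> / 2 * q - M) * Im z" using q elim(10) by simp
      have "(\<delta> / 2 * q - M) * Im z / B\<^sup>2 \<le> num / (norm (b0 z - b1 z * k z))\<^sup>2"
        using n1 n0 elim(7,8) by (intro frac_le power_mono) auto
      then show ?thesis by simp
    qed
    ultimately show ?case
      unfolding q_def[symmetric] using elim(10) by (simp only: pos_le_divide_eq)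
  qed
  have "filterlim (\<lambda>z. (- M / B\<^sup>2) + (\<delta> / 2 / B\<^sup>2) * (Im (k z) / Im z)) at_top (ntf x a)"
    by (intro filterlim_tendsto_add_at_top[OF tendsto_const]
        filterlim_tendsto_pos_mult_at_top[OF tendsto_const _ K]) (use \<delta> in \<open>simp add: B_def\<close>)
  then have "filterlim (\<lambda>z. (\<delta> / 2 * (Im (k z) / Im z) - M) / B\<^sup>2) at_top (ntf x a)"
    by (simp add: diff_divide_distrib mult_ac)
  then show ?thesis
    by (rule filterlim_at_top_mono[OF _ lower])
qed

section \<open>Boundary behaviour of the parameter\<close>

text \<open>The cases are \<open>d = \<infinity>\<close>, \<open>d = 0\<close> and
  \<open>0 < d < \<infinity>\<close> for the limit \<open>d\<close> of
  \<open>(g z - \<eta>) / (z - x)\<close>. Off the constant \<open>\<eta>\<close>, \<open>d\<close>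
  is 1 over the mass \<open>m\<close> of \<open>- 1 / (g - \<eta>)\<close> and never 0. The equation
  in the last case is \<open>- 1 / (g - \<eta>) = h - m / (z - x)\<close> cleared of denominators,
  with \<open>D = 1 / m\<close>.\<close>

lemma nevanlinna_boundary_cases:
  fixes g :: "complex \<Rightarrow> complex" and \<eta> x :: real
  assumes g: "g \<in> nevanlinna"
  obtains
    (inf) "\<And>z. Im z > 0 \<Longrightarrow> g z \<noteq> of_real \<eta>"
      "\<And>a. a > 0 \<Longrightarrow> ((\<lambda>z. (z - of_real x) / (g z - of_real \<eta>)) \<longlongrightarrow> 0) (ntf x a)"
  | (const) "\<And>z. Im z > 0 \<Longrightarrow> g z = of_real \<eta>"
  | (fin) D h where "D > 0" "h \<in> nevanlinna"
      "\<And>z. Im z > 0 \<Longrightarrow>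
        (g z - of_real \<eta>) * (1 - of_real D * (z - of_real x) * h z) = of_real D * (z - of_real x)"
      "\<And>a. a > 0 \<Longrightarrow> ((\<lambda>z. (z - of_real x) * h z) \<longlongrightarrow> 0) (ntf x a)"
proof (cases "\<exists>c. Im c > 0 \<and> g c = of_real \<eta>")
  case True
  then obtain c where c: "Im c > 0" "g c = of_real \<eta>" by blast
  then have "g z = of_real \<eta>" if "Im z > 0" for z
    using nevanlinna_real_value_const[OF g c(1) _ that] by simp
  then show ?thesis by (rule const)
next
  case False
  then have ne: "g z - of_real \<eta> \<noteq> 0" if "Im z > 0" for z using that by auto
  have "(\<lambda>z. g z - of_real \<eta>) \<in> nevanlinna"
    using g by (auto simp: nevanlinna_def intro!: holomorphic_intros)
  then have "(\<lambda>z. - 1 / (g z - of_real \<eta>)) \<in> nevanlinna"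
    by (rule nevanlinna_neg_inverse) (use ne in auto)
  then obtain m :: real where m: "m \<ge> 0"
    "(\<lambda>z. - 1 / (g z - of_real \<eta>) + of_real m / (z - of_real x)) \<in> nevanlinna"
    "\<And>a. a > 0 \<Longrightarrow> ((\<lambda>z. (z - of_real x) * (- 1 / (g z - of_real \<eta>))) \<longlongrightarrow> - of_real m) (ntf x a)"
    using nevanlinna_boundary_mass by blast
  show ?thesis
  proof (cases "m = 0")
    case True
    show ?thesis
    proof (rule inf)
      fix a :: real assume "a > 0"
      from tendsto_minus[OF m(3)[OF this]]
      show "((\<lambda>z. (z - of_real x) / (g z - of_real \<eta>)) \<longlongrightarrow> 0) (ntf x a)"
        using True by simp
    qed (use ne in auto)
  next
    case False
    then have mpos: "m > 0" using m(1) by simp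
    define h where "h = (\<lambda>z. - 1 / (g z - of_real \<eta>) + of_real m / (z - of_real x))"
    have th: "(z - of_real x) * h z = (z - of_real x) * (- 1 / (g z - of_real \<eta>)) + of_real m" if "Im z > 0" for z
    proof -
      have "z - of_real x \<noteq> 0" using that by auto
      then show ?thesis unfolding h_def distrib_left by simp
    qed
    show ?thesis
    proof (rule fin[of "1 / m" h])
      show "1 / m > 0" using mpos by simp
      show "h \<in> nevanlinna" using m(2) by (simp add: h_def)
      show "(g z - of_real \<eta>) * (1 - of_real (1 / m) * (z - of_real x) * h z) = of_real (1 / m) * (z - of_real x)"
        if "Im z > 0" for z
        unfolding mult.assoc th[OF that] using ne[OF that] mpos by (simp add: field_simps)
      show "((\<lambda>z. (z - of_real x) * h z) \<longlongrightarrow> 0) (ntf x a)" if "a > 0" for a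
      proof -
        have "((\<lambda>z. (z - of_real x) * (- 1 / (g z - of_real \<eta>)) + of_real m) \<longlongrightarrow> - of_real m + of_real m) (ntf x a)"
          by (intro tendsto_intros m(3) that)
        then show ?thesis
          by (rule Lim_transform_eventually[THEN tendsto_eq_rhs])
             (use eventually_ntf_upper[of x a] in eventually_elim, use th in auto)
      qed
    qed
  qed
qed

lemma zero_less_one_real: "0 < (1 :: real)"
  by simp

section \<open>The diagonal kernel and the derivative of the parameter\<close>

lemma nev_kernel_diag:
  "nev_kernel f z z = (case f z of None \<Rightarrow> None | Some v \<Rightarrow> Some (of_real (Im v / Im z)))"
proof (cases "f z")
  case (Some v)
  have "v - cnj v = 2 * \<i> * of_real (Im v)" "z - cnj z = 2 * \<i> * of_real (Im z)"
    by (auto simp: complex_eq_iff)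
  then show ?thesis using Some by (simp add: nev_kernel_def)
qed (simp add: nev_kernel_def)

lemma nt_kernel_infiniteI:
  assumes "\<And>a. a > 0 \<Longrightarrow> filterlim (\<lambda>z. Im (the (f z)) / Im z) at_top (ntf x a)"
  shows "bd_kernel_infinite f x"
  unfolding bd_kernel_infinite_def nt_limit_None
proof (intro allI impI)
  fix a M :: real assume a: "a > 0"
  have "\<forall>\<^sub>F z in ntf x a. max M 0 < Im (the (f z)) / Im z"
    using assms[OF a] unfolding filterlim_at_top_dense by blast
  then show "\<forall>\<^sub>F z in ntf x a. \<forall>v. nev_kernel f z z = Some v \<longrightarrow> M < norm v"
  proof eventually_elim
    case (elim z)
    show ?case
    proof (intro allI impI)
      fix v assume "nev_kernel f z z = Some v"
      then have "v = of_real (Im (the (f z)) / Im z)"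
        by (auto simp: nev_kernel_diag split: option.splits)
      then have "norm v = \<bar>Im (the (f z)) / Im z\<bar>" by (simp only: norm_of_real)
      then show "M < norm v"
        using elim abs_ge_self[of "Im (the (f z)) / Im z"] by (auto intro: less_le_trans)
    qed
  qed
qed

lemma ext_nevanlinna_cases:
  assumes "\<phi> \<in> ext_nevanlinna"
  obtains (fin) g where "g \<in> nevanlinna" "\<And>z. Im z > 0 \<Longrightarrow> \<phi> z = Some (g z)"
    | (inf) "\<And>z. Im z > 0 \<Longrightarrow> \<phi> z = None"
  using assms by (auto simp: ext_nevanlinna_def upper_half_plane_def)

lemma sphere_regular_quotient:
  assumes "N holomorphic_on upper_half_plane" "Q holomorphic_on upper_half_plane" "R holomorphic_on upper_half_plane"
    and w: "\<And>z. Im z > 0 \<Longrightarrow> w z = (if Q z = 0 then None else Some (R z + N z / Q z))"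
  shows "sphere_regular w"
  unfolding sphere_regular_def
proof (intro ballI impI)
  fix z assume z: "z \<in> upper_half_plane" "w z \<noteq> None"
  let ?U = "upper_half_plane \<inter> Q -` (- {0})"
  have "open upper_half_plane"
    unfolding upper_half_plane_def by (rule open_halfspace_Im_gt)
  then have op: "open ?U"
    by (intro continuous_open_preimage holomorphic_on_imp_continuous_on assms) auto
  have "(\<lambda>u. R u + N u / Q u) holomorphic_on ?U"
    by (intro holomorphic_intros holomorphic_on_subset[OF assms(1)] holomorphic_on_subset[OF assms(2)]
        holomorphic_on_subset[OF assms(3)]) auto
  then have "(\<lambda>u. the (w u)) holomorphic_on ?U"
    by (rule holomorphic_transform) (auto simp: w upper_half_plane_def)
  moreover have "z \<in> ?U" using z w by (auto simp: upper_half_plane_def split: if_splits)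
  ultimately show "(\<lambda>u. the (w u)) field_differentiable at z"
    using op holomorphic_on_imp_differentiable_at by blast
qed

lemma sphere_regular_nevanlinna:
  assumes "g \<in> nevanlinna" "\<And>z. Im z > 0 \<Longrightarrow> \<phi> z = Some (g z)"
  shows "sphere_regular \<phi>"
  by (rule sphere_regular_quotient[of "\<lambda>_. 0" "\<lambda>_. 1" g])
     (use assms in \<open>auto simp: nevanlinna_def\<close>)

text \<open>A quotient and its reciprocal have product 1, so a finite derivative is incompatible
  with \<open>q\<close>. The kernel of \<open>\<phi>\<close> is that of \<open>g - \<eta>\<close>,
  because \<open>\<eta>\<close> is real. Once the boundary value is \<open>\<eta>\<close>, only C2
  can hold.\<close>

lemma parameter_infinite_derivative:
  assumes g: "g \<in> nevanlinna" "\<And>z. Im z > 0 \<Longrightarrow> \<phi> z = Some (g z)"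
    and ne: "\<And>z. Im z > 0 \<Longrightarrow> g z \<noteq> of_real \<eta>"
    and q: "\<And>a. a > 0 \<Longrightarrow> ((\<lambda>z. (z - of_real x) / (g z - of_real \<eta>)) \<longlongrightarrow> 0) (ntf x a)"
    and val: "bd_value \<phi> x \<eta>"
  shows "\<not> bd_deriv \<phi> x d" "bd_kernel_infinite \<phi> x"
proof -
  have val': "nt_limit \<phi> x (Some (of_real \<eta>))" using val by (simp add: bd_value_def)
  show "\<not> bd_deriv \<phi> x d"
  proof
    assume "bd_deriv \<phi> x d"
    then have "((\<lambda>y. (the (\<phi> (vert x y)) - of_real \<eta>) / (vert x y - of_real x)) \<longlongrightarrow> of_real d) (at_right 0)"
      using nt_deriv_imp_vertical_quotient[OF sphere_regular_nevanlinna[OF g] val'] by (simp add: bd_deriv_def)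
    moreover have "((\<lambda>y. (vert x y - of_real x) / (g (vert x y) - of_real \<eta>)) \<longlongrightarrow> 0) (at_right 0)"
      by (rule filterlim_compose[OF q[OF zero_less_one_real] filterlim_vert[OF zero_less_one_real]])
    ultimately have "((\<lambda>y. (the (\<phi> (vert x y)) - of_real \<eta>) / (vert x y - of_real x) *
        ((vert x y - of_real x) / (g (vert x y) - of_real \<eta>))) \<longlongrightarrow> of_real d * 0) (at_right 0)"
      by (rule tendsto_mult)
    moreover have "\<forall>\<^sub>F y in at_right 0. (the (\<phi> (vert x y)) - of_real \<eta>) / (vert x y - of_real x) *
        ((vert x y - of_real x) / (g (vert x y) - of_real \<eta>)) = 1"
      using eventually_at_right_less[of 0]
      by eventually_elim (use g(2) ne in \<open>simp\<close>)
    ultimately have "((\<lambda>y. 1 :: complex) \<longlongrightarrow> 0) (at_right (0::real))"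
      using Lim_transform_eventually by fastforce
    then show False by (simp add: tendsto_const_iff)
  qed
  show "bd_kernel_infinite \<phi> x"
  proof (rule nt_kernel_infiniteI)
    fix a :: real assume a: "a > 0"
    have gl: "((\<lambda>z. g z - of_real \<eta>) \<longlongrightarrow> 0) (ntf x a)"
    proof -
      have "((\<lambda>z. the (\<phi> z) - of_real \<eta>) \<longlongrightarrow> of_real \<eta> - of_real \<eta>) (ntf x a)"
        using val' a unfolding nt_limit_Some by (intro tendsto_intros) auto
      then show ?thesis
        by (rule Lim_transform_eventually[THEN tendsto_eq_rhs])
           (use eventually_ntf_upper[of x a] in eventually_elim, use g(2) in auto)
    qed
    have "filterlim (\<lambda>z. Im (g z - of_real \<eta>) / Im z) at_top (ntf x a)"
    proof (rule nevanlinna_kernel_at_top[OF _ _ q gl])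
      show "(\<lambda>z. g z - of_real \<eta>) \<in> nevanlinna"
        using g(1) by (auto simp: nevanlinna_def intro!: holomorphic_intros)
    qed (use ne in auto)
    then show "filterlim (\<lambda>z. Im (the (\<phi> z)) / Im z) at_top (ntf x a)"
      by (rule filterlim_mono_eventually[OF _ order_refl order_refl])
         (use eventually_ntf_upper[of x a] in eventually_elim, use g(2) in auto)
  qed
qed

text \<open>On the vertical ray the kernel is at most the norm of the difference quotient,
  \<open>\<eta>\<close> being real, and so stays below \<open>\<bar>D\<bar> + 1\<close>; this rules
  out C2.\<close>

lemma parameter_finite_derivative:
  assumes g: "g \<in> nevanlinna" "\<And>z. Im z > 0 \<Longrightarrow> \<phi> z = Some (g z)"
    and q: "\<And>a. a > 0 \<Longrightarrow> ((\<lambda>z. (g z - of_real \<eta>) / (z - of_real x)) \<longlongrightarrow> of_real D) (ntf x a)"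
  shows "bd_value \<phi> x \<eta>" "bd_deriv \<phi> x D" "\<not> bd_kernel_infinite \<phi> x"
proof -
  have fin: "\<forall>\<^sub>F z in ntf x a. \<phi> z = Some (g z)" for a
    using eventually_ntf_upper[of x a] by eventually_elim (rule g(2))
  have "((\<lambda>z. (the (\<phi> z) - of_real \<eta>) / (z - of_real x)) \<longlongrightarrow> of_real D) (ntf x a)" if "a > 0" for a
    using q[OF that] by (rule Lim_transform_eventually) (use fin[of a] in eventually_elim, auto)
  moreover have "\<forall>\<^sub>F z in ntf x a. \<phi> z \<noteq> None" for a
    using fin[of a] by eventually_elim auto
  ultimately show "bd_value \<phi> x \<eta>" "bd_deriv \<phi> x D"
    unfolding bd_value_def bd_deriv_def
    using nt_limit_of_quotient_limit[OF sphere_regular_nevanlinna[OF g], of x "of_real \<eta>" "of_real D"] by auto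
  show "\<not> bd_kernel_infinite \<phi> x"
  proof
    assume "bd_kernel_infinite \<phi> x"
    then have inf: "\<forall>\<^sub>F z in ntf x 1. \<forall>v. nev_kernel \<phi> z z = Some v \<longrightarrow> \<bar>D\<bar> + 1 < norm v"
      unfolding bd_kernel_infinite_def nt_limit_None by simp
    have lim: "((\<lambda>y. norm ((g (vert x y) - of_real \<eta>) / (vert x y - of_real x))) \<longlongrightarrow> norm (complex_of_real D)) (at_right 0)"
      by (intro tendsto_norm filterlim_compose[OF q[OF zero_less_one_real] filterlim_vert[OF zero_less_one_real]])
    have "\<forall>\<^sub>F y in at_right 0. norm ((g (vert x y) - of_real \<eta>) / (vert x y - of_real x)) < \<bar>D\<bar> + 1"
      by (rule order_tendstoD(2)[OF lim]) simp
    moreover have "\<forall>\<^sub>F y in at_right 0. \<forall>v. nev_kernel \<phi> (vert x y) (vert x y) = Some v \<longrightarrow> \<bar>D\<bar> + 1 < norm v"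
      using inf filterlim_vert[of 1 x] unfolding filterlim_iff by auto
    ultimately have "\<forall>\<^sub>F y in at_right (0::real). False"
      using eventually_at_right_less[of 0]
    proof eventually_elim
      case (elim y)
      have "\<bar>Im (g (vert x y))\<bar> \<le> norm (g (vert x y) - of_real \<eta>)"
        using abs_Im_le_cmod[of "g (vert x y) - of_real \<eta>"] by simp
      then have "\<bar>Im (g (vert x y)) / y\<bar> \<le> norm ((g (vert x y) - of_real \<eta>) / (vert x y - of_real x))"
        using elim(3) by (simp add: norm_divide norm_mult divide_right_mono)
      moreover have "\<bar>D\<bar> + 1 < norm (complex_of_real (Im (g (vert x y)) / y))"
        using elim(2,3) g(2)[of "vert x y"] by (simp add: nev_kernel_diag)
      ultimately show ?case using elim(1) unfolding norm_of_real by linarith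
    qed
    then show False by simp
  qed
qed

section \<open>The transformed function near a node\<close>

text \<open>
  The transform \<open>w\<close> of \<open>\<phi>\<close> once the pole of \<open>\<Theta>\<close> at the node \<open>x\<close> is cleared; \<open>e\<close>, \<open>p\<close> and \<open>w0\<close> stand for
  the paper's \<open>e_i\<close>, \<open>p_ii\<close> (with tildes) and \<open>w_i\<close>.
\<close>

locale node_model =
  fixes x \<eta> e p \<gamma> w0 \<alpha> \<beta> \<sigma> :: real
    and A B H S :: "complex \<Rightarrow> complex"
    and \<phi> w :: "complex \<Rightarrow> sphere"
  assumes e: "e \<noteq> 0"
    and A: "real_at x A \<alpha>" and B: "real_at x B \<beta>" and H: "real_at x H (- 1 / e)" and S: "real_at x S \<sigma>"
    and hol: "A holomorphic_on upper_half_plane" "B holomorphic_on upper_half_plane"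
      "H holomorphic_on upper_half_plane" "S holomorphic_on upper_half_plane"
    and w_Some: "\<And>z v. Im z > 0 \<Longrightarrow> \<phi> z = Some v \<Longrightarrow>
      w z = (let t = z - of_real x; u = v - of_real \<eta>;
                 Q = of_real e * u + t * (of_real (p / e) + t * S z + B z * u)
             in if Q = 0 then None else Some (of_real w0 + t * of_real \<gamma> + t\<^sup>2 * (H z + A z * u) / Q))"
    and w_None: "\<And>z. Im z > 0 \<Longrightarrow> \<phi> z = None \<Longrightarrow>
      w z = (let t = z - of_real x; Q = of_real e + t * B z
             in if Q = 0 then None else Some (of_real w0 + t * of_real \<gamma> + t\<^sup>2 * A z / Q))"
begin

text \<open>The value \<open>p / e\<close> at \<open>x\<close> enters the limit of the denominator;
  the remainder \<open>S\<close> matters once the leading terms cancel, that is for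
  \<open>e\<^sup>2 * D + p = 0\<close>.\<close>

definition G :: "complex \<Rightarrow> complex" where
  "G z = of_real (p / e) + (z - of_real x) * S z"

lemma real_at_G: "real_at x G (p / e)"
  using real_at_add[OF real_at_const real_at_mult[OF real_at_ident S], of "p / e"]
  unfolding G_def by simp

lemma w_fin:
  assumes "\<phi> z = Some v" "Im z > 0"
  shows "w z = (let t = z - of_real x; u = v - of_real \<eta>; Q = of_real e * u + t * (G z + B z * u)
             in if Q = 0 then None else Some (of_real w0 + t * of_real \<gamma> + t\<^sup>2 * (H z + A z * u) / Q))"
  by (simp add: w_Some[OF assms(2,1)] G_def Let_def)

lemma w_regular:
  assumes "\<phi> \<in> ext_nevanlinna"
  shows "sphere_regular w"
  using assms
proof (cases rule: ext_nevanlinna_cases)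
  case (fin g)
  have hg: "g holomorphic_on upper_half_plane" using fin(1) by (simp add: nevanlinna_def)
  show ?thesis
    by (rule sphere_regular_quotient[of
          "\<lambda>z. (z - of_real x)\<^sup>2 * (H z + A z * (g z - of_real \<eta>))"
          "\<lambda>z. of_real e * (g z - of_real \<eta>) + (z - of_real x) * (of_real (p / e) + (z - of_real x) * S z + B z * (g z - of_real \<eta>))"
          "\<lambda>z. of_real w0 + (z - of_real x) * of_real \<gamma>"])
       (intro holomorphic_intros hg hol | simp only: w_Some[OF _ fin(2)] Let_def)+
next
  case inf
  show ?thesis
    by (rule sphere_regular_quotient[of "\<lambda>z. (z - of_real x)\<^sup>2 * A z"
          "\<lambda>z. of_real e + (z - of_real x) * B z" "\<lambda>z. of_real w0 + (z - of_real x) * of_real \<gamma>"])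
       (intro holomorphic_intros hol | simp only: w_None[OF _ inf] Let_def)+
qed

lemma real_at_limits:
  "(A \<longlongrightarrow> of_real \<alpha>) (ntf x a)" "(B \<longlongrightarrow> of_real \<beta>) (ntf x a)"
  "(H \<longlongrightarrow> of_real (- 1 / e)) (ntf x a)" "(S \<longlongrightarrow> of_real \<sigma>) (ntf x a)"
  "(G \<longlongrightarrow> of_real (p / e)) (ntf x a)"
  by (intro real_at_tendsto A B H S real_at_G)+

text \<open>Every nondegenerate case is brought to this shape. The nonzero limit \<open>M\<close>
  keeps poles of \<open>w\<close> away from \<open>x\<close> in each sector, and
  \<open>L / M\<close> is the correction to \<open>\<gamma>\<close>.\<close>

lemma w_limits_from_form:
  assumes reg: "\<phi> \<in> ext_nevanlinna"
    and N: "\<And>a. a > 0 \<Longrightarrow> (N \<longlongrightarrow> L) (ntf x a)" and Q: "\<And>a. a > 0 \<Longrightarrow> (Q \<longlongrightarrow> M) (ntf x a)" and M: "M \<noteq> 0"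
    and form: "\<And>z. Im z > 0 \<Longrightarrow> Q z \<noteq> 0 \<Longrightarrow>
       w z = Some (of_real w0 + (z - of_real x) * (of_real \<gamma> + N z / Q z))"
  shows "nt_limit w x (Some (of_real w0))" "nt_limit (sphere_deriv w) x (Some (of_real \<gamma> + L / M))"
proof -
  have ev: "\<forall>\<^sub>F z in ntf x a. w z = Some (of_real w0 + (z - of_real x) * (of_real \<gamma> + N z / Q z))" if "a > 0" for a
    using eventually_ntf_upper tendsto_imp_eventually_ne[OF Q[OF that] M] by eventually_elim (rule form)
  have fin: "\<forall>\<^sub>F z in ntf x a. w z \<noteq> None" if "a > 0" for a
    using ev[OF that] by eventually_elim simp
  have dq: "((\<lambda>z. (the (w z) - of_real w0) / (z - of_real x)) \<longlongrightarrow> of_real \<gamma> + L / M) (ntf x a)" if "a > 0" for a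
  proof -
    have "((\<lambda>z. of_real \<gamma> + N z / Q z) \<longlongrightarrow> of_real \<gamma> + L / M) (ntf x a)"
      by (intro tendsto_intros N Q that M)
    then show ?thesis
      by (rule Lim_transform_eventually)
         (use ev[OF that] eventually_ntf_upper in eventually_elim, auto)
  qed
  show "nt_limit w x (Some (of_real w0))" "nt_limit (sphere_deriv w) x (Some (of_real \<gamma> + L / M))"
    using nt_limit_of_quotient_limit[OF w_regular[OF reg] fin dq] by auto
qed

lemma w_parameter_infinity:
  assumes "\<phi> \<in> ext_nevanlinna" "\<And>z. Im z > 0 \<Longrightarrow> \<phi> z = None"
  shows "bd_value w x w0" "bd_deriv w x \<gamma>"
proof -
  note lims = real_at_limits tendsto_diff_ntf
  have N: "((\<lambda>z. (z - of_real x) * A z) \<longlongrightarrow> 0 * of_real \<alpha>) (ntf x a)" for a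
    by (intro tendsto_intros lims)
  have Q: "((\<lambda>z. of_real e + (z - of_real x) * B z) \<longlongrightarrow> of_real e + 0 * of_real \<beta>) (ntf x a)" for a
    by (intro tendsto_intros lims)
  have form: "w z = Some (of_real w0 + (z - of_real x) * (of_real \<gamma> + (z - of_real x) * A z / (of_real e + (z - of_real x) * B z)))"
    if "Im z > 0" "of_real e + (z - of_real x) * B z \<noteq> 0" for z
    using that by (simp add: w_None[OF that(1) assms(2)[OF that(1)]] Let_def power2_eq_square distrib_left)
  show "bd_value w x w0" "bd_deriv w x \<gamma>"
    using w_limits_from_form[OF assms(1) N Q _ form] e by (auto simp: bd_value_def bd_deriv_def)
qed

lemma w_infinite_derivative:
  assumes reg: "\<phi> \<in> ext_nevanlinna" and g: "\<And>z. Im z > 0 \<Longrightarrow> \<phi> z = Some (g z)"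
    and ne: "\<And>z. Im z > 0 \<Longrightarrow> g z \<noteq> of_real \<eta>"
    and q: "\<And>a. a > 0 \<Longrightarrow> ((\<lambda>z. (z - of_real x) / (g z - of_real \<eta>)) \<longlongrightarrow> 0) (ntf x a)"
  shows "bd_value w x w0" "bd_deriv w x \<gamma>"
proof -
  \<comment> \<open>Numerator and denominator are divided by \<open>u = g z - \<eta>\<close> because
    \<open>u / t\<close> has no finite limit here; its reciprocal \<open>r\<close> tends to
    0.\<close>
  define r where "r = (\<lambda>z. (z - of_real x) / (g z - of_real \<eta>))"
  have r: "(r \<longlongrightarrow> 0) (ntf x a)" if "a > 0" for a using q[OF that] by (simp add: r_def)
  note lims = real_at_limits tendsto_diff_ntf r
  have N: "((\<lambda>z. r z * H z + (z - of_real x) * A z) \<longlongrightarrow> 0 * of_real (- 1 / e) + 0 * of_real \<alpha>) (ntf x a)" if "a > 0" for a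
    by (intro tendsto_intros lims that)
  have Q: "((\<lambda>z. of_real e + r z * G z + (z - of_real x) * B z) \<longlongrightarrow> of_real e + 0 * of_real (p / e) + 0 * of_real \<beta>) (ntf x a)" if "a > 0" for a
    by (intro tendsto_intros lims that)
  have form: "w z = Some (of_real w0 + (z - of_real x) * (of_real \<gamma> +
      (r z * H z + (z - of_real x) * A z) / (of_real e + r z * G z + (z - of_real x) * B z)))"
    if z: "Im z > 0" and nz: "of_real e + r z * G z + (z - of_real x) * B z \<noteq> 0" for z
  proof -
    define t where "t = z - of_real x"
    define u where "u = g z - of_real \<eta>"
    have u: "u \<noteq> 0" using ne[OF z] by (simp add: u_def)
    have ru: "r z * u = t" using u by (simp add: r_def t_def u_def)
    define Qu where "Qu = of_real e * u + t * (G z + B z * u)"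
    have Qu: "Qu = u * (of_real e + r z * G z + t * B z)"
      unfolding Qu_def ru[symmetric] by (simp add: algebra_simps)
    have Nu: "t\<^sup>2 * (H z + A z * u) = t * u * (r z * H z + t * A z)"
    proof -
      have "t\<^sup>2 * (H z + A z * u) = t * (r z * u) * H z + t\<^sup>2 * A z * u"
        unfolding ru by (simp add: power2_eq_square algebra_simps)
      then show ?thesis by (simp add: power2_eq_square algebra_simps)
    qed
    have "Qu \<noteq> 0" using nz u by (simp add: Qu t_def)
    then have "w z = Some (of_real w0 + t * of_real \<gamma> + t\<^sup>2 * (H z + A z * u) / Qu)"
      using w_fin[OF g[OF z] z] by (simp add: Let_def t_def u_def Qu_def)
    also have "t\<^sup>2 * (H z + A z * u) / Qu = t * ((r z * H z + t * A z) / (of_real e + r z * G z + t * B z))"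
      unfolding Nu Qu using u by simp
    finally show ?thesis by (simp add: t_def distrib_left)
  qed
  show "bd_value w x w0" "bd_deriv w x \<gamma>"
    using w_limits_from_form[OF reg N Q _ form] e by (auto simp: bd_value_def bd_deriv_def)
qed

text \<open>With a finite limit of \<open>u / t\<close> the division is by \<open>t\<close> instead
  of \<open>u\<close>. The pole case is kept exact, since \<open>Q\<close> may tend to 0.\<close>

lemma w_difference_form:
  assumes g: "\<phi> z = Some (g z)" and z: "Im z > 0"
  defines "Q \<equiv> of_real e * ((g z - of_real \<eta>) / (z - of_real x)) + G z + B z * (g z - of_real \<eta>)"
  shows "w z = (if Q = 0 then None else Some (of_real w0 + (z - of_real x) * (of_real \<gamma> +
      (H z + A z * (g z - of_real \<eta>)) / Q)))"
proof -
  define t where "t = z - of_real x"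
  define u where "u = g z - of_real \<eta>"
  have t: "t \<noteq> 0" using z by (auto simp: t_def)
  have Qu: "of_real e * u + t * (G z + B z * u) = t * Q"
    using t unfolding Q_def t_def[symmetric] u_def[symmetric] by (simp add: algebra_simps)
  have "t\<^sup>2 * (H z + A z * u) / (t * Q) = t * ((H z + A z * u) / Q)"
    using t by (simp add: power2_eq_square)
  then show ?thesis
    using w_fin[of z "g z"] g z t by (simp add: Let_def Qu flip: t_def u_def) (simp add: distrib_left)
qed

section \<open>The transform when the parameter has a finite derivative\<close>

context
  fixes g :: "complex \<Rightarrow> complex" and D :: real
  assumes reg: "\<phi> \<in> ext_nevanlinna" and g: "\<And>z. Im z > 0 \<Longrightarrow> \<phi> z = Some (g z)"
    and q: "\<And>a. a > 0 \<Longrightarrow> ((\<lambda>z. (g z - of_real \<eta>) / (z - of_real x)) \<longlongrightarrow> of_real D) (ntf x a)"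
begin

lemma g_limit: "a > 0 \<Longrightarrow> ((\<lambda>z. g z - of_real \<eta>) \<longlongrightarrow> 0) (ntf x a)"
proof -
  assume a: "a > 0"
  have "((\<lambda>z. (g z - of_real \<eta>) / (z - of_real x) * (z - of_real x)) \<longlongrightarrow> of_real D * 0) (ntf x a)"
    by (intro tendsto_intros q a tendsto_diff_ntf)
  then show ?thesis
    by (rule Lim_transform_eventually[THEN tendsto_eq_rhs])
       (use eventually_ntf_upper[of x a] in eventually_elim, auto)
qed

lemma numerator_limit:
  "a > 0 \<Longrightarrow> ((\<lambda>z. H z + A z * (g z - of_real \<eta>)) \<longlongrightarrow> of_real (- 1 / e)) (ntf x a)"
  by (rule tendsto_eq_rhs) (rule tendsto_intros real_at_limits g_limit | simp)+

lemma denominator_limit: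
  "a > 0 \<Longrightarrow> ((\<lambda>z. of_real e * ((g z - of_real \<eta>) / (z - of_real x)) + G z + B z * (g z - of_real \<eta>))
     \<longlongrightarrow> of_real (e * D + p / e)) (ntf x a)"
  by (rule tendsto_eq_rhs) (rule tendsto_intros real_at_limits g_limit q | simp)+

lemma w_finite_derivative:
  assumes "e\<^sup>2 * D + p \<noteq> 0"
  shows "bd_value w x w0" "bd_deriv w x (\<gamma> - 1 / (e\<^sup>2 * D + p))"
proof -
  have eq: "e * (e * D + p / e) = e\<^sup>2 * D + p" using e by (simp add: power2_eq_square algebra_simps)
  then have ne: "e * D + p / e \<noteq> 0" using assms by auto
  have ne': "complex_of_real (e * D + p / e) \<noteq> 0" using ne of_real_eq_0_iff by blast
  have "- 1 / e / (e * D + p / e) = - 1 / (e\<^sup>2 * D + p)"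
    unfolding eq[symmetric] divide_divide_eq_left ..
  then have lim: "complex_of_real \<gamma> + of_real (- 1 / e) / of_real (e * D + p / e) = of_real (\<gamma> - 1 / (e\<^sup>2 * D + p))"
    by (metis (no_types) add_uminus_conv_diff minus_divide_left of_real_add of_real_divide)
  let ?Q = "\<lambda>z. of_real e * ((g z - of_real \<eta>) / (z - of_real x)) + G z + B z * (g z - of_real \<eta>)"
  have form: "w z = Some (of_real w0 + (z - of_real x) * (of_real \<gamma> + (H z + A z * (g z - of_real \<eta>)) / ?Q z))"
    if "Im z > 0" "?Q z \<noteq> 0" for z
    using w_difference_form[where g = g, OF g[OF that(1)] that(1)] by (simp only: that(2) if_False)
  show "bd_value w x w0" "bd_deriv w x (\<gamma> - 1 / (e\<^sup>2 * D + p))"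
    unfolding bd_value_def bd_deriv_def lim[symmetric]
    using w_limits_from_form[OF reg numerator_limit denominator_limit ne' form] by auto
qed

text \<open>The difference quotient of \<open>w\<close> minus \<open>\<gamma>\<close>, times the
  denominator, equals the numerator. A finite derivative would send the left side to 0, while the
  right side tends to \<open>- 1 / e\<close>. This keeps C5 and C6 out of the three
  equivalences.\<close>

lemma w_degenerate_no_derivative:
  assumes "e\<^sup>2 * D + p = 0" "bd_value w x w0"
  shows "\<not> bd_deriv w x d"
proof
  assume "bd_deriv w x d"
  have "e * (e * D + p / e) = 0" using assms(1) e by (simp add: power2_eq_square algebra_simps)
  then have z0: "e * D + p / e = 0" using e by simp
  let ?u = "\<lambda>y. (the (w (vert x y)) - of_real w0) / (vert x y - of_real x)"
  let ?Q = "\<lambda>z. of_real e * ((g z - of_real \<eta>) / (z - of_real x)) + G z + B z * (g z - of_real \<eta>)"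
  let ?N = "\<lambda>z. H z + A z * (g z - of_real \<eta>)"
  have u: "(?u \<longlongrightarrow> of_real d) (at_right 0)"
    using nt_deriv_imp_vertical_quotient[OF w_regular[OF reg]] assms(2) \<open>bd_deriv w x d\<close>
    by (simp add: bd_value_def bd_deriv_def)
  have Q: "((\<lambda>y. ?Q (vert x y)) \<longlongrightarrow> 0) (at_right 0)"
    using filterlim_compose[OF denominator_limit[OF zero_less_one_real] filterlim_vert[OF zero_less_one_real]] z0
    by (simp only: of_real_0)
  have N: "((\<lambda>y. ?N (vert x y)) \<longlongrightarrow> of_real (- 1 / e)) (at_right 0)"
    by (rule filterlim_compose[OF numerator_limit[OF zero_less_one_real] filterlim_vert[OF zero_less_one_real]])
  have "\<forall>\<^sub>F z in ntf x 1. w z \<noteq> None"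
    using assms(2) by (simp add: bd_value_def nt_limit_Some)
  then have "\<forall>\<^sub>F y in at_right 0. w (vert x y) \<noteq> None"
    using filterlim_vert[of 1 x] unfolding filterlim_iff by auto
  then have "\<forall>\<^sub>F y in at_right 0. (?u y - of_real \<gamma>) * ?Q (vert x y) = ?N (vert x y)"
    using eventually_at_right_less[of 0]
  proof eventually_elim
    case (elim y)
    define s where "s = vert x y"
    have y: "Im s > 0" using elim(2) by (simp add: s_def)
    have nz: "s - of_real x \<noteq> 0" using y by auto
    note form = w_difference_form[where g = g, OF g[OF y] y]
    have Qn: "?Q s \<noteq> 0"
    proof
      assume "?Q s = 0"
      then have "w s = None" using form by (simp only: refl if_True)
      then show False using elim(1) by (simp add: s_def)
    qed
    then have "w s = Some (of_real w0 + (s - of_real x) * (of_real \<gamma> + ?N s / ?Q s))"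
      using form by (simp only: if_False)
    then have eq: "(the (w s) - of_real w0) / (s - of_real x) - of_real \<gamma> = ?N s / ?Q s"
      using nz by simp
    show ?case
      unfolding s_def[symmetric] by (rule iffD1[OF nonzero_eq_divide_eq[OF Qn] eq])
  qed
  moreover have "((\<lambda>y. (?u y - of_real \<gamma>) * ?Q (vert x y)) \<longlongrightarrow> (of_real d - of_real \<gamma>) * 0) (at_right 0)"
    by (intro tendsto_intros u Q)
  ultimately have "((\<lambda>y. ?N (vert x y)) \<longlongrightarrow> (of_real d - of_real \<gamma>) * 0) (at_right 0)"
    by (rule Lim_transform_eventually[rotated])
  with N have "complex_of_real (- 1 / e) = (of_real d - of_real \<gamma>) * 0"
    by (intro tendsto_unique[OF trivial_limit_at_right_real])
  then show False using e by simp
qed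

end

text \<open>For \<open>u = 0\<close> and \<open>p = 0\<close> the denominator is
  \<open>t\<^sup>2 * S z\<close> and \<open>t\<^sup>2\<close> cancels completely: \<open>w\<close>
  differs from \<open>w0 + t * \<gamma>\<close> by \<open>H / S\<close>, whose limit is nonzero or
  infinite because \<open>H\<close> tends to \<open>- 1 / e\<close>.\<close>

lemma w_constant_degenerate:
  assumes g: "\<And>z. Im z > 0 \<Longrightarrow> \<phi> z = Some (of_real \<eta>)" and p: "p = 0"
  shows "\<exists>L. nt_limit w x L \<and> L \<noteq> Some (of_real w0)"
proof -
  have form: "w z = (if S z = 0 then None else Some (of_real w0 + (z - of_real x) * of_real \<gamma> + H z / S z))"
    if z: "Im z > 0" for z
  proof -
    have "z - of_real x \<noteq> 0" using z by auto
    moreover have "G z = (z - of_real x) * S z" unfolding G_def by (simp add: p)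
    ultimately show ?thesis
      using w_fin[OF g[OF z] z] by (simp add: Let_def power2_eq_square)
  qed
  show ?thesis
  proof (cases "\<sigma> = 0")
    case False
    have "nt_limit w x (Some (of_real w0 + of_real (- 1 / e) / of_real \<sigma>))"
      unfolding nt_limit_Some
    proof (intro allI impI conjI)
      fix a :: real assume "a > 0"
      have ev: "\<forall>\<^sub>F z in ntf x a. w z = Some (of_real w0 + (z - of_real x) * of_real \<gamma> + H z / S z)"
      proof -
        have "\<forall>\<^sub>F z in ntf x a. S z \<noteq> 0"
          by (rule tendsto_imp_eventually_ne[OF real_at_limits(4)]) (use False in simp)
        with eventually_ntf_upper[of x a] show ?thesis
          by eventually_elim (use form in simp)
      qed
      then show "\<forall>\<^sub>F z in ntf x a. w z \<noteq> None" by eventually_elim simp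
      have "((\<lambda>z. of_real w0 + (z - of_real x) * of_real \<gamma> + H z / S z) \<longlongrightarrow>
          of_real w0 + 0 * of_real \<gamma> + of_real (- 1 / e) / of_real \<sigma>) (ntf x a)"
        by (intro tendsto_intros tendsto_diff_ntf real_at_limits) (use False in simp)
      then show "((\<lambda>z. the (w z)) \<longlongrightarrow> of_real w0 + of_real (- 1 / e) / of_real \<sigma>) (ntf x a)"
        by (rule Lim_transform_eventually[THEN tendsto_eq_rhs]) (use ev in eventually_elim, auto)
    qed
    moreover have "of_real (- 1 / e) / complex_of_real \<sigma> \<noteq> 0" using e False by simp
    ultimately show ?thesis by (metis add_cancel_right_right option.inject)
  next
    case True
    \<comment> \<open>\<open>S\<close> may have zeros near \<open>x\<close> or vanish identically,
      so the estimate is proved multiplied by \<open>norm (S z)\<close>. The three summands of the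
      constant pay for \<open>M\<close>, for \<open>w0\<close>, and for \<open>t * \<gamma>\<close>
      with \<open>norm t < 1\<close>.\<close>
    have "nt_limit w x None"
      unfolding nt_limit_None
    proof (intro allI impI)
      fix a M :: real assume "a > 0"
      have "((\<lambda>z. norm (H z) - (\<bar>M\<bar> + \<bar>w0\<bar> + \<bar>\<gamma>\<bar>) * norm (S z)) \<longlongrightarrow>
          norm (complex_of_real (- 1 / e)) - (\<bar>M\<bar> + \<bar>w0\<bar> + \<bar>\<gamma>\<bar>) * norm (complex_of_real \<sigma>)) (ntf x a)"
        by (intro tendsto_intros real_at_limits)
      then have l: "((\<lambda>z. norm (H z) - (\<bar>M\<bar> + \<bar>w0\<bar> + \<bar>\<gamma>\<bar>) * norm (S z)) \<longlongrightarrow> 1 / \<bar>e\<bar>) (ntf x a)"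
        using True by (simp add: norm_divide)
      have ev1: "\<forall>\<^sub>F z in ntf x a. 0 < norm (H z) - (\<bar>M\<bar> + \<bar>w0\<bar> + \<bar>\<gamma>\<bar>) * norm (S z)"
        by (rule order_tendstoD(1)[OF l]) (use e in simp)
      have ev2: "\<forall>\<^sub>F z in ntf x a. norm (z - of_real x) < 1"
        using order_tendstoD(2)[OF tendsto_norm[OF tendsto_diff_ntf], of 1] by simp
      show "\<forall>\<^sub>F z in ntf x a. \<forall>v. w z = Some v \<longrightarrow> M < norm v"
        using ev1 ev2 eventually_ntf_upper
      proof eventually_elim
        case (elim z)
        show ?case
        proof (intro allI impI)
          fix v assume v: "w z = Some v"
          then have Sz: "S z \<noteq> 0" and vz: "v = of_real w0 + (z - of_real x) * of_real \<gamma> + H z / S z"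
            using form[OF elim(3)] by (auto split: if_splits)
          have "H z = (v - of_real w0 - (z - of_real x) * of_real \<gamma>) * S z"
            using Sz by (simp add: vz)
          then have "norm (H z) = norm (v - of_real w0 - (z - of_real x) * of_real \<gamma>) * norm (S z)"
            by (simp add: norm_mult)
          then have "(\<bar>M\<bar> + \<bar>w0\<bar> + \<bar>\<gamma>\<bar>) * norm (S z) < norm (v - of_real w0 - (z - of_real x) * of_real \<gamma>) * norm (S z)"
            using elim(1) by simp
          then have "\<bar>M\<bar> + \<bar>w0\<bar> + \<bar>\<gamma>\<bar> < norm (v - of_real w0 - (z - of_real x) * of_real \<gamma>)"
            by (rule mult_right_less_imp_less) simp
          also have "\<dots> \<le> norm v + norm (complex_of_real w0) + norm ((z - of_real x) * complex_of_real \<gamma>)"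
            using norm_triangle_ineq4[of "v - of_real w0" "(z - of_real x) * of_real \<gamma>"]
              norm_triangle_ineq4[of v "of_real w0"] by linarith
          also have "norm ((z - of_real x) * complex_of_real \<gamma>) \<le> 1 * \<bar>\<gamma>\<bar>"
            unfolding norm_mult norm_of_real using elim(2) by (intro mult_right_mono) auto
          finally show "M < norm v" by simp
        qed
      qed
    qed
    then show ?thesis by blast
  qed
qed

text \<open>Insert \<open>g - \<eta> = D * t / E\<close> with \<open>E = 1 - D * t * h\<close>. As
  \<open>p = - (e\<^sup>2 * D)\<close>, the lowest terms of the denominator cancel, and then
  \<open>t\<^sup>2\<close> and \<open>E\<close> drop out of the fraction. The remaining coefficients
  have determinant \<open>(1 / e) * (e * D\<^sup>2) = D\<^sup>2 > 0\<close> at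
  \<open>x\<close>.\<close>

lemma w_degenerate_kernel:
  assumes g: "\<And>z. Im z > 0 \<Longrightarrow> \<phi> z = Some (g z)"
    and h: "h \<in> nevanlinna"
    and gh: "\<And>z. Im z > 0 \<Longrightarrow>
        (g z - of_real \<eta>) * (1 - of_real D * (z - of_real x) * h z) = of_real D * (z - of_real x)"
    and th: "\<And>a. a > 0 \<Longrightarrow> ((\<lambda>z. (z - of_real x) * h z) \<longlongrightarrow> 0) (ntf x a)"
    and D: "D > 0" "e\<^sup>2 * D + p = 0"
    and val: "bd_value w x w0"
  shows "bd_kernel_infinite w x"
proof -
  have pe: "p / e = - e * D"
  proof -
    have "p = - (e * e * D)" using D(2) by (simp add: power2_eq_square)
    then show ?thesis using e by simp
  qed
  \<comment> \<open>\<open>a0\<close> and \<open>b0\<close> multiply \<open>h\<close>,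
    \<open>a1\<close> and \<open>b1\<close> are the free terms. Division by
    \<open>h = - 1 / k\<close> gives the shape \<open>(a0 - a1 * k) / (b0 - b1 * k)\<close>.\<close>
  define a0 where "a0 = (\<lambda>z. - (of_real D * (H z * (z - of_real x))))"
  define a1 where "a1 = (\<lambda>z. H z + of_real D * (A z * (z - of_real x)))"
  define b0 where "b0 = (\<lambda>z. - (of_real D * G z))"
  define b1 where "b1 = (\<lambda>z. S z + of_real D * B z)"
  have ra0: "real_at x a0 0"
    using real_at_uminus[OF real_at_cmult[OF real_at_mult[OF H real_at_ident], of D]] by (simp add: a0_def)
  have ra1: "real_at x a1 (- 1 / e)"
    using real_at_add[OF H real_at_cmult[OF real_at_mult[OF A real_at_ident], of D]] by (simp add: a1_def)
  have rb0: "real_at x b0 (e * D\<^sup>2)"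
    using real_at_uminus[OF real_at_cmult[OF real_at_G, of D]] by (simp add: b0_def pe power2_eq_square mult_ac)
  have rb1: "real_at x b1 (\<sigma> + D * \<beta>)"
    unfolding b1_def by (intro real_at_add S real_at_cmult B)
  define v where "v = (\<lambda>z. (a1 z + a0 z * h z) / (b1 z + b0 z * h z))"
  have form: "w z = (if b1 z + b0 z * h z = 0 then None else Some (of_real w0 + (z - of_real x) * of_real \<gamma> + v z))"
    if z: "Im z > 0" for z
  proof -
    define t where "t = z - of_real x"
    define u where "u = g z - of_real \<eta>"
    define E where "E = 1 - of_real D * t * h z"
    have t: "t \<noteq> 0" using z by (auto simp: t_def)
    have uE: "u * E = of_real D * t" using gh[OF z] by (simp add: u_def E_def t_def)
    have E: "E \<noteq> 0" using uE t D(1) by auto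
    have Gz: "G z = - (of_real e * of_real D) + t * S z" by (simp add: G_def pe t_def)
    have "(of_real e * u + t * (G z + B z * u)) * E = of_real e * (u * E) + t * (G z * E + B z * (u * E))"
      by (simp add: algebra_simps)
    also have "\<dots> = t * (of_real e * of_real D + G z * E + B z * of_real D * t)"
      unfolding uE by (simp add: algebra_simps)
    also have "\<dots> = t\<^sup>2 * (b1 z + b0 z * h z)"
      unfolding b1_def b0_def E_def by (simp add: Gz power2_eq_square algebra_simps)
    finally have Q: "of_real e * u + t * (G z + B z * u) = t\<^sup>2 * (b1 z + b0 z * h z) / E"
      using E by (simp add: eq_divide_eq)
    have "(H z + A z * u) * E = H z * E + A z * (u * E)" by (simp add: algebra_simps)
    also have "\<dots> = a1 z + a0 z * h z"
      unfolding uE unfolding E_def a1_def a0_def t_def[symmetric] by (simp add: algebra_simps)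
    finally have N: "H z + A z * u = (a1 z + a0 z * h z) / E" using E by (simp add: eq_divide_eq)
    have "t\<^sup>2 * (H z + A z * u) / (of_real e * u + t * (G z + B z * u)) = v z"
      unfolding Q N v_def using t E by simp
    moreover have "of_real e * u + t * (G z + B z * u) = 0 \<longleftrightarrow> b1 z + b0 z * h z = 0"
      unfolding Q using t E by simp
    ultimately show ?thesis
      using w_fin[OF g[OF z] z] by (simp add: Let_def flip: t_def u_def)
  qed
  have wv: "\<forall>\<^sub>F z in ntf x a. b1 z + b0 z * h z \<noteq> 0 \<and> the (w z) = of_real w0 + (z - of_real x) * of_real \<gamma> + v z"
    if "a > 0" for a
  proof -
    have "\<forall>\<^sub>F z in ntf x a. w z \<noteq> None" using val that by (simp add: bd_value_def nt_limit_Some)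
    then show ?thesis using eventually_ntf_upper
      by eventually_elim (auto simp: form split: if_splits)
  qed
  have v0: "(v \<longlongrightarrow> 0) (ntf x a)" if a: "a > 0" for a
  proof -
    have "((\<lambda>z. the (w z) - of_real w0 - (z - of_real x) * of_real \<gamma>) \<longlongrightarrow> of_real w0 - of_real w0 - 0 * of_real \<gamma>) (ntf x a)"
      using val a unfolding bd_value_def nt_limit_Some by (intro tendsto_intros tendsto_diff_ntf) auto
    then show ?thesis
      by (rule Lim_transform_eventually[THEN tendsto_eq_rhs]) (use wv[OF a] in eventually_elim, auto)
  qed
  \<comment> \<open>The relation between \<open>v\<close> and \<open>h\<close> solved for
    \<open>h\<close>. The factor of \<open>h\<close> tends to 0 and the right side to
    \<open>- 1 / e\<close>, so \<open>h\<close> tends to infinity.\<close>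
  have cross: "\<forall>\<^sub>F z in ntf x a. h z * (v z * b0 z - a0 z) = a1 z - v z * b1 z" if a: "a > 0" for a
    using wv[OF a]
  proof eventually_elim
    case (elim z)
    then have "v z * (b1 z + b0 z * h z) = a1 z + a0 z * h z" by (simp add: v_def)
    then show ?case by (simp add: algebra_simps)
  qed
  have clim: "((\<lambda>z. a1 z - v z * b1 z) \<longlongrightarrow> of_real (- 1 / e)) (ntf x a)" if a: "a > 0" for a
    by (rule tendsto_eq_rhs)
       (rule tendsto_intros real_at_tendsto[OF ra1] real_at_tendsto[OF rb1] v0[OF a] | simp)+
  have cnz: "\<forall>\<^sub>F z in ntf x a. a1 z - v z * b1 z \<noteq> 0" if a: "a > 0" for a
    by (rule tendsto_imp_eventually_ne[OF clim[OF a]]) (use e in simp)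
  have hnz: "\<forall>\<^sub>F z in ntf x a. h z \<noteq> 0" if a: "a > 0" for a
    using cross[OF a] cnz[OF a] by eventually_elim auto
  \<comment> \<open>A single zero would make \<open>h\<close> identically 0, against
    \<open>hnz\<close>.\<close>
  have hne: "h z \<noteq> 0" if "Im z > 0" for z
  proof
    assume "h z = 0"
    then have "h u = 0" if "Im u > 0" for u
      using nevanlinna_real_value_const[OF h \<open>Im z > 0\<close> _ that] by simp
    moreover have "\<forall>\<^sub>F u in ntf x 1. h u \<noteq> 0" by (rule hnz) simp
    ultimately have "\<forall>\<^sub>F u in ntf x 1. False"
      using eventually_ntf_upper[of x 1] by (auto elim: eventually_elim2)
    then show False using ntf_nontrivial[of 1 x] by simp
  qed
  define k where "k = (\<lambda>z. - 1 / h z)"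
  have kN: "k \<in> nevanlinna" unfolding k_def by (rule nevanlinna_neg_inverse[OF h hne])
  have k0: "(k \<longlongrightarrow> 0) (ntf x a)" if a: "a > 0" for a
  proof -
    have "((\<lambda>z. - ((v z * b0 z - a0 z) / (a1 z - v z * b1 z))) \<longlongrightarrow>
        - ((0 * of_real (e * D\<^sup>2) - of_real 0) / of_real (- 1 / e))) (ntf x a)"
      by (intro tendsto_intros clim a v0 real_at_tendsto ra0 rb0) (use e in simp)
    then show ?thesis
    proof (rule Lim_transform_eventually[THEN tendsto_eq_rhs])
      show "\<forall>\<^sub>F z in ntf x a. - ((v z * b0 z - a0 z) / (a1 z - v z * b1 z)) = k z"
        using cross[OF a] cnz[OF a] hnz[OF a]
      proof eventually_elim
        case (elim z)
        then have "(v z * b0 z - a0 z) / (a1 z - v z * b1 z) = 1 / h z"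
          by (simp add: field_simps)
        then show ?case by (simp add: k_def)
      qed
    qed simp
  qed
  show ?thesis
  proof (rule nt_kernel_infiniteI)
    fix a :: real assume a: "a > 0"
    have "filterlim (\<lambda>z. Im (k z) / Im z) at_top (ntf x a)"
    proof (rule nevanlinna_kernel_at_top[OF kN _ _ k0[OF a]])
      show "((\<lambda>z. (z - of_real x) / k z) \<longlongrightarrow> 0) (ntf x 1)"
        using tendsto_minus[OF th[of 1]] by (simp add: k_def)
    qed (use hne in \<open>auto simp: k_def\<close>)
    then have "filterlim (\<lambda>z. Im ((a0 z - a1 z * k z) / (b0 z - b1 z * k z)) / Im z) at_top (ntf x a)"
      by (intro lft_kernel_at_top[OF ra0 ra1 rb0 rb1] k0 a) (use e D in auto)
    \<comment> \<open>The linear part \<open>w0 + t * \<gamma>\<close> of \<open>w\<close>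
      contributes exactly \<open>\<gamma>\<close> to the kernel.\<close>
    then have "filterlim (\<lambda>z. \<gamma> + Im ((a0 z - a1 z * k z) / (b0 z - b1 z * k z)) / Im z) at_top (ntf x a)"
      by (intro filterlim_tendsto_add_at_top[OF tendsto_const])
    then show "filterlim (\<lambda>z. Im (the (w z)) / Im z) at_top (ntf x a)"
    proof (rule filterlim_mono_eventually[OF _ order_refl order_refl])
      show "\<forall>\<^sub>F z in ntf x a. \<gamma> + Im ((a0 z - a1 z * k z) / (b0 z - b1 z * k z)) / Im z = Im (the (w z)) / Im z"
        using wv[OF a] eventually_ntf_upper
      proof eventually_elim
        case (elim z)
        have hz: "h z \<noteq> 0" by (rule hne[OF elim(2)])
        have "a0 z - a1 z * k z = (a1 z + a0 z * h z) / h z" "b0 z - b1 z * k z = (b1 z + b0 z * h z) / h z"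
          using hz by (simp_all add: k_def field_simps)
        then have "(a0 z - a1 z * k z) / (b0 z - b1 z * k z) = v z"
          using hz by (simp add: v_def)
        then show ?case using elim by (simp add: add_divide_distrib)
      qed
    qed
  qed
qed

text \<open>Both sides of every equivalence are evaluated on one case distinction for
  \<open>\<phi>\<close>; nothing is inferred from \<open>w\<close> back to
  \<open>\<phi>\<close>.\<close>

lemma node_classification:
  assumes reg: "\<phi> \<in> ext_nevanlinna"
  shows "((bd_deriv w x \<gamma> \<and> bd_value w x w0) \<longleftrightarrow>
            (\<not> (\<exists>L. nt_limit \<phi> x L) \<or> (\<exists>L. nt_limit \<phi> x L \<and> L \<noteq> Some (of_real \<eta>))) \<or>
            (bd_value \<phi> x \<eta> \<and> bd_kernel_infinite \<phi> x)) \<and>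
         (((\<exists>d. bd_deriv w x d \<and> d < \<gamma>) \<and> bd_value w x w0) \<longleftrightarrow>
            bd_value \<phi> x \<eta> \<and> (\<exists>d. bd_deriv \<phi> x d \<and> - p / e\<^sup>2 < d)) \<and>
         (((\<exists>d. bd_deriv w x d \<and> \<gamma> < d) \<and> bd_value w x w0) \<longleftrightarrow>
            bd_value \<phi> x \<eta> \<and> (\<exists>d. bd_deriv \<phi> x d \<and> 0 \<le> d \<and> d < - p / e\<^sup>2)) \<and>
         (bd_value \<phi> x \<eta> \<and> (\<exists>d. bd_deriv \<phi> x d \<and> d = - p / e\<^sup>2 \<and> d > 0) \<longrightarrow>
            \<not> (\<exists>L. nt_limit w x L) \<or>
            (\<exists>L. nt_limit w x L \<and> L \<noteq> Some (of_real w0)) \<or>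
            (bd_value w x w0 \<and> bd_kernel_infinite w x)) \<and>
         (bd_value \<phi> x \<eta> \<and> bd_deriv \<phi> x 0 \<and> p = 0 \<longrightarrow>
            (\<exists>L. nt_limit w x L \<and> L \<noteq> Some (of_real w0)))"
    (is "(?W1 \<longleftrightarrow> ?C1 \<or> ?C2) \<and> (?W2 \<longleftrightarrow> ?C3) \<and> (?W3 \<longleftrightarrow> ?C4) \<and> (?C5 \<longrightarrow> ?W5) \<and> (?C6 \<longrightarrow> ?W6)")
proof -
  have derivu: "d = d'" if "bd_deriv f x d" "bd_deriv f x d'" for f d d'
    using that nt_limit_unique unfolding bd_deriv_def by fastforce
  \<comment> \<open>Here the first equivalence has true sides, the next two have false sides, and
    the last two claims are vacuous.\<close>
  have infinite: ?thesis
    if w: "bd_value w x w0" "bd_deriv w x \<gamma>"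
      and \<phi>: "\<And>d. bd_value \<phi> x \<eta> \<Longrightarrow> \<not> bd_deriv \<phi> x d" "bd_value \<phi> x \<eta> \<Longrightarrow> bd_kernel_infinite \<phi> x"
  proof -
    have "?C1 \<or> ?C2" using \<phi>(2) unfolding bd_value_def by blast
    then show ?thesis using w \<phi>(1) derivu by blast
  qed
  have finite: ?thesis
    if fin: "bd_value \<phi> x \<eta>" "bd_deriv \<phi> x D" "\<not> bd_kernel_infinite \<phi> x" "D \<ge> 0"
      and reg: "e\<^sup>2 * D + p \<noteq> 0 \<Longrightarrow> bd_value w x w0 \<and> bd_deriv w x (\<gamma> - 1 / (e\<^sup>2 * D + p))"
      and deg: "e\<^sup>2 * D + p = 0 \<Longrightarrow> bd_value w x w0 \<Longrightarrow> (\<forall>d. \<not> bd_deriv w x d)"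
      and ker: "e\<^sup>2 * D + p = 0 \<Longrightarrow> D > 0 \<Longrightarrow> bd_value w x w0 \<Longrightarrow> bd_kernel_infinite w x"
      and cst: "p = 0 \<Longrightarrow> D = 0 \<Longrightarrow> ?W6" for D
  proof -
    have e2: "e\<^sup>2 > 0" using e by simp
    have C12: "\<not> (?C1 \<or> ?C2)"
      using fin nt_limit_unique unfolding bd_value_def by blast
    have C3: "?C3 \<longleftrightarrow> e\<^sup>2 * D + p > 0"
    proof -
      have "?C3 \<longleftrightarrow> - p / e\<^sup>2 < D" using fin derivu by blast
      then show ?thesis unfolding pos_divide_less_eq[OF e2] by (smt (verit) mult.commute)
    qed
    have C4: "?C4 \<longleftrightarrow> e\<^sup>2 * D + p < 0"
    proof -
      have "?C4 \<longleftrightarrow> D < - p / e\<^sup>2" using fin derivu by blast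
      then show ?thesis unfolding pos_less_divide_eq[OF e2] by (smt (verit) mult.commute)
    qed
    have C5: "?C5 \<longleftrightarrow> e\<^sup>2 * D + p = 0 \<and> D > 0"
    proof -
      have "?C5 \<longleftrightarrow> D = - p / e\<^sup>2 \<and> D > 0" using fin derivu by blast
      moreover have "D = - p / e\<^sup>2 \<longleftrightarrow> D * e\<^sup>2 = - p"
        using e2 by (subst nonzero_eq_divide_eq) auto
      ultimately show ?thesis by (smt (verit) mult.commute)
    qed
    have C6: "?C6 \<longleftrightarrow> p = 0 \<and> D = 0" using fin derivu by blast
    have W123: "\<not> ?W1" "?W2 \<longleftrightarrow> e\<^sup>2 * D + p > 0" "?W3 \<longleftrightarrow> e\<^sup>2 * D + p < 0"
    proof -
      \<comment> \<open>The sign of \<open>c\<close> says on which side of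
        \<open>- p / e\<^sup>2\<close> the derivative \<open>D\<close> lies, and also on which side
        of \<open>\<gamma>\<close> the value \<open>\<gamma> - 1 / c\<close> lies; it never equals
        \<open>\<gamma>\<close>.\<close>
      define c where "c = e\<^sup>2 * D + p"
      have "\<not> ?W1 \<and> (?W2 \<longleftrightarrow> c > 0) \<and> (?W3 \<longleftrightarrow> c < 0)"
      proof (cases "c = 0")
        case True
        then show ?thesis using deg unfolding c_def by auto
      next
        case False
        then have w: "bd_value w x w0" "bd_deriv w x (\<gamma> - 1 / c)" using reg unfolding c_def by auto
        have "?W1 \<longleftrightarrow> \<gamma> - 1 / c = \<gamma>" using w derivu by metis
        moreover have "?W2 \<longleftrightarrow> \<gamma> - 1 / c < \<gamma>" using w derivu by blast
        moreover have "?W3 \<longleftrightarrow> \<gamma> < \<gamma> - 1 / c" using w derivu by blast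
        ultimately show ?thesis using False by simp
      qed
      then show "\<not> ?W1" "?W2 \<longleftrightarrow> e\<^sup>2 * D + p > 0" "?W3 \<longleftrightarrow> e\<^sup>2 * D + p < 0"
        unfolding c_def by blast+
    qed
    have W5: ?W5 if ?C5
      using ker that C5 unfolding bd_value_def by blast
    show ?thesis using C12 C3 C4 W123 W5 C6 cst by blast
  qed
  from reg show ?thesis
  proof (cases rule: ext_nevanlinna_cases)
    case inf
    show ?thesis
    proof (rule infinite)
      have "\<not> bd_value \<phi> x \<eta>"
      proof
        assume "bd_value \<phi> x \<eta>"
        then have "\<forall>\<^sub>F z in ntf x 1. \<phi> z \<noteq> None" by (simp add: bd_value_def nt_limit_Some)
        then have "\<forall>\<^sub>F z in ntf x 1. False"
          using eventually_ntf_upper by eventually_elim (use inf in auto)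
        then show False using ntf_nontrivial[of 1 x] by simp
      qed
      then show "bd_value \<phi> x \<eta> \<Longrightarrow> \<not> bd_deriv \<phi> x d" "bd_value \<phi> x \<eta> \<Longrightarrow> bd_kernel_infinite \<phi> x" for d
        by auto
    qed (use w_parameter_infinity[OF reg inf] in auto)
  next
    case (fin g)
    from fin(1) show ?thesis
    proof (cases rule: nevanlinna_boundary_cases[of g \<eta> x])
      case inf
      show ?thesis
        by (rule infinite) (use w_infinite_derivative[OF reg fin(2) inf]
          parameter_infinite_derivative[OF fin inf] in auto)
    next
      \<comment> \<open>The only source of \<open>D = 0\<close>; the degenerate subcase is then
        \<open>p = 0\<close>, settled by the explicit form of \<open>w\<close>.\<close>
      case const
      have q: "((\<lambda>z. (g z - of_real \<eta>) / (z - of_real x)) \<longlongrightarrow> of_real 0) (ntf x a)" if "a > 0" for a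
        by (rule Lim_transform_eventually[OF tendsto_const])
           (use eventually_ntf_upper[of x a] in eventually_elim, use const in auto)
      have "\<phi> z = Some (of_real \<eta>)" if "Im z > 0" for z using fin(2) const that by simp
      then show ?thesis
        by (intro finite[of 0])
           (use parameter_finite_derivative[OF fin q] w_finite_derivative[OF reg fin(2) q]
             w_degenerate_no_derivative[OF reg fin(2) q] w_constant_degenerate in auto)
    next
      case (fin D h)
      note g = \<open>g \<in> nevanlinna\<close> \<open>\<And>z. Im z > 0 \<Longrightarrow> \<phi> z = Some (g z)\<close>
      have q: "((\<lambda>z. (g z - of_real \<eta>) / (z - of_real x)) \<longlongrightarrow> of_real D) (ntf x a)" if a: "a > 0" for a
      proof -
        have "((\<lambda>z. of_real D / (1 - of_real D * ((z - of_real x) * h z))) \<longlongrightarrow> of_real D / (1 - of_real D * 0)) (ntf x a)"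
          by (intro tendsto_intros fin(4) a) simp
        then show ?thesis
        proof (rule Lim_transform_eventually[THEN tendsto_eq_rhs])
          show "\<forall>\<^sub>F z in ntf x a. of_real D / (1 - of_real D * ((z - of_real x) * h z)) = (g z - of_real \<eta>) / (z - of_real x)"
            using eventually_ntf_upper
          proof eventually_elim
            case (elim z)
            have "z - of_real x \<noteq> 0" using elim by auto
            moreover have "1 - of_real D * (z - of_real x) * h z \<noteq> 0"
              using fin(3)[OF elim] calculation fin(1) by auto
            ultimately show ?case using fin(3)[OF elim] by (simp add: frac_eq_eq mult.assoc)
          qed
        qed simp
      qed
      show ?thesis
        by (rule finite[of D])
           (use fin(1) parameter_finite_derivative[OF g q] w_finite_derivative[OF reg g(2) q]
             w_degenerate_no_derivative[OF reg g(2) q] w_degenerate_kernel[OF g(2) fin(2-4) fin(1)] in auto)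
    qed
  qed
qed

end

section \<open>Finite sums of real poles\<close>

definition pole_sum :: "nat set \<Rightarrow> (nat \<Rightarrow> real) \<Rightarrow> (nat \<Rightarrow> real) \<Rightarrow> complex \<Rightarrow> complex" where
  "pole_sum K y b z = (\<Sum>k\<in>K. of_real (b k) / (z - of_real (y k)))"

lemma real_at_pole_sum:
  assumes "finite K" "\<And>k. k \<in> K \<Longrightarrow> y k \<noteq> x"
  shows "real_at x (pole_sum K y b) (\<Sum>k\<in>K. b k / (x - y k))"
  unfolding pole_sum_def by (intro real_at_sum real_at_pole assms)

lemma pole_sum_holomorphic: "pole_sum K y b holomorphic_on upper_half_plane"
  unfolding pole_sum_def by (intro holomorphic_intros) (auto simp: upper_half_plane_def)

text \<open>From \<open>1 / s = 1 / d - (s - d) / (d * s)\<close>. The quotient by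
  \<open>z - x\<close> is again a sum over the same poles, so a Taylor step at \<open>x\<close> is
  exact and its remainder stays \<open>real_at\<close> and holomorphic.\<close>

lemma pole_sum_expand:
  assumes "\<And>k. k \<in> K \<Longrightarrow> y k \<noteq> x" "Im z > 0"
  shows "pole_sum K y b z =
    of_real (\<Sum>k\<in>K. b k / (x - y k)) + (z - of_real x) * pole_sum K y (\<lambda>k. - (b k / (x - y k))) z"
proof -
  have "of_real (b k) / (z - of_real (y k)) =
      of_real (b k / (x - y k)) + (z - of_real x) * (of_real (- (b k / (x - y k))) / (z - of_real (y k)))"
    if k: "k \<in> K" for k
  proof -
    define d where "d = complex_of_real x - of_real (y k)"
    define s where "s = z - of_real (y k)"
    have d: "d \<noteq> 0" "s \<noteq> 0"
      using assms(1)[OF k] assms(2) by (auto simp: d_def s_def)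
    have "of_real (b k) / s = of_real (b k) / d + (s - d) * (- (of_real (b k) / d) / s)"
      using d by (simp add: field_simps)
    then show ?thesis
      by (simp add: d_def s_def)
  qed
  then show ?thesis
    unfolding pole_sum_def of_real_sum sum_distrib_left sum.distrib[symmetric] by (intro sum.cong) auto
qed

lemma pole_sum_linear:
  "pole_sum K y (\<lambda>k. c * b k + d * b' k) z = of_real c * pole_sum K y b z + of_real d * pole_sum K y b' z"
  unfolding pole_sum_def sum_distrib_left sum.distrib[symmetric]
  by (intro sum.cong) (auto simp: add_divide_distrib)

section \<open>The Pick matrix\<close>

text \<open>\<open>mat_inv\<close> is \<open>the\<close> of an optional result; membership in the
  units of the matrix ring excludes \<open>None\<close>.\<close>

lemma mat_inv_mult:
  assumes "invertible_mat A" "A \<in> carrier_mat n n"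
  shows "mat_inv A \<in> carrier_mat n n" "A * mat_inv A = 1\<^sub>m n" "mat_inv A * A = 1\<^sub>m n"
proof -
  obtain B where B: "A * B = 1\<^sub>m (dim_row A)" "B * A = 1\<^sub>m (dim_row B)"
    using assms(1) unfolding invertible_mat_def inverts_mat_def by auto
  have "dim_col B = n" using arg_cong[OF B(1), of dim_col] assms(2) by simp
  moreover have "dim_row B = n" using arg_cong[OF B(2), of dim_col] assms(2) by simp
  ultimately have Bc: "B \<in> carrier_mat n n" by auto
  have "A \<in> Units (ring_mat TYPE('a) n ())"
    using assms(2) B Bc by (auto simp: Units_def ring_mat_simps intro!: bexI[of _ B])
  then have "mat_inverse A \<noteq> None"
    using mat_inverse(1)[OF assms(2), where b = "()"] by blast
  then obtain C where "mat_inverse A = Some C" by blast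
  then show "mat_inv A \<in> carrier_mat n n" "A * mat_inv A = 1\<^sub>m n" "mat_inv A * A = 1\<^sub>m n"
    using mat_inverse(2)[OF assms(2)] by (auto simp: mat_inv_def)
qed

lemma mat_inv_eqI:
  fixes A :: "'a :: field mat"
  assumes "A \<in> carrier_mat n n" "B \<in> carrier_mat n n" "A * B = 1\<^sub>m n" "B * A = 1\<^sub>m n"
  shows "mat_inv A = B"
proof -
  have "invertible_mat A"
    using assms unfolding invertible_mat_def inverts_mat_def by (auto intro!: exI[of _ B])
  note inv = mat_inv_mult[OF this assms(1)]
  have "mat_inv A = mat_inv A * (A * B)" using inv(1) assms(3) by simp
  also have "\<dots> = mat_inv A * A * B" using inv(1) assms by (intro assoc_mult_mat[symmetric]) auto
  also have "\<dots> = B" using inv(3) assms(2) by simp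
  finally show ?thesis .
qed

lemma mat_mult_index:
  assumes "A \<in> carrier_mat m n" "B \<in> carrier_mat n l" "i < m" "j < l"
  shows "(A * B) $$ (i, j) = (\<Sum>k<n. A $$ (i, k) * B $$ (k, j))"
  using assms by (auto simp: scalar_prod_def lessThan_atLeast0 intro!: sum.cong)

locale pick_data =
  fixes D :: interp_data
  assumes valid: "valid_data D" and invertible: "invertible_mat (pick_matrix D)"
begin

definition n where "n = nnodes D"
definition Cv where "Cv k = (if k < nreg D then wval D k else xi D k)"
definition Ev :: "nat \<Rightarrow> real" where "Ev k = (if k < nreg D then 1 else 0)"
definition Q where "Q = mat_inv (pick_matrix D)"

lemma P_carrier: "pick_matrix D \<in> carrier_mat n n"
  by (simp add: pick_matrix_def n_def)

lemmas Q_carrier = mat_inv_mult(1)[OF invertible P_carrier, folded Q_def]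
  and P_Q = mat_inv_mult(2)[OF invertible P_carrier, folded Q_def]
  and Q_P = mat_inv_mult(3)[OF invertible P_carrier, folded Q_def]

lemma nodes_distinct: "j < n \<Longrightarrow> k < n \<Longrightarrow> node D j = node D k \<longleftrightarrow> j = k"
  using valid by (auto simp: valid_data_def n_def inj_on_eq_iff)

lemma nreg_le: "nreg D \<le> n"
  using valid by (simp add: valid_data_def n_def)

lemma pick_entry_sym: "pick_entry D j k = pick_entry D k j"
proof -
  have "(wval D k - wval D j) / (node D k - node D j) = (wval D j - wval D k) / (node D j - node D k)"
    by (metis minus_diff_eq minus_divide_divide)
  then show ?thesis by (auto simp: pick_entry_def)
qed

lemma Q_sym: "j < n \<Longrightarrow> k < n \<Longrightarrow> Q $$ (j, k) = Q $$ (k, j)"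
proof -
  assume jk: "j < n" "k < n"
  have PT: "transpose_mat (pick_matrix D) = pick_matrix D"
    by (rule eq_matI) (auto simp: pick_matrix_def pick_entry_sym)
  have "Q = transpose_mat Q"
    unfolding Q_def
  proof (rule mat_inv_eqI[OF P_carrier])
    show "transpose_mat (mat_inv (pick_matrix D)) \<in> carrier_mat n n"
      using Q_carrier by (simp add: Q_def)
    have "pick_matrix D * transpose_mat Q = transpose_mat (Q * pick_matrix D)"
      using transpose_mult[OF Q_carrier P_carrier] by (simp add: PT)
    then show "pick_matrix D * transpose_mat (mat_inv (pick_matrix D)) = 1\<^sub>m n"
      by (simp add: Q_P transpose_one Q_def[symmetric])
    have "transpose_mat Q * pick_matrix D = transpose_mat (pick_matrix D * Q)"
      using transpose_mult[OF P_carrier Q_carrier] by (simp add: PT)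
    then show "transpose_mat (mat_inv (pick_matrix D)) * pick_matrix D = 1\<^sub>m n"
      by (simp add: P_Q transpose_one Q_def[symmetric])
  qed
  then show ?thesis using jk Q_carrier
    by (metis carrier_matD(1) carrier_matD(2) index_transpose_mat(1))
qed

lemma PQ_sum: "j < n \<Longrightarrow> k < n \<Longrightarrow> (\<Sum>l<n. pick_entry D j l * Q $$ (l, k)) = (if j = k then 1 else 0)"
  using mat_mult_index[OF P_carrier Q_carrier, of j k] unfolding P_Q
  by (simp add: pick_matrix_def n_def)

lemma QP_sum: "j < n \<Longrightarrow> k < n \<Longrightarrow> (\<Sum>l<n. Q $$ (j, l) * pick_entry D l k) = (if j = k then 1 else 0)"
  using mat_mult_index[OF Q_carrier P_carrier, of j k] unfolding Q_P
  by (simp add: pick_matrix_def n_def)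

lemma C_row_carrier: "C_row D \<in> carrier_mat 1 n" and E_row_carrier: "E_row D \<in> carrier_mat 1 n"
  by (simp_all add: C_row_def E_row_def n_def)

lemma c_tilde_sum: "k < n \<Longrightarrow> c_tilde D k = (\<Sum>j<n. Cv j * Q $$ (j, k))"
  unfolding c_tilde_def Q_def[symmetric]
  using mat_mult_index[OF C_row_carrier Q_carrier, of 0 k] by (simp add: C_row_def Cv_def n_def)

lemma e_tilde_sum: "k < n \<Longrightarrow> e_tilde D k = (\<Sum>j<n. Ev j * Q $$ (j, k))"
  unfolding e_tilde_def Q_def[symmetric]
  using mat_mult_index[OF E_row_carrier Q_carrier, of 0 k] by (simp add: E_row_def Ev_def n_def)

lemma P_vec:
  assumes "j < n"
  shows "(\<Sum>k<n. pick_entry D j k * (\<Sum>l<n. v l * Q $$ (l, k))) = v j"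
proof -
  have "(\<Sum>k<n. pick_entry D j k * (\<Sum>l<n. v l * Q $$ (l, k))) =
      (\<Sum>k<n. \<Sum>l<n. v l * (pick_entry D j k * Q $$ (k, l)))"
    unfolding sum_distrib_left by (intro sum.cong) (auto simp: Q_sym)
  also have "\<dots> = (\<Sum>l<n. v l * (\<Sum>k<n. pick_entry D j k * Q $$ (k, l)))"
    unfolding sum_distrib_left by (rule sum.swap)
  also have "\<dots> = (\<Sum>l<n. if j = l then v l else 0)"
    using assms by (intro sum.cong) (auto simp: PQ_sum)
  also have "\<dots> = v j" using assms by simp
  finally show ?thesis .
qed

lemma P_e_tilde: "j < n \<Longrightarrow> (\<Sum>k<n. pick_entry D j k * e_tilde D k) = Ev j"
  using P_vec[of j Ev] by (simp add: e_tilde_sum)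

lemma P_c_tilde: "j < n \<Longrightarrow> (\<Sum>k<n. pick_entry D j k * c_tilde D k) = Cv j"
  using P_vec[of j Cv] by (simp add: c_tilde_sum)

text \<open>In matrix form \<open>P X - X P = E^T C - C^T E\<close>. Off the diagonal the Pick
  entries solve this equation; on it both sides vanish, which leaves \<open>gam\<close>
  free.\<close>

lemma pick_Lyapunov:
  assumes "j < n" "k < n"
  shows "pick_entry D j k * (node D k - node D j) = Ev j * Cv k - Cv j * Ev k"
  using nodes_distinct[OF assms]
  by (auto simp: pick_entry_def Ev_def Cv_def) (auto simp: field_simps)

text \<open>Multiply the Lyapunov identity by the inverse on both sides:
  \<open>Q (P X - X P) Q = X Q - Q X\<close>. The double sum is an entry of the left side, evaluated
  with either form of the middle factor.\<close>

lemma inverse_Lyapunov: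
  assumes j: "j < n" and k: "k < n"
  shows "Q $$ (k, j) * (node D k - node D j) = e_tilde D k * c_tilde D j - c_tilde D k * e_tilde D j"
proof -
  let ?x = "node D" and ?q = "\<lambda>a b. Q $$ (a, b)" and ?P = "pick_entry D"
  have "(\<Sum>a<n. \<Sum>b<n. ?q k a * (?P a b * (?x b - ?x a)) * ?q b j) =
      (\<Sum>a<n. \<Sum>b<n. (?q k a * ?P a b) * (?x b * ?q b j)) - (\<Sum>a<n. \<Sum>b<n. (?q k a * ?x a) * (?P a b * ?q b j))"
    unfolding sum_subtractf[symmetric] by (intro sum.cong refl) (simp add: algebra_simps)
  also have "(\<Sum>a<n. \<Sum>b<n. (?q k a * ?P a b) * (?x b * ?q b j)) = (\<Sum>b<n. (\<Sum>a<n. ?q k a * ?P a b) * (?x b * ?q b j))"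
    unfolding sum_distrib_right by (rule sum.swap)
  also have "\<dots> = (\<Sum>b<n. if k = b then ?x b * ?q b j else 0)"
    using k by (intro sum.cong) (auto simp: QP_sum)
  also have "\<dots> = ?x k * ?q k j" using k by simp
  also have "(\<Sum>a<n. \<Sum>b<n. (?q k a * ?x a) * (?P a b * ?q b j)) = (\<Sum>a<n. (?q k a * ?x a) * (\<Sum>b<n. ?P a b * ?q b j))"
    unfolding sum_distrib_left ..
  also have "\<dots> = (\<Sum>a<n. if a = j then ?q k a * ?x a else 0)"
    using j by (intro sum.cong) (auto simp: PQ_sum)
  also have "\<dots> = ?q k j * ?x j" using j by simp
  finally have L: "(\<Sum>a<n. \<Sum>b<n. ?q k a * (?P a b * (?x b - ?x a)) * ?q b j) = ?q k j * (?x k - ?x j)"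
    by (simp add: algebra_simps)
  have "(\<Sum>a<n. \<Sum>b<n. ?q k a * (?P a b * (?x b - ?x a)) * ?q b j) =
      (\<Sum>a<n. \<Sum>b<n. (Ev a * ?q a k) * (Cv b * ?q b j) - (Cv a * ?q a k) * (Ev b * ?q b j))"
  proof (intro sum.cong refl)
    fix a b assume "a \<in> {..<n}" "b \<in> {..<n}"
    then have "?P a b * (?x b - ?x a) = Ev a * Cv b - Cv a * Ev b" "?q k a = ?q a k"
      using k by (auto simp: pick_Lyapunov Q_sym)
    then show "?q k a * (?P a b * (?x b - ?x a)) * ?q b j =
        (Ev a * ?q a k) * (Cv b * ?q b j) - (Cv a * ?q a k) * (Ev b * ?q b j)"
      by (simp add: left_diff_distrib right_diff_distrib mult_ac)
  qed
  also have "\<dots> = e_tilde D k * c_tilde D j - c_tilde D k * e_tilde D j"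
    unfolding sum_subtractf e_tilde_sum[OF k] e_tilde_sum[OF j] c_tilde_sum[OF k] c_tilde_sum[OF j] sum_product ..
  finally show ?thesis using L by simp
qed

section \<open>The entries of Theta as sums of real poles\<close>

definition CE :: "complex mat" where
  "CE = cmat (C_row D) @\<^sub>r cmat (E_row D)"

lemma CE_carrier: "CE \<in> carrier_mat 2 n"
  using carrier_append_rows[of "cmat (C_row D)" 1 n "cmat (E_row D)" 1] C_row_carrier E_row_carrier
  by (simp add: CE_def numeral_2_eq_2)

lemma CE_index: "k < n \<Longrightarrow> CE $$ (0, k) = of_real (Cv k)" "k < n \<Longrightarrow> CE $$ (1, k) = of_real (Ev k)"
  using C_row_carrier E_row_carrier
  by (auto simp: CE_def append_rows_def C_row_def E_row_def Cv_def Ev_def n_def)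

lemma resolvent:
  assumes "Im z > 0"
  shows "mat_inv (z \<cdot>\<^sub>m 1\<^sub>m (nnodes D) - cmat (X_mat D)) = mat_diag n (\<lambda>k. 1 / (z - of_real (node D k)))"
proof (rule mat_inv_eqI[of _ n])
  have ne: "z - of_real (node D k) \<noteq> 0" for k using assms by auto
  have eq: "z \<cdot>\<^sub>m 1\<^sub>m (nnodes D) - cmat (X_mat D) = mat_diag n (\<lambda>k. z - of_real (node D k))"
    by (rule eq_matI) (auto simp: X_mat_def mat_diag_def n_def)
  have one: "mat_diag n (\<lambda>k. 1) = (1\<^sub>m n :: complex mat)"
    by (rule eq_matI) (auto simp: mat_diag_def)
  show "z \<cdot>\<^sub>m 1\<^sub>m (nnodes D) - cmat (X_mat D) \<in> carrier_mat n n"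
    unfolding eq by simp
  show "mat_diag n (\<lambda>k. 1 / (z - of_real (node D k))) \<in> carrier_mat n n" by simp
  show "(z \<cdot>\<^sub>m 1\<^sub>m (nnodes D) - cmat (X_mat D)) * mat_diag n (\<lambda>k. 1 / (z - of_real (node D k))) = 1\<^sub>m n"
    "mat_diag n (\<lambda>k. 1 / (z - of_real (node D k))) * (z \<cdot>\<^sub>m 1\<^sub>m (nnodes D) - cmat (X_mat D)) = 1\<^sub>m n"
    unfolding eq mat_diag_diag using ne by (simp_all add: one)
qed

text \<open>\<open>J_mat\<close> swaps the columns with factors \<open>\<i>\<close> and
  \<open>- \<i>\<close>; together with the leading \<open>- \<i>\<close> they become the signs 1 and
  -1. The data are real and \<open>Q\<close> is symmetric, so the other weights are
  \<open>e_tilde\<close> and \<open>c_tilde\<close>.\<close>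

lemma Theta_index:
  assumes z: "Im z > 0"
  shows "Theta D z $$ (0, 0) = 1 + pole_sum {..<n} (node D) (\<lambda>k. Cv k * e_tilde D k) z"
    "Theta D z $$ (0, 1) = - pole_sum {..<n} (node D) (\<lambda>k. Cv k * c_tilde D k) z"
    "Theta D z $$ (1, 0) = pole_sum {..<n} (node D) (\<lambda>k. Ev k * e_tilde D k) z"
    "Theta D z $$ (1, 1) = 1 - pole_sum {..<n} (node D) (\<lambda>k. Ev k * c_tilde D k) z"
proof -
  define Z where "Z = mat_diag n (\<lambda>k. 1 / (z - of_real (node D k)))"
  have Zc: "Z \<in> carrier_mat n n" by (simp add: Z_def)
  have Qc: "cmat Q \<in> carrier_mat n n" using Q_carrier by simp
  have Ac: "mat_adjoint CE \<in> carrier_mat n 2"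
    using CE_carrier by (auto simp: mat_adjoint_def mat_of_rows_def)
  have Aind: "mat_adjoint CE $$ (k, s) = cnj (CE $$ (s, k))" if "k < n" "s < 2" for k s
    using CE_carrier that by (auto simp: mat_adjoint_def mat_of_rows_index)
  have Jc: "J_mat \<in> carrier_mat 2 2" by (simp add: J_mat_def mat_of_rows_list_def numeral_2_eq_2)
  have Jind: "J_mat $$ (0, 0) = 0" "J_mat $$ (0, 1) = - \<i>" "J_mat $$ (1, 0) = \<i>" "J_mat $$ (1, 1) = 0"
    by (auto simp: J_mat_def mat_of_rows_list_def)
  define W where "W = cmat Q * mat_adjoint CE"
  have Wc: "W \<in> carrier_mat n 2" using Qc Ac by (simp add: W_def)
  have W0: "W $$ (k, 0) = of_real (c_tilde D k)" and W1: "W $$ (k, 1) = of_real (e_tilde D k)" if k: "k < n" for k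
    unfolding W_def using k Q_carrier
    by (auto simp: mat_mult_index[OF Qc Ac] Aind CE_index CE_index(2)[unfolded One_nat_def] c_tilde_sum e_tilde_sum Q_sym[OF _ k] mult.commute intro!: sum.cong)
  define V where "V = CE * Z * W"
  have CZc: "CE * Z \<in> carrier_mat 2 n" using CE_carrier Zc by simp
  have Vc: "V \<in> carrier_mat 2 2" using CZc Wc by (simp add: V_def)
  have CZ: "(CE * Z) $$ (r, k) = CE $$ (r, k) / (z - of_real (node D k))" if "r < 2" "k < n" for r k
    using that CE_carrier unfolding Z_def by (subst mat_diag_mult_right[OF CE_carrier]) auto
  have V: "V $$ (r, s) = (\<Sum>k<n. CE $$ (r, k) / (z - of_real (node D k)) * W $$ (k, s))" if "r < 2" "s < 2" for r s
    unfolding V_def using that by (simp add: mat_mult_index[OF CZc Wc] CZ)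
  have VJ: "(V * J_mat) $$ (r, 0) = \<i> * V $$ (r, 1)" "(V * J_mat) $$ (r, 1) = - \<i> * V $$ (r, 0)" if "r < 2" for r
    using that by (simp_all add: mat_mult_index[OF Vc Jc] numeral_2_eq_2 Jind Jind[unfolded One_nat_def])
  have "CE * Z * cmat Q * mat_adjoint CE = V"
    unfolding V_def W_def by (rule assoc_mult_mat[OF CZc Qc Ac])
  then have T: "Theta D z = 1\<^sub>m 2 - \<i> \<cdot>\<^sub>m (V * J_mat)"
    unfolding Theta_def resolvent[OF z] Let_def CE_def[symmetric] Q_def[symmetric] Z_def by simp
  have T': "Theta D z $$ (r, s) = (if r = s then 1 else 0) - \<i> * (V * J_mat) $$ (r, s)" if "r < 2" "s < 2" for r s
    unfolding T using that carrier_matD[OF Vc] carrier_matD[OF Jc] by simp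
  have lt: "(0::nat) < 2" "(1::nat) < 2" by simp_all
  note simps = T'[OF lt(1) lt(1)] T'[OF lt(1) lt(2)] T'[OF lt(2) lt(1)] T'[OF lt(2) lt(2)]
    VJ[OF lt(1)] VJ[OF lt(2)] V[OF lt(1) lt(1)] V[OF lt(1) lt(2)] V[OF lt(2) lt(1)] V[OF lt(2) lt(2)]
  show "Theta D z $$ (0, 0) = 1 + pole_sum {..<n} (node D) (\<lambda>k. Cv k * e_tilde D k) z"
    "Theta D z $$ (0, 1) = - pole_sum {..<n} (node D) (\<lambda>k. Cv k * c_tilde D k) z"
    "Theta D z $$ (1, 0) = pole_sum {..<n} (node D) (\<lambda>k. Ev k * e_tilde D k) z"
    "Theta D z $$ (1, 1) = 1 - pole_sum {..<n} (node D) (\<lambda>k. Ev k * c_tilde D k) z"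
    unfolding simps pole_sum_def
    by (simp_all add: sum_negf[symmetric] CE_index CE_index(2)[unfolded One_nat_def] W0 W1 W1[unfolded One_nat_def] mult.assoc[symmetric] del: One_nat_def)
qed

end

section \<open>The local model of the transform at a regular node\<close>

locale regular_node = pick_data +
  fixes i :: nat
  assumes i: "i < nreg D" and e_nz: "e_tilde D i \<noteq> 0"
begin

abbreviation "x \<equiv> node D i"
abbreviation "e \<equiv> e_tilde D i"
abbreviation "p \<equiv> p_tilde D i"
abbreviation "\<eta> \<equiv> eta D i"
abbreviation "\<gamma> \<equiv> gam D i"
abbreviation "w0 \<equiv> wval D i"
abbreviation "others \<equiv> {..<n} - {i}"
abbreviation "ps b \<equiv> pole_sum others (node D) b"

text \<open>Weights of the upper row of Theta minus \<open>w0\<close> times the lower one, as needed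
  for \<open>w - w0\<close>. The weight at \<open>i\<close> is 0, so this combination has no pole at
  \<open>x\<close>.\<close>

definition bv where "bv k = Cv k - w0 * Ev k"

lemma i_less: "i < n"
  using i nreg_le by simp

lemma Cv_i: "Cv i = w0" and Ev_i: "Ev i = 1"
  using i by (simp_all add: Cv_def Ev_def)

lemma eta_e: "e * \<eta> = c_tilde D i"
  using e_nz by (simp add: eta_def)

lemma p_eq: "p = Q $$ (i, i)"
  by (simp add: p_tilde_def Q_def)

lemma others_ne: "k \<in> others \<Longrightarrow> node D k \<noteq> x"
  using nodes_distinct[OF _ i_less] by auto

text \<open>Row \<open>i\<close> of the Lyapunov identity. It trades node differences for Pick
  entries, so that sums over the other nodes become rows of products with \<open>P\<close>.\<close>

lemma bv_pick: "k \<in> others \<Longrightarrow> bv k / (x - node D k) = - pick_entry D i k"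
  using pick_Lyapunov[OF i_less, of k] others_ne[of k]
  by (simp add: bv_def Cv_i Ev_i field_simps)

text \<open>The counterpart for the inverse. The combination
  \<open>e_tilde D k * \<eta> - c_tilde D k\<close> arises from expanding the parameter around
  \<open>\<eta>\<close>.\<close>

lemma inverse_entry: "k \<in> others \<Longrightarrow> (e_tilde D k * \<eta> - c_tilde D k) / (x - node D k) = - Q $$ (k, i) / e"
proof -
  assume k: "k \<in> others"
  have "e * (e_tilde D k * \<eta> - c_tilde D k) = Q $$ (k, i) * (node D k - x)"
    using inverse_Lyapunov[OF i_less, of k] k eta_e by (simp add: algebra_simps)
  then show ?thesis using e_nz others_ne[OF k] by (simp add: field_simps)
qed

lemma sum_others: "(\<Sum>k\<in>others. f k) = (\<Sum>k<n. f k) - (f i :: real)"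
  using i_less by (simp add: sum_diff1)

text \<open>The full row sums to \<open>Ev i = 1\<close> by \<open>P_e_tilde\<close>; taking out the
  diagonal term brings in \<open>\<gamma>\<close>. This is the value at \<open>x\<close> of a
  regular part of Theta.\<close>

lemma sum_bv_e: "(\<Sum>k\<in>others. bv k * e_tilde D k / (x - node D k)) = \<gamma> * e - 1"
proof -
  have "(\<Sum>k\<in>others. bv k * e_tilde D k / (x - node D k)) = (\<Sum>k\<in>others. - (pick_entry D i k * e_tilde D k))"
    by (intro sum.cong refl) (simp flip: times_divide_eq_left add: bv_pick)
  also have "\<dots> = \<gamma> * e - 1"
    unfolding sum_negf sum_others P_e_tilde[OF i_less] using i by (simp add: pick_entry_def Ev_i)
  finally show ?thesis .
qed

lemma sum_bv_c: "(\<Sum>k\<in>others. bv k * c_tilde D k / (x - node D k)) = \<gamma> * (e * \<eta>) - w0"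
proof -
  have "(\<Sum>k\<in>others. bv k * c_tilde D k / (x - node D k)) = (\<Sum>k\<in>others. - (pick_entry D i k * c_tilde D k))"
    by (intro sum.cong refl) (simp flip: times_divide_eq_left add: bv_pick)
  also have "\<dots> = \<gamma> * (e * \<eta>) - w0"
    unfolding sum_negf sum_others P_c_tilde[OF i_less] eta_e using i by (simp add: pick_entry_def Cv_i)
  finally show ?thesis .
qed

lemma sum_Ev: "(\<Sum>k\<in>others. Ev k * (e_tilde D k * \<eta> - c_tilde D k) / (x - node D k)) = p / e - 1"
proof -
  have "(\<Sum>k\<in>others. Ev k * (e_tilde D k * \<eta> - c_tilde D k) / (x - node D k)) = (\<Sum>k\<in>others. - (Ev k * Q $$ (k, i)) / e)"
    by (intro sum.cong refl) (simp flip: times_divide_eq_right add: inverse_entry)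
  also have "\<dots> = p / e - 1"
    unfolding sum_divide_distrib[symmetric] sum_negf sum_others
    using e_nz e_tilde_sum[OF i_less] by (simp add: Ev_i p_eq field_simps)
  finally show ?thesis .
qed

text \<open>Each of the two divisions by \<open>x - node D k\<close> uses up one Lyapunov identity,
  and what is left is a diagonal entry of \<open>P Q = I\<close> without its diagonal term. Then
  \<open>H\<close> has the value \<open>(\<gamma> * p - 1) / e - \<gamma> * p / e = - 1 / e\<close>
  at \<open>x\<close>.\<close>

lemma sum_H:
  "(\<Sum>k\<in>others. - (bv k * (e_tilde D k * \<eta> - c_tilde D k) / (x - node D k)) / (x - node D k)) = (\<gamma> * p - 1) / e"
proof -
  have "(\<Sum>k\<in>others. - (bv k * (e_tilde D k * \<eta> - c_tilde D k) / (x - node D k)) / (x - node D k))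
      = (\<Sum>k\<in>others. - (pick_entry D i k * Q $$ (k, i)) / e)"
  proof (intro sum.cong refl)
    fix k assume k: "k \<in> others"
    have "- (bv k * (e_tilde D k * \<eta> - c_tilde D k) / (x - node D k)) / (x - node D k) =
       - ((bv k / (x - node D k)) * ((e_tilde D k * \<eta> - c_tilde D k) / (x - node D k)))"
      by simp
    then show "- (bv k * (e_tilde D k * \<eta> - c_tilde D k) / (x - node D k)) / (x - node D k) =
       - (pick_entry D i k * Q $$ (k, i)) / e"
      unfolding bv_pick[OF k] inverse_entry[OF k] by simp
  qed
  also have "\<dots> = (\<gamma> * p - 1) / e"
    unfolding sum_divide_distrib[symmetric] sum_negf sum_others PQ_sum[OF i_less i_less]
    using i by (simp add: pick_entry_def p_eq)
  finally show ?thesis .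
qed

text \<open>Write \<open>v = u + \<eta>\<close> for the parameter and multiply numerator and
  denominator of the transform by \<open>t\<close>. Subtracting \<open>w0 + t * \<gamma>\<close>
  times the new denominator leaves \<open>t\<^sup>2 * (H z + A z * u)\<close> in the numerator.
  \<open>B\<close> is the lower left entry of Theta without its pole; \<open>S\<close> is the
  remainder of the part of the denominator that does not contain \<open>u\<close>.\<close>

definition "A = (\<lambda>z. ps (\<lambda>k. - (bv k * e_tilde D k / (x - node D k))) z - of_real \<gamma> * ps (\<lambda>k. Ev k * e_tilde D k) z)"
definition "B = ps (\<lambda>k. Ev k * e_tilde D k)"
definition "S = ps (\<lambda>k. - (Ev k * (e_tilde D k * \<eta> - c_tilde D k) / (x - node D k)))"
definition "H = (\<lambda>z. ps (\<lambda>k. - (bv k * (e_tilde D k * \<eta> - c_tilde D k) / (x - node D k))) z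
   - of_real \<gamma> * (1 + ps (\<lambda>k. Ev k * (e_tilde D k * \<eta> - c_tilde D k)) z))"

lemmas real_at_ps = real_at_pole_sum[OF finite_Diff[OF finite_lessThan] others_ne]

lemma real_at_H: "real_at x H (- 1 / e)"
proof -
  have "real_at x H ((\<gamma> * p - 1) / e - \<gamma> * (1 + (p / e - 1)))"
    unfolding H_def sum_H[symmetric] sum_Ev[symmetric]
    by (intro real_at_diff real_at_cmult real_at_add real_at_ps real_at_const[of x 1, unfolded of_real_1])
  then show ?thesis by (simp add: diff_divide_distrib)
qed

lemma Theta_local:
  assumes z: "Im z > 0"
  defines "t \<equiv> z - of_real x"
  defines "f1 \<equiv> ps (\<lambda>k. bv k * e_tilde D k) z" and "f2 \<equiv> ps (\<lambda>k. bv k * c_tilde D k) z"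
  defines "g1 \<equiv> ps (\<lambda>k. Ev k * e_tilde D k) z" and "g2 \<equiv> ps (\<lambda>k. Ev k * c_tilde D k) z"
  shows "Theta D z $$ (0, 0) = 1 + of_real (w0 * e) / t + f1 + of_real w0 * g1"
    "Theta D z $$ (0, 1) = - (of_real (w0 * (e * \<eta>)) / t + f2 + of_real w0 * g2)"
    "Theta D z $$ (1, 0) = of_real e / t + g1"
    "Theta D z $$ (1, 1) = 1 - (of_real (e * \<eta>) / t + g2)"
proof -
  have split: "pole_sum {..<n} (node D) b z = of_real (b i) / t + ps b z" for b
    unfolding pole_sum_def t_def using i_less by (intro sum.remove) auto
  have lin: "ps (\<lambda>k. Cv k * v k) z = ps (\<lambda>k. bv k * v k) z + of_real w0 * ps (\<lambda>k. Ev k * v k) z" for v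
    using pole_sum_linear[of others "node D" 1 "\<lambda>k. bv k * v k" w0 "\<lambda>k. Ev k * v k" z]
    by (simp add: bv_def algebra_simps)
  show "Theta D z $$ (0, 0) = 1 + of_real (w0 * e) / t + f1 + of_real w0 * g1"
    "Theta D z $$ (0, 1) = - (of_real (w0 * (e * \<eta>)) / t + f2 + of_real w0 * g2)"
    "Theta D z $$ (1, 0) = of_real e / t + g1"
    "Theta D z $$ (1, 1) = 1 - (of_real (e * \<eta>) / t + g2)"
    unfolding Theta_index[OF z] split lin f1_def f2_def g1_def g2_def eta_e
    by (simp_all add: Cv_i Ev_i)
qed

lemma node_model_transform:
  "node_model x \<eta> e p \<gamma> w0
     ((\<Sum>k\<in>others. - (bv k * e_tilde D k / (x - node D k)) / (x - node D k))
        - \<gamma> * (\<Sum>k\<in>others. Ev k * e_tilde D k / (x - node D k)))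
     (\<Sum>k\<in>others. Ev k * e_tilde D k / (x - node D k))
     (\<Sum>k\<in>others. - (Ev k * (e_tilde D k * \<eta> - c_tilde D k) / (x - node D k)) / (x - node D k))
     A B H S \<phi> (T_Theta D \<phi>)"
proof
  show "e \<noteq> 0" by (rule e_nz)
  show "real_at x A ((\<Sum>k\<in>others. - (bv k * e_tilde D k / (x - node D k)) / (x - node D k))
        - \<gamma> * (\<Sum>k\<in>others. Ev k * e_tilde D k / (x - node D k)))"
    unfolding A_def by (intro real_at_diff real_at_cmult real_at_ps)
  show "real_at x B (\<Sum>k\<in>others. Ev k * e_tilde D k / (x - node D k))"
    unfolding B_def by (intro real_at_ps)
  show "real_at x H (- 1 / e)" by (rule real_at_H)
  show "real_at x S (\<Sum>k\<in>others. - (Ev k * (e_tilde D k * \<eta> - c_tilde D k) / (x - node D k)) / (x - node D k))"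
    unfolding S_def by (intro real_at_ps)
  show "A holomorphic_on upper_half_plane" "B holomorphic_on upper_half_plane"
    "H holomorphic_on upper_half_plane" "S holomorphic_on upper_half_plane"
    unfolding A_def B_def H_def S_def by (intro holomorphic_intros pole_sum_holomorphic)+
next
  fix z v assume z: "Im z > 0" and v: "\<phi> z = Some v"
  define t where "t = z - of_real x"
  define u where "u = v - of_real \<eta>"
  have t: "t \<noteq> 0" using z by (auto simp: t_def)
  define f1 f2 g1 g2 where "f1 = ps (\<lambda>k. bv k * e_tilde D k) z" and "f2 = ps (\<lambda>k. bv k * c_tilde D k) z"
    and "g1 = ps (\<lambda>k. Ev k * e_tilde D k) z" and "g2 = ps (\<lambda>k. Ev k * c_tilde D k) z"
  define f1' f2' where "f1' = ps (\<lambda>k. - (bv k * e_tilde D k / (x - node D k))) z"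
    and "f2' = ps (\<lambda>k. - (bv k * c_tilde D k / (x - node D k))) z"
  note Th = Theta_local[OF z, folded t_def f1_def f2_def g1_def g2_def]
  \<comment> \<open>The constant terms of \<open>f1\<close> and \<open>f2\<close> make the terms of
    order \<open>t\<close> in the numerator combine into \<open>t * \<gamma>\<close> times the
    denominator.\<close>
  have f1: "f1 = of_real (\<gamma> * e - 1) + t * f1'"
    unfolding f1_def f1'_def t_def by (subst pole_sum_expand[OF others_ne z]) (simp_all only: sum_bv_e)
  have f2: "f2 = of_real (\<gamma> * (e * \<eta>) - w0) + t * f2'"
    unfolding f2_def f2'_def t_def by (subst pole_sum_expand[OF others_ne z]) (simp_all only: sum_bv_c)
  have g12: "ps (\<lambda>k. Ev k * (e_tilde D k * \<eta> - c_tilde D k)) z = of_real \<eta> * g1 - g2"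
    using pole_sum_linear[of others "node D" \<eta> "\<lambda>k. Ev k * e_tilde D k" "-1" "\<lambda>k. Ev k * c_tilde D k" z]
    by (simp add: g1_def g2_def algebra_simps)
  have G: "of_real (p / e) + t * S z = 1 + of_real \<eta> * g1 - g2"
  proof -
    have "of_real \<eta> * g1 - g2 = of_real (p / e - 1) + t * S z"
      unfolding g12[symmetric] S_def t_def by (subst pole_sum_expand[OF others_ne z]) (simp_all only: sum_Ev)
    then show ?thesis by (simp add: algebra_simps)
  qed
  have A: "A z = f1' - of_real \<gamma> * g1" by (simp add: A_def f1'_def g1_def)
  have B: "B z = g1" by (simp add: B_def g1_def)
  have "ps (\<lambda>k. - (bv k * (e_tilde D k * \<eta> - c_tilde D k) / (x - node D k))) z = of_real \<eta> * f1' - f2'"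
  proof -
    have "(\<lambda>k. - (bv k * (e_tilde D k * \<eta> - c_tilde D k) / (x - node D k))) =
        (\<lambda>k. \<eta> * - (bv k * e_tilde D k / (x - node D k)) + -1 * - (bv k * c_tilde D k / (x - node D k)))"
      by (rule ext) (simp add: right_diff_distrib diff_divide_distrib)
    then show ?thesis
      unfolding f1'_def f2'_def by (simp only: pole_sum_linear) simp
  qed
  then have H: "H z = of_real \<eta> * f1' - f2' - of_real \<gamma> * (1 + of_real \<eta> * g1 - g2)"
    by (simp add: H_def g12)
  define Q where "Q = of_real e * u + t * (of_real (p / e) + t * S z + B z * u)"
  define Den where "Den = Theta D z $$ (1, 0) * v + Theta D z $$ (1, 1)"
  define Num where "Num = Theta D z $$ (0, 0) * v + Theta D z $$ (0, 1)"
  have vu: "v = u + of_real \<eta>" by (simp add: u_def)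
  have Den: "Q = t * Den"
    unfolding Q_def G B Den_def Th vu using t by (simp add: field_simps)
  have Num: "t * Num = of_real w0 * Q + t * of_real \<gamma> * Q + t\<^sup>2 * (H z + A z * u)"
    unfolding Num_def Th Q_def G B A H vu f1 f2 using t by (simp add: field_simps power2_eq_square)
  have "Num / Den = (t * Num) / (t * Den)" using t by simp
  also have "\<dots> = of_real w0 + t * of_real \<gamma> + t\<^sup>2 * (H z + A z * u) / Q" if "Q \<noteq> 0"
    unfolding Num Den[symmetric] using that by (simp add: add_divide_distrib)
  finally have "T_Theta D \<phi> z = (if Q = 0 then None else Some (of_real w0 + t * of_real \<gamma> + t\<^sup>2 * (H z + A z * u) / Q))"
    using Den t by (simp add: T_Theta_def lin_frac_def v del: One_nat_def flip: Num_def Den_def)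
  then show "T_Theta D \<phi> z =
      (let t = z - of_real x; u = v - of_real \<eta>;
           Q = of_real e * u + t * (of_real (p / e) + t * S z + B z * u)
       in if Q = 0 then None else Some (of_real w0 + t * of_real \<gamma> + t\<^sup>2 * (H z + A z * u) / Q))"
    unfolding Let_def Q_def u_def t_def .
next
  \<comment> \<open>At infinity only the coefficients of \<open>v\<close> remain, so
    \<open>\<eta>\<close>, \<open>S\<close> and \<open>H\<close> drop out.\<close>
  fix z assume z: "Im z > 0" and v: "\<phi> z = None"
  define t where "t = z - of_real x"
  have t: "t \<noteq> 0" using z by (auto simp: t_def)
  define f1 g1 where "f1 = ps (\<lambda>k. bv k * e_tilde D k) z" and "g1 = ps (\<lambda>k. Ev k * e_tilde D k) z"
  define f1' where "f1' = ps (\<lambda>k. - (bv k * e_tilde D k / (x - node D k))) z"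
  note Th = Theta_local(1,3)[OF z, folded t_def f1_def g1_def]
  have f1: "f1 = of_real (\<gamma> * e - 1) + t * f1'"
    unfolding f1_def f1'_def t_def by (subst pole_sum_expand[OF others_ne z]) (simp_all only: sum_bv_e)
  have A: "A z = f1' - of_real \<gamma> * g1" by (simp add: A_def f1'_def g1_def)
  have B: "B z = g1" by (simp add: B_def g1_def)
  define Q where "Q = of_real e + t * B z"
  define Den where "Den = Theta D z $$ (1, 0)"
  define Num where "Num = Theta D z $$ (0, 0)"
  have Den: "Q = t * Den"
    unfolding Q_def B Den_def Th using t by (simp add: field_simps)
  have Num: "t * Num = of_real w0 * Q + t * of_real \<gamma> * Q + t\<^sup>2 * A z"
    unfolding Num_def Th Q_def B A f1 using t by (simp add: field_simps power2_eq_square)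
  have "Num / Den = (t * Num) / (t * Den)" using t by simp
  also have "\<dots> = of_real w0 + t * of_real \<gamma> + t\<^sup>2 * A z / Q" if "Q \<noteq> 0"
    unfolding Num Den[symmetric] using that by (simp add: add_divide_distrib)
  finally have "T_Theta D \<phi> z = (if Q = 0 then None else Some (of_real w0 + t * of_real \<gamma> + t\<^sup>2 * A z / Q))"
    using Den t by (simp add: T_Theta_def lin_frac_def v del: One_nat_def flip: Num_def Den_def)
  then show "T_Theta D \<phi> z =
      (let t = z - of_real x; Q = of_real e + t * B z
       in if Q = 0 then None else Some (of_real w0 + t * of_real \<gamma> + t\<^sup>2 * A z / Q))"
    unfolding Let_def Q_def t_def .
qed

end

theorem theorem2p6:
  fixes D :: interp_data and \<phi> w :: "complex \<Rightarrow> sphere" and i :: nat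
  assumes "valid_data D"
    and "invertible_mat (pick_matrix D)"
    and "\<phi> \<in> ext_nevanlinna"
    and "w = T_Theta D \<phi>"
    and "i < nreg D"
    and "e_tilde D i \<noteq> 0"
  shows "((bd_deriv w (node D i) (gam D i) \<and> bd_value w (node D i) (wval D i)) \<longleftrightarrow>
            (cond_C1 D \<phi> i \<or> cond_C2 D \<phi> i)) \<and>
         (((\<exists>d. bd_deriv w (node D i) d \<and> d < gam D i) \<and> bd_value w (node D i) (wval D i)) \<longleftrightarrow>
            cond_C3 D \<phi> i) \<and>
         (((\<exists>d. bd_deriv w (node D i) d \<and> gam D i < d) \<and> bd_value w (node D i) (wval D i)) \<longleftrightarrow>
            cond_C4 D \<phi> i) \<and>
         (cond_C5 D \<phi> i \<longrightarrow>
            \<not> (\<exists>L. nt_limit w (node D i) L) \<or>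
            (\<exists>L. nt_limit w (node D i) L \<and> L \<noteq> Some (complex_of_real (wval D i))) \<or>
            (bd_value w (node D i) (wval D i) \<and> bd_kernel_infinite w (node D i))) \<and>
         (cond_C6 D \<phi> i \<longrightarrow>
            (\<exists>L. nt_limit w (node D i) L \<and> L \<noteq> Some (complex_of_real (wval D i))))"
proof -
  interpret regular_node D i
    using assms by unfold_locales auto
  show ?thesis
    unfolding cond_C1_def cond_C2_def cond_C3_def cond_C4_def cond_C5_def cond_C6_def assms(4)
    by (rule node_model.node_classification[OF node_model_transform assms(3)])
qed

end
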